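(* Fix $0<r<1$. For an invertible operator $T\in B(H)$ on a Hilbert space $H$, the following are equivalent. (i) $T\in\mathbb{P}\mathbb{A}_r$; (ii) $T$ dilates to some $Y\in\mathbb{P}\mathbb{A}_r$; (iii) $T$ lifts to some $J\in\mathscr{P}\mathbb{A}_r$. Moreover, (a) if $J\in\mathscr{P}\mathbb{A}_r$, then $J$ is dilation extremal; that is, any dilation of $J$ to an element of $\mathbb{P}\mathbb{A}_r$ is trivial; (b) the collection $\mathscr{P}\mathbb{A}_r$ is closed with respect to arbitrary direct sums, unital $*$-representations and restrictions to reducing subspaces.
   Context: All operators are bounded operators on (complex) Hilbert spaces; $B(H)$ denotes the bounded operators on $H$. For an invertible operator $T$ write $T^{-*}=(T^{-1})^*$, and for self-adjoint $A$ write $A\succeq0$ if $A$ is positive semidefinite. Fix $0<r<1$. $\mathbb{P}\mathbb{A}_r$ is the collection of invertible Hilbert space operators $T$ satisfying $$\frac{1}{r^{-2}-r^2}\left(r^{-2}+r^2-T^*T-T^{-*}T^{-1}\right)\succeq 0.$$ $\mathscr{P}\mathbb{A}_r$ is the collection of Hilbert space operators $J$ that have, up to unitary equivalence, the form $$J=\begin{pmatrix} rV & \frac1r E\\ 0 & \frac1r W^*\end{pmatrix}=\begin{pmatrix} V & E\\ 0& W^*\end{pmatrix}\begin{pmatrix} rI_{K_{+1}}&0\\0&r^{-1}I_{K_{-1}}\end{pmatrix}$$ on a Hilbert space direct sum $K_{+1}\oplus K_{-1}$, where $U=\begin{pmatrix} V&E\\0&W^*\end{pmatrix}$ is unitary.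 (In particular $V$ and $W$ are isometries and $E$ is a partial isometry with initial space $\ker W^*$ and final space $\ker V^*$.) An invertible operator $T\in B(H)$ dilates to an invertible operator $Y\in B(K)$ if there is an isometry $V:H\to K$ such that $T^n=V^*Y^nV$ for all integers $n$ (positive, zero and negative). The dilation is trivial if the range of $V$ reduces $Y$ (i.e., is invariant for both $Y$ and $Y^*$). An operator $T\in B(H)$ lifts to an operator $J\in B(K)$ if there is an isometry $V:H\to K$ such that $VT=JV$. Closed with respect to unital $*$-representations means: if $J$ in the collection acts on $K$ and $\pi:B(K)\to B(G)$ is a unital $*$-representation on a Hilbert space $G$, then $\pi(J)$ is in the collection. *)

theory Defs
  imports "HOL-Analysis.Analysis" "HOL-Library.Function_Algebras"
begin

section \<open>Complex vector spaces\<close>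

class scaleC =
  fixes scaleC :: "complex \<Rightarrow> 'a \<Rightarrow> 'a" (infixr \<open>*\<^sub>C\<close> 75)

class complex_vector = ab_group_add + scaleC +
  assumes scaleC_add_right: "a *\<^sub>C (x + y) = a *\<^sub>C x + a *\<^sub>C y"
    and scaleC_add_left: "(a + b) *\<^sub>C x = a *\<^sub>C x + b *\<^sub>C x"
    and scaleC_scaleC: "a *\<^sub>C (b *\<^sub>C x) = (a * b) *\<^sub>C x"
    and scaleC_one: "1 *\<^sub>C x = x"

global_interpretation complex_vector: vector_space "scaleC :: complex \<Rightarrow> 'a \<Rightarrow> 'a::complex_vector"
  by unfold_locales (simp_all add: scaleC_add_right scaleC_add_left scaleC_scaleC scaleC_one)

instantiation "fun" :: (type, complex_vector) complex_vector
begin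

definition scaleC_fun_def: "c *\<^sub>C f = (\<lambda>x. c *\<^sub>C f x)"

instance
  by standard
    (simp_all add: scaleC_fun_def fun_eq_iff scaleC_add_right scaleC_add_left scaleC_scaleC scaleC_one)

end

instantiation prod :: (complex_vector, complex_vector) complex_vector
begin

definition scaleC_prod_def: "c *\<^sub>C p = (c *\<^sub>C fst p, c *\<^sub>C snd p)"

instance
  by standard
    (simp_all add: scaleC_prod_def prod_eq_iff scaleC_add_right scaleC_add_left scaleC_scaleC scaleC_one)

end


section \<open>Hilbert spaces\<close>

text \<open>
  A Hilbert space consists of a linear subspace \<open>carrier H\<close> of some complex vector space (a type of
  class \<open>complex_vector\<close>) together with its own inner product, whose values off the carrier are
  irrelevant. As Hilbert spaces are values and not types, one can quantify over them inside a
  formula and form direct sums of families and subspaces. Since the ambient type is an arbitrary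
  complex vector space, every abstract Hilbert space is covered. The zero space is allowed.
\<close>

record 'a chilbert =
  carrier :: "'a set"
  cinner :: "'a \<Rightarrow> 'a \<Rightarrow> complex"

definition hnorm :: "'a chilbert \<Rightarrow> 'a \<Rightarrow> real" where
  "hnorm H x = sqrt (Re (cinner H x x))"

definition inner_product_space :: "'a::complex_vector chilbert \<Rightarrow> bool" where
  "inner_product_space H \<longleftrightarrow>
     complex_vector.subspace (carrier H) \<and>
     (\<forall>x\<in>carrier H. \<forall>y\<in>carrier H. \<forall>z\<in>carrier H.
        cinner H (x + y) z = cinner H x z + cinner H y z) \<and>
     (\<forall>c. \<forall>x\<in>carrier H. \<forall>y\<in>carrier H. cinner H (c *\<^sub>C x) y = c * cinner H x y) \<and>
     (\<forall>x\<in>carrier H. \<forall>y\<in>carrier H. cinner H y x = cnj (cinner H x y)) \<and>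
     (\<forall>x\<in>carrier H. 0 \<le> Re (cinner H x x)) \<and>
     (\<forall>x\<in>carrier H. cinner H x x = 0 \<longrightarrow> x = 0)"

definition hilbert_space :: "'a::complex_vector chilbert \<Rightarrow> bool" where
  "hilbert_space H \<longleftrightarrow> inner_product_space H \<and>
     (\<forall>X. (\<forall>n. X n \<in> carrier H) \<and>
          (\<forall>e>0. \<exists>N. \<forall>m\<ge>N. \<forall>n\<ge>N. hnorm H (X m - X n) < e) \<longrightarrow>
          (\<exists>x\<in>carrier H. (\<lambda>n::nat. hnorm H (X n - x)) \<longlonglongrightarrow> 0))"

definition hprod :: "'a::complex_vector chilbert \<Rightarrow> 'b::complex_vector chilbert \<Rightarrow> ('a \<times> 'b) chilbert" where
  "hprod H K = \<lparr>carrier = carrier H \<times> carrier K,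
     cinner = (\<lambda>p q. cinner H (fst p) (fst q) + cinner K (snd p) (snd q))\<rparr>"

definition hsum :: "'i set \<Rightarrow> ('i \<Rightarrow> 'a::complex_vector chilbert) \<Rightarrow> ('i \<Rightarrow> 'a) chilbert" where
  "hsum I H = \<lparr>carrier = {f. (\<forall>i\<in>I. f i \<in> carrier (H i)) \<and> (\<forall>i. i \<notin> I \<longrightarrow> f i = 0) \<and>
                           (\<lambda>i. (hnorm (H i) (f i))\<^sup>2) summable_on I},
     cinner = (\<lambda>f g. \<Sum>\<^sub>\<infinity>i\<in>I. cinner (H i) (f i) (g i))\<rparr>"

definition closed_subspace :: "'a::complex_vector chilbert \<Rightarrow> 'a set \<Rightarrow> bool" where
  "closed_subspace H M \<longleftrightarrow> complex_vector.subspace M \<and> M \<subseteq> carrier H \<and>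
     (\<forall>X. \<forall>x\<in>carrier H.
        (\<forall>n. X n \<in> M) \<and> (\<lambda>n::nat. hnorm H (X n - x)) \<longlonglongrightarrow> 0 \<longrightarrow> x \<in> M)"

definition sub_hilbert :: "'a chilbert \<Rightarrow> 'a set \<Rightarrow> 'a chilbert" where
  "sub_hilbert H M = H\<lparr>carrier := M\<rparr>"


section \<open>Bounded operators\<close>

text \<open>
  Operators vanish off the carrier of their domain. Hence equality of operators is equality of
  functions, products are compositions, and sums and scalar multiples are the pointwise ones.
\<close>

definition bounded_ops :: "'a::complex_vector chilbert \<Rightarrow> 'b::complex_vector chilbert \<Rightarrow> ('a \<Rightarrow> 'b) set" where
  "bounded_ops H K = {T.
     (\<forall>x\<in>carrier H. T x \<in> carrier K) \<and>
     (\<forall>x. x \<notin> carrier H \<longrightarrow> T x = 0) \<and>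
     (\<forall>x\<in>carrier H. \<forall>y\<in>carrier H. T (x + y) = T x + T y) \<and>
     (\<forall>c. \<forall>x\<in>carrier H. T (c *\<^sub>C x) = c *\<^sub>C T x) \<and>
     (\<exists>B. \<forall>x\<in>carrier H. hnorm K (T x) \<le> B * hnorm H x)}"

definition id_op :: "'a::complex_vector chilbert \<Rightarrow> 'a \<Rightarrow> 'a" where
  "id_op H = (\<lambda>x. if x \<in> carrier H then x else 0)"

definition adj_op :: "'a::complex_vector chilbert \<Rightarrow> 'b::complex_vector chilbert \<Rightarrow> ('a \<Rightarrow> 'b) \<Rightarrow> 'b \<Rightarrow> 'a" where
  "adj_op H K T = (THE S. S \<in> bounded_ops K H \<and>
     (\<forall>x\<in>carrier H. \<forall>y\<in>carrier K. cinner K (T x) y = cinner H x (S y)))"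

definition invertible_op :: "'a::complex_vector chilbert \<Rightarrow> ('a \<Rightarrow> 'a) \<Rightarrow> bool" where
  "invertible_op H T \<longleftrightarrow> T \<in> bounded_ops H H \<and>
     (\<exists>S\<in>bounded_ops H H. S \<circ> T = id_op H \<and> T \<circ> S = id_op H)"

definition inv_op :: "'a::complex_vector chilbert \<Rightarrow> ('a \<Rightarrow> 'a) \<Rightarrow> 'a \<Rightarrow> 'a" where
  "inv_op H T = (THE S. S \<in> bounded_ops H H \<and> S \<circ> T = id_op H \<and> T \<circ> S = id_op H)"

definition powi_op :: "'a::complex_vector chilbert \<Rightarrow> ('a \<Rightarrow> 'a) \<Rightarrow> int \<Rightarrow> 'a \<Rightarrow> 'a" where
  "powi_op H T n = (if 0 \<le> n then (T ^^ nat n) \<circ> id_op H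
                    else (inv_op H T ^^ nat (- n)) \<circ> id_op H)"

definition psd :: "'a::complex_vector chilbert \<Rightarrow> ('a \<Rightarrow> 'a) \<Rightarrow> bool" where
  "psd H A \<longleftrightarrow> A \<in> bounded_ops H H \<and> adj_op H H A = A \<and>
     (\<forall>x\<in>carrier H. 0 \<le> Re (cinner H (A x) x))"

definition isometry :: "'a::complex_vector chilbert \<Rightarrow> 'b::complex_vector chilbert \<Rightarrow> ('a \<Rightarrow> 'b) \<Rightarrow> bool" where
  "isometry H K V \<longleftrightarrow> V \<in> bounded_ops H K \<and> (\<forall>x\<in>carrier H. hnorm K (V x) = hnorm H x)"

definition unitary_op :: "'a::complex_vector chilbert \<Rightarrow> 'b::complex_vector chilbert \<Rightarrow> ('a \<Rightarrow> 'b) \<Rightarrow> bool" where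
  "unitary_op H K U \<longleftrightarrow> isometry H K U \<and> U ` carrier H = carrier K"

definition restrict_op :: "'a set \<Rightarrow> ('a \<Rightarrow> 'b) \<Rightarrow> 'a \<Rightarrow> 'b::zero" where
  "restrict_op M T = (\<lambda>x. if x \<in> M then T x else 0)"

definition block_op :: "'a::complex_vector chilbert \<Rightarrow> 'b::complex_vector chilbert \<Rightarrow>
    ('a \<Rightarrow> 'a) \<Rightarrow> ('b \<Rightarrow> 'a) \<Rightarrow> ('a \<Rightarrow> 'b) \<Rightarrow> ('b \<Rightarrow> 'b) \<Rightarrow> 'a \<times> 'b \<Rightarrow> 'a \<times> 'b" where
  "block_op H K A B C D =
     restrict_op (carrier (hprod H K)) (\<lambda>(x, y). (A x + B y, C x + D y))"

definition sum_op :: "'i set \<Rightarrow> ('i \<Rightarrow> 'a::complex_vector chilbert) \<Rightarrow> ('i \<Rightarrow> 'a \<Rightarrow> 'a) \<Rightarrow>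
    ('i \<Rightarrow> 'a) \<Rightarrow> 'i \<Rightarrow> 'a" where
  "sum_op I H T = restrict_op (carrier (hsum I H)) (\<lambda>f i. if i \<in> I then T i (f i) else 0)"

definition reduces :: "'a::complex_vector chilbert \<Rightarrow> 'a set \<Rightarrow> ('a \<Rightarrow> 'a) \<Rightarrow> bool" where
  "reduces H M T \<longleftrightarrow> T ` M \<subseteq> M \<and> adj_op H H T ` M \<subseteq> M"

definition unital_star_rep :: "'a::complex_vector chilbert \<Rightarrow> 'b::complex_vector chilbert \<Rightarrow>
    (('a \<Rightarrow> 'a) \<Rightarrow> 'b \<Rightarrow> 'b) \<Rightarrow> bool" where
  "unital_star_rep K G \<pi> \<longleftrightarrow>
     (\<forall>A\<in>bounded_ops K K. \<pi> A \<in> bounded_ops G G) \<and>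
     (\<forall>A\<in>bounded_ops K K. \<forall>B\<in>bounded_ops K K. \<pi> (A + B) = \<pi> A + \<pi> B) \<and>
     (\<forall>c. \<forall>A\<in>bounded_ops K K. \<pi> (c *\<^sub>C A) = c *\<^sub>C \<pi> A) \<and>
     (\<forall>A\<in>bounded_ops K K. \<forall>B\<in>bounded_ops K K. \<pi> (A \<circ> B) = \<pi> A \<circ> \<pi> B) \<and>
     (\<forall>A\<in>bounded_ops K K. \<pi> (adj_op K K A) = adj_op G G (\<pi> A)) \<and>
     \<pi> (id_op K) = id_op G"


section \<open>Dilations and liftings\<close>

definition dilation :: "'a::complex_vector chilbert \<Rightarrow> ('a \<Rightarrow> 'a) \<Rightarrow>
    'b::complex_vector chilbert \<Rightarrow> ('b \<Rightarrow> 'b) \<Rightarrow> ('a \<Rightarrow> 'b) \<Rightarrow> bool" where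
  "dilation H T K Y V \<longleftrightarrow> invertible_op H T \<and> invertible_op K Y \<and> isometry H K V \<and>
     (\<forall>n::int. powi_op H T n = adj_op H K V \<circ> powi_op K Y n \<circ> V)"

definition dilates_to :: "'a::complex_vector chilbert \<Rightarrow> ('a \<Rightarrow> 'a) \<Rightarrow>
    'b::complex_vector chilbert \<Rightarrow> ('b \<Rightarrow> 'b) \<Rightarrow> bool" where
  "dilates_to H T K Y \<longleftrightarrow> (\<exists>V. dilation H T K Y V)"

definition trivial_dilation :: "'a::complex_vector chilbert \<Rightarrow>
    'b::complex_vector chilbert \<Rightarrow> ('b \<Rightarrow> 'b) \<Rightarrow> ('a \<Rightarrow> 'b) \<Rightarrow> bool" where
  "trivial_dilation H K Y V \<longleftrightarrow> reduces K (V ` carrier H) Y"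

definition lifts_to :: "'a::complex_vector chilbert \<Rightarrow> ('a \<Rightarrow> 'a) \<Rightarrow>
    'b::complex_vector chilbert \<Rightarrow> ('b \<Rightarrow> 'b) \<Rightarrow> bool" where
  "lifts_to H T K J \<longleftrightarrow> (\<exists>V. isometry H K V \<and> V \<circ> T = J \<circ> V)"


section \<open>The two classes of operators\<close>

text \<open>
  A class of operators on varying Hilbert spaces is given by its members on each space;
  \<open>PA\<close> is $\mathbb{P}\mathbb{A}_r$ and \<open>scrPA\<close> is $\mathscr{P}\mathbb{A}_r$.

  A quantifier over Hilbert spaces ranges over those in one ambient type. When spaces dilating or
  lifting an operator on a nonzero space \<open>H\<close> over \<open>'a\<close> are to be found, \<open>nat \<Rightarrow> 'a\<close> is a sufficiently
  large ambient type: it has room for the square-summable sequences in \<open>H\<close>, hence up to unitary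
  equivalence for all Hilbert spaces of dimension at most \<open>max \<aleph>\<^sub>0 (dim H)\<close>.
\<close>

definition PA :: "real \<Rightarrow> 'a::complex_vector chilbert \<Rightarrow> ('a \<Rightarrow> 'a) set" where
  "PA r H = {T. hilbert_space H \<and> invertible_op H T \<and>
     psd H (complex_of_real (1 / (1 / r\<^sup>2 - r\<^sup>2)) *\<^sub>C
       (complex_of_real (1 / r\<^sup>2 + r\<^sup>2) *\<^sub>C id_op H
          - (adj_op H H T \<circ> T)
          - (adj_op H H (inv_op H T) \<circ> inv_op H T)))}"

text \<open>
  The summands \<open>Kp\<close> and \<open>Km\<close> are taken over the same ambient type as \<open>K\<close>. This is no restriction:
  the unitary \<open>\<Phi>\<close> carries any decomposition to one into two orthogonal subspaces of \<open>K\<close>.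
\<close>

definition scrPA :: "real \<Rightarrow> 'a::complex_vector chilbert \<Rightarrow> ('a \<Rightarrow> 'a) set" where
  "scrPA r K = {J. hilbert_space K \<and> J \<in> bounded_ops K K \<and>
     (\<exists>(Kp :: 'a chilbert) (Km :: 'a chilbert) V E W \<Phi>.
        hilbert_space Kp \<and> hilbert_space Km \<and>
        V \<in> bounded_ops Kp Kp \<and> E \<in> bounded_ops Km Kp \<and> W \<in> bounded_ops Km Km \<and>
        unitary_op (hprod Kp Km) (hprod Kp Km) (block_op Kp Km V E 0 (adj_op Km Km W)) \<and>
        unitary_op K (hprod Kp Km) \<Phi> \<and>
        \<Phi> \<circ> J = block_op Kp Km
                  (complex_of_real r *\<^sub>C V) (complex_of_real (1 / r) *\<^sub>C E)
                  0                         (complex_of_real (1 / r) *\<^sub>C adj_op Km Km W) \<circ> \<Phi>)}"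

end

(*
  An operator J is in scrPA iff J = U (r P + (1/r) (1 - P)) for a unitary U and a projection P with
  P U P = U P. For such J the quadratic form of J* J + J^-* J^-1 is 1/r^2 + r^2 minus
  (1/r^2 - r^2) times the projection P - U P U*, so J is in PA, and compressions and restrictions
  to invariant subspaces inherit the inequality defining PA. The description by U and P uses only
  the *-algebra structure, which gives the permanence properties.

  Extremality: on the kernel of P - U P U* the inequality for J is an equality, so a dilation Y must
  agree with J there, and so must its positive defect form vanish there. This determines Y on the
  copy of the space, and for Y* it yields a recursion whose solutions grow geometrically by
  r <= |Y| <= 1/r, while the orbits of J on ran P and of J^-1 on ker P decay like r^n; hence the
  deviation of Y* from J* is zero.

  Lifting of T in PA: put k = 1/(1/r^2 - r^2), A = k (1/r^2 - T*T) and B = 1 - A, both positive.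
  The defining inequality says exactly that D = B/r^2 - T*BT = T*AT - r^2 A is positive. With
  factorizations A = a*a, B = b*b, D = d*d the maps b h / r -> (b T h, d h) and
  a T h -> (r a h, d h) are isometric. Extending both to unitaries and gluing them along the
  d-component gives a unitary U such that h -> (a h, b h) intertwines T with J.
*)

theory Submission
  imports Defs
begin

section \<open>Inner product spaces\<close>

text \<open>The operators A, B, D of the lifting are forced. In the model, J* J = r^2 P + (1/r^2) (1
  - P), so P = k (1/r^2 - J* J), and an isometry V intertwining T with J compresses P to A and 1 - P
  to B. The form of D is then the squared norm of the part of J V h that crosses from ker P into ran
  P through the corner E/r. Hence d is what the two halves exchange, and the two isometric relations
  describe it leaving one half and entering the other. The obstacle is unitarity: an isometry
  between subspaces extends to a unitary of the given spaces only if the orthogonal complements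
  match in dimension. Dimension counts are avoided by Halmos matrices, which double the space, and
  by infinitely many copies of the d-space, which absorb the summand left over. Square roots are
  avoided as well: positive operators are factored through a series, and partial isometries come
  from a Riesz argument on ranges. A Hilbert space lives in a fixed ambient type, so the lift is
  built over a nested product type and then carried to \<open>nat => 'a\<close> by an injective
  linear coding.\<close>

lemma hilbert_space_inner_product_space [simp]: "hilbert_space H \<Longrightarrow> inner_product_space H"
  by (simp add: hilbert_space_def)

context
  fixes H :: "'a::complex_vector chilbert"
  assumes ips: "inner_product_space H"
begin

lemma carrier_subspace [simp]: "complex_vector.subspace (carrier H)"
  using ips[unfolded inner_product_space_def, THEN conjunct1] by blast

lemma carrier_zero [simp]: "0 \<in> carrier H"
  by (simp add: complex_vector.subspace_0)

lemma carrier_add [simp]: "x \<in> carrier H \<Longrightarrow> y \<in> carrier H \<Longrightarrow> x + y \<in> carrier H"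
  by (simp add: complex_vector.subspace_add)

lemma carrier_diff [simp]: "x \<in> carrier H \<Longrightarrow> y \<in> carrier H \<Longrightarrow> x - y \<in> carrier H"
  by (simp add: complex_vector.subspace_diff)

lemma carrier_scale [simp]: "x \<in> carrier H \<Longrightarrow> c *\<^sub>C x \<in> carrier H"
  by (simp add: complex_vector.subspace_scale)

lemma carrier_minus [simp]: "x \<in> carrier H \<Longrightarrow> - x \<in> carrier H"
  by (simp add: complex_vector.subspace_neg)

lemma cinner_add_left:
  "x \<in> carrier H \<Longrightarrow> y \<in> carrier H \<Longrightarrow> z \<in> carrier H \<Longrightarrow>
     cinner H (x + y) z = cinner H x z + cinner H y z"
  using ips[unfolded inner_product_space_def, THEN conjunct2, THEN conjunct1] by blast

lemma cinner_scale_left: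
  "x \<in> carrier H \<Longrightarrow> y \<in> carrier H \<Longrightarrow> cinner H (c *\<^sub>C x) y = c * cinner H x y"
  using ips[unfolded inner_product_space_def, THEN conjunct2, THEN conjunct2, THEN conjunct1] by blast

lemma cinner_commute: "x \<in> carrier H \<Longrightarrow> y \<in> carrier H \<Longrightarrow> cinner H y x = cnj (cinner H x y)"
  using ips[unfolded inner_product_space_def, THEN conjunct2, THEN conjunct2, THEN conjunct2, THEN conjunct1] by blast

lemma Re_cinner_commute: "x \<in> carrier H \<Longrightarrow> y \<in> carrier H \<Longrightarrow> Re (cinner H y x) = Re (cinner H x y)"
  by (simp add: cinner_commute[of x y])

lemma cinner_ge_zero: "x \<in> carrier H \<Longrightarrow> 0 \<le> Re (cinner H x x)"
  using ips[unfolded inner_product_space_def, THEN conjunct2, THEN conjunct2, THEN conjunct2, THEN conjunct2, THEN conjunct1] by blast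

lemma cinner_add_right:
  "x \<in> carrier H \<Longrightarrow> y \<in> carrier H \<Longrightarrow> z \<in> carrier H \<Longrightarrow>
     cinner H z (x + y) = cinner H z x + cinner H z y"
  by (simp add: cinner_commute[of _ z] cinner_add_left)

lemma cinner_scale_right:
  "x \<in> carrier H \<Longrightarrow> y \<in> carrier H \<Longrightarrow> cinner H y (c *\<^sub>C x) = cnj c * cinner H y x"
  by (simp add: cinner_commute[of _ y] cinner_scale_left)

lemma cinner_minus_left: "x \<in> carrier H \<Longrightarrow> y \<in> carrier H \<Longrightarrow> cinner H (- x) y = - cinner H x y"
  using cinner_scale_left[of x y "-1"] by (simp add: complex_vector.scale_minus_left)

lemma cinner_minus_right: "x \<in> carrier H \<Longrightarrow> y \<in> carrier H \<Longrightarrow> cinner H y (- x) = - cinner H y x"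
  using cinner_scale_right[of x y "-1"] by (simp add: complex_vector.scale_minus_left)

lemma cinner_diff_left:
  "x \<in> carrier H \<Longrightarrow> y \<in> carrier H \<Longrightarrow> z \<in> carrier H \<Longrightarrow>
     cinner H (x - y) z = cinner H x z - cinner H y z"
  using cinner_add_left[of x "- y" z] by (simp add: cinner_minus_left)

lemma cinner_diff_right:
  "x \<in> carrier H \<Longrightarrow> y \<in> carrier H \<Longrightarrow> z \<in> carrier H \<Longrightarrow>
     cinner H z (x - y) = cinner H z x - cinner H z y"
  using cinner_add_right[of x "- y" z] by (simp add: cinner_minus_right)

lemma cinner_zero_left [simp]: "x \<in> carrier H \<Longrightarrow> cinner H 0 x = 0"
  using cinner_scale_left[of 0 x 0] by simp

lemma cinner_zero_right [simp]: "x \<in> carrier H \<Longrightarrow> cinner H x 0 = 0"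
  using cinner_scale_right[of 0 x 0] by simp

lemmas cinner_linear = cinner_add_left cinner_add_right cinner_diff_left cinner_diff_right
  cinner_minus_left cinner_minus_right cinner_scale_left cinner_scale_right

lemma hnorm_nonneg [simp]: "x \<in> carrier H \<Longrightarrow> 0 \<le> hnorm H x"
  by (simp add: hnorm_def cinner_ge_zero)

lemma hnorm_power2: "x \<in> carrier H \<Longrightarrow> (hnorm H x)\<^sup>2 = Re (cinner H x x)"
  by (simp add: hnorm_def cinner_ge_zero)

lemma cinner_self: "x \<in> carrier H \<Longrightarrow> cinner H x x = of_real ((hnorm H x)\<^sup>2)"
  using cinner_commute[of x x] by (simp add: hnorm_power2 complex_eq_iff)

lemma hnorm_eq_zero [simp]: "x \<in> carrier H \<Longrightarrow> hnorm H x = 0 \<longleftrightarrow> x = 0"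
proof
  assume x: "x \<in> carrier H" and "hnorm H x = 0"
  then have "cinner H x x = 0" by (simp add: cinner_self)
  then show "x = 0" using ips[unfolded inner_product_space_def, THEN conjunct2, THEN conjunct2, THEN conjunct2, THEN conjunct2, THEN conjunct2] x by blast
qed (simp add: hnorm_def)

lemma hnorm_zero [simp]: "hnorm H 0 = 0"
  by simp

lemma hnorm_scale: "x \<in> carrier H \<Longrightarrow> hnorm H (c *\<^sub>C x) = cmod c * hnorm H x"
proof (rule power2_eq_imp_eq)
  assume x: "x \<in> carrier H"
  have "cinner H (c *\<^sub>C x) (c *\<^sub>C x) = (c * cnj c) * cinner H x x"
    using x by (simp add: cinner_linear mult.assoc)
  then have "cinner H (c *\<^sub>C x) (c *\<^sub>C x) = of_real ((cmod c)\<^sup>2 * (hnorm H x)\<^sup>2)"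
    using x by (simp only: complex_norm_square cinner_self of_real_mult)
  then show "(hnorm H (c *\<^sub>C x))\<^sup>2 = (cmod c * hnorm H x)\<^sup>2"
    using x by (simp add: hnorm_power2[of "c *\<^sub>C x"] power_mult_distrib)
qed auto

lemma hnorm_minus [simp]: "x \<in> carrier H \<Longrightarrow> hnorm H (- x) = hnorm H x"
  using hnorm_scale[of x "-1"] by (simp add: complex_vector.scale_minus_left)

lemma hnorm_minus_commute: "x \<in> carrier H \<Longrightarrow> y \<in> carrier H \<Longrightarrow> hnorm H (x - y) = hnorm H (y - x)"
  using hnorm_minus[of "x - y"] by simp

lemma hnorm_power2_add:
  "x \<in> carrier H \<Longrightarrow> y \<in> carrier H \<Longrightarrow>
     (hnorm H (x + y))\<^sup>2 = (hnorm H x)\<^sup>2 + 2 * Re (cinner H x y) + (hnorm H y)\<^sup>2"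
  by (simp add: hnorm_power2 cinner_linear Re_cinner_commute[of x y])

lemma hnorm_power2_diff:
  "x \<in> carrier H \<Longrightarrow> y \<in> carrier H \<Longrightarrow>
     (hnorm H (x - y))\<^sup>2 = (hnorm H x)\<^sup>2 - 2 * Re (cinner H x y) + (hnorm H y)\<^sup>2"
  by (simp add: hnorm_power2 cinner_linear Re_cinner_commute[of x y])

lemma parallelogram_law:
  "x \<in> carrier H \<Longrightarrow> y \<in> carrier H \<Longrightarrow>
     (hnorm H (x + y))\<^sup>2 + (hnorm H (x - y))\<^sup>2 = 2 * (hnorm H x)\<^sup>2 + 2 * (hnorm H y)\<^sup>2"
  by (simp add: hnorm_power2_add hnorm_power2_diff)

lemma Cauchy_Schwarz:
  assumes x: "x \<in> carrier H" and y: "y \<in> carrier H"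
  shows "cmod (cinner H x y) \<le> hnorm H x * hnorm H y"
proof (cases "y = 0")
  case False
  define n where "n = (hnorm H y)\<^sup>2"
  have n: "n > 0" using False y by (simp add: n_def)
  define c where "c = cinner H x y"
  have "0 \<le> (hnorm H (x - (c / n) *\<^sub>C y))\<^sup>2" by simp
  also have "\<dots> = (hnorm H x)\<^sup>2 - 2 * Re (cnj (c / n) * c) + (cmod (c / n))\<^sup>2 * n"
    using x y by (simp add: hnorm_power2_diff cinner_linear hnorm_scale c_def n_def power_mult_distrib)
  also have "cnj (c / n) * c = of_real ((cmod c)\<^sup>2 / n)"
    using complex_norm_square[of c] by (simp add: mult.commute)
  also have "(cmod (c / n))\<^sup>2 * n = (cmod c)\<^sup>2 / n"
    using n by (simp add: norm_divide power2_eq_square)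
  finally have "(cmod c)\<^sup>2 / n \<le> (hnorm H x)\<^sup>2" by simp
  then have "(cmod c)\<^sup>2 \<le> (hnorm H x * hnorm H y)\<^sup>2"
    using n by (simp add: pos_divide_le_eq n_def power_mult_distrib)
  then show ?thesis using x y by (simp add: c_def power2_le_iff_abs_le)
qed (use x in simp)

lemma Re_Cauchy_Schwarz:
  "x \<in> carrier H \<Longrightarrow> y \<in> carrier H \<Longrightarrow> Re (cinner H x y) \<le> hnorm H x * hnorm H y"
  using Cauchy_Schwarz complex_Re_le_cmod order_trans by blast

lemma hnorm_triangle:
  assumes x: "x \<in> carrier H" and y: "y \<in> carrier H"
  shows "hnorm H (x + y) \<le> hnorm H x + hnorm H y"
proof (rule power2_le_imp_le)
  show "(hnorm H (x + y))\<^sup>2 \<le> (hnorm H x + hnorm H y)\<^sup>2"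
    using Re_Cauchy_Schwarz[OF x y] x y by (simp add: hnorm_power2_add power2_sum)
qed (use x y in simp)

lemma hnorm_triangle_diff:
  assumes "x \<in> carrier H" and "y \<in> carrier H"
  shows "hnorm H (x - y) \<le> hnorm H x + hnorm H y"
  using hnorm_triangle[of x "- y"] assms by simp

lemma hnorm_triangle_sub:
  assumes "x \<in> carrier H" and "y \<in> carrier H" and "z \<in> carrier H"
  shows "hnorm H (x - z) \<le> hnorm H (x - y) + hnorm H (y - z)"
  using hnorm_triangle[of "x - y" "y - z"] assms by simp

lemma hnorm_power2_add_le:
  assumes x: "x \<in> carrier H" and y: "y \<in> carrier H"
  shows "(hnorm H (x + y))\<^sup>2 \<le> 2 * (hnorm H x)\<^sup>2 + 2 * (hnorm H y)\<^sup>2"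
  using parallelogram_law[OF x y] zero_le_power2[of "hnorm H (x - y)"] by linarith

lemma eq_zeroI: "x \<in> carrier H \<Longrightarrow> (\<And>y. y \<in> carrier H \<Longrightarrow> cinner H x y = 0) \<Longrightarrow> x = 0"
  using cinner_self[of x] by auto

lemma eqI_cinner:
  assumes "x \<in> carrier H" "y \<in> carrier H" "\<And>z. z \<in> carrier H \<Longrightarrow> cinner H z x = cinner H z y"
  shows "x = y"
proof -
  have "cinner H (x - y) z = 0" if "z \<in> carrier H" for z
    using assms(3)[OF that] that assms(1,2) cinner_commute[of z x] cinner_commute[of z y]
    by (simp add: cinner_linear)
  then show ?thesis using eq_zeroI[of "x - y"] assms(1,2) by simp
qed

lemma tendsto_cinner:
  assumes X: "\<And>n. X n \<in> carrier H" and x: "x \<in> carrier H" and y: "y \<in> carrier H"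
    and lim: "(\<lambda>n::nat. hnorm H (X n - x)) \<longlonglongrightarrow> 0"
  shows "(\<lambda>n. cinner H y (X n)) \<longlonglongrightarrow> cinner H y x"
proof -
  have "(\<lambda>n. cinner H y (X n) - cinner H y x) \<longlonglongrightarrow> 0"
  proof (rule tendsto_0_le[OF lim])
    show "\<forall>\<^sub>F n in sequentially. norm (cinner H y (X n) - cinner H y x) \<le> norm (hnorm H (X n - x)) * hnorm H y"
      using Cauchy_Schwarz[OF y, of "X n - x" for n] X x y
      by (auto simp: cinner_linear mult.commute)
  qed
  then show ?thesis by (simp add: LIM_zero_iff)
qed

lemma tendsto_hnorm:
  assumes X: "\<And>n. X n \<in> carrier H" and x: "x \<in> carrier H"
    and lim: "(\<lambda>n::nat. hnorm H (X n - x)) \<longlonglongrightarrow> 0"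
  shows "(\<lambda>n. hnorm H (X n)) \<longlonglongrightarrow> hnorm H x"
proof -
  have "\<bar>hnorm H (X n) - hnorm H x\<bar> \<le> hnorm H (X n - x)" for n
    using hnorm_triangle[of "X n - x" x] hnorm_triangle[of "x - X n" "X n"]
      hnorm_minus_commute[of x "X n"] X[of n] x by simp
  then have "(\<lambda>n. hnorm H (X n) - hnorm H x) \<longlonglongrightarrow> 0"
    by (intro tendsto_0_le[OF lim, where K = 1]) (use X x in auto)
  then show ?thesis by (simp add: LIM_zero_iff)
qed

end

lemma hilbert_space_complete:
  assumes "hilbert_space H" "\<And>n. X n \<in> carrier H"
    and "\<And>e. e > 0 \<Longrightarrow> \<exists>N. \<forall>m\<ge>N. \<forall>n\<ge>N. hnorm H (X m - X n) < e"
  obtains x where "x \<in> carrier H" "(\<lambda>n::nat. hnorm H (X n - x)) \<longlonglongrightarrow> 0"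
proof -
  have "\<exists>x\<in>carrier H. (\<lambda>n::nat. hnorm H (X n - x)) \<longlonglongrightarrow> 0"
    by (rule assms(1)[unfolded hilbert_space_def, THEN conjunct2, rule_format]) (use assms(2,3) in auto)
  then show thesis using that by blast
qed

text \<open>Polarization reduces inner products to norms, first for the real part and then, replacing
  a vector by \<open>\<i>\<close> times it, for the imaginary part.\<close>

lemma cinner_preserved_if_hnorm_preserved:
  assumes "inner_product_space H" "inner_product_space K"
    and S: "complex_vector.subspace S" "S \<subseteq> carrier H'"
    and a: "\<And>x. x \<in> S \<Longrightarrow> a x \<in> carrier H" "\<And>x. x \<in> S \<Longrightarrow> b x \<in> carrier K"
    and add: "\<And>x y. x \<in> S \<Longrightarrow> y \<in> S \<Longrightarrow> a (x + y) = a x + a y"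
      "\<And>x y. x \<in> S \<Longrightarrow> y \<in> S \<Longrightarrow> b (x + y) = b x + b y"
    and scale: "\<And>c x. x \<in> S \<Longrightarrow> a (c *\<^sub>C x) = c *\<^sub>C a x" "\<And>c x. x \<in> S \<Longrightarrow> b (c *\<^sub>C x) = c *\<^sub>C b x"
    and eq: "\<And>x. x \<in> S \<Longrightarrow> hnorm H (a x) = hnorm K (b x)"
    and x: "x \<in> S" and y: "y \<in> S"
  shows "cinner H (a x) (a y) = cinner K (b x) (b y)"
proof -
  have Re: "Re (cinner H (a x) (a y)) = Re (cinner K (b x) (b y))" if "y \<in> S" for y
  proof -
    have "x + y \<in> S" using S x that by (simp add: complex_vector.subspace_add)
    then show ?thesis
      using eq[of "x + y"] eq[OF x] eq[OF that] add x that a assms(1,2)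
        hnorm_power2_add[of H "a x" "a y"] hnorm_power2_add[of K "b x" "b y"] by simp
  qed
  have "\<i> *\<^sub>C y \<in> S" using S y by (simp add: complex_vector.subspace_scale)
  from Re[OF this] have "Im (cinner H (a x) (a y)) = Im (cinner K (b x) (b y))"
    using x y a scale assms(1,2) by (simp add: cinner_scale_right)
  with Re[OF y] show ?thesis by (simp add: complex_eq_iff)
qed

section \<open>Bounded operators\<close>

lemma bounded_opsI:
  assumes "\<And>x. x \<in> carrier H \<Longrightarrow> T x \<in> carrier K"
    and "\<And>x. x \<notin> carrier H \<Longrightarrow> T x = 0"
    and "\<And>x y. x \<in> carrier H \<Longrightarrow> y \<in> carrier H \<Longrightarrow> T (x + y) = T x + T y"
    and "\<And>c x. x \<in> carrier H \<Longrightarrow> T (c *\<^sub>C x) = c *\<^sub>C T x"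
    and "\<And>x. x \<in> carrier H \<Longrightarrow> hnorm K (T x) \<le> B * hnorm H x"
  shows "T \<in> bounded_ops H K"
  using assms unfolding bounded_ops_def by blast

context
  fixes H :: "'a::complex_vector chilbert" and K :: "'b::complex_vector chilbert" and T
  assumes ips: "inner_product_space H" "inner_product_space K"
    and T: "T \<in> bounded_ops H K"
begin

lemma op_closed: "x \<in> carrier H \<Longrightarrow> T x \<in> carrier K"
  and op_outside: "x \<notin> carrier H \<Longrightarrow> T x = 0"
  and op_add: "x \<in> carrier H \<Longrightarrow> y \<in> carrier H \<Longrightarrow> T (x + y) = T x + T y"
  and op_scale: "x \<in> carrier H \<Longrightarrow> T (c *\<^sub>C x) = c *\<^sub>C T x"
  using T by (auto simp: bounded_ops_def)

lemma op_zero: "T 0 = 0"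
  using op_scale[of 0 0] ips by simp

lemma op_minus: "x \<in> carrier H \<Longrightarrow> T (- x) = - T x"
  using op_scale[of x "-1"] by (simp add: complex_vector.scale_minus_left)

lemma op_diff: "x \<in> carrier H \<Longrightarrow> y \<in> carrier H \<Longrightarrow> T (x - y) = T x - T y"
  using op_add[of x "- y"] ips by (simp add: op_minus)

lemmas op_linear = op_closed op_add op_scale op_zero op_minus op_diff

lemma op_bound: obtains B where "B > 0" "\<And>x. x \<in> carrier H \<Longrightarrow> hnorm K (T x) \<le> B * hnorm H x"
proof -
  obtain B where B: "\<And>x. x \<in> carrier H \<Longrightarrow> hnorm K (T x) \<le> B * hnorm H x"
    using T unfolding bounded_ops_def mem_Collect_eq by (elim conjE exE) (rule that, rule bspec)
  \<comment> \<open>The bound in \<open>bounded_ops\<close> may be 0, and even negative on the zero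
    space; a strictly positive one can be divided by later.\<close>
  have "hnorm K (T x) \<le> (\<bar>B\<bar> + 1) * hnorm H x" if "x \<in> carrier H" for x
  proof (rule order_trans[OF B[OF that]])
    show "B * hnorm H x \<le> (\<bar>B\<bar> + 1) * hnorm H x"
      using ips that by (intro mult_right_mono) auto
  qed
  moreover have "\<bar>B\<bar> + 1 > 0" by simp
  ultimately show thesis by (rule that[rotated])
qed

end

lemma bounded_ops_eqI:
  "S \<in> bounded_ops H K \<Longrightarrow> T \<in> bounded_ops H K \<Longrightarrow> (\<And>x. x \<in> carrier H \<Longrightarrow> S x = T x) \<Longrightarrow> S = T"
proof (rule ext)
  fix x
  assume S: "S \<in> bounded_ops H K" and T: "T \<in> bounded_ops H K"
    and eq: "\<And>x. x \<in> carrier H \<Longrightarrow> S x = T x"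
  note outside = S[unfolded bounded_ops_def mem_Collect_eq, THEN conjunct2, THEN conjunct1, rule_format]
    T[unfolded bounded_ops_def mem_Collect_eq, THEN conjunct2, THEN conjunct1, rule_format]
  show "S x = T x" using eq outside[of x] by (cases "x \<in> carrier H") auto
qed

lemma id_op_apply [simp]: "x \<in> carrier H \<Longrightarrow> id_op H x = x"
  by (simp add: id_op_def)

lemma id_op_bounded [simp]: "inner_product_space H \<Longrightarrow> id_op H \<in> bounded_ops H H"
  by (rule bounded_opsI[where B = 1]) (auto simp: id_op_def)

lemma comp_bounded:
  assumes "inner_product_space G" "inner_product_space H" "inner_product_space K"
    and S: "S \<in> bounded_ops H K" and T: "T \<in> bounded_ops G H"
  shows "S \<circ> T \<in> bounded_ops G K"
proof -
  note [simp] = op_linear[OF assms(2,3) S] op_linear[OF assms(1,2) T]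
  obtain B where B: "B > 0" "\<And>x. x \<in> carrier H \<Longrightarrow> hnorm K (S x) \<le> B * hnorm H x"
    by (rule op_bound[OF assms(2,3) S], rule that)
  obtain C where C: "C > 0" "\<And>x. x \<in> carrier G \<Longrightarrow> hnorm H (T x) \<le> C * hnorm G x"
    by (rule op_bound[OF assms(1,2) T], rule that)
  show ?thesis
  proof (rule bounded_opsI[where B = "B * C"])
    show "hnorm K ((S \<circ> T) x) \<le> B * C * hnorm G x" if "x \<in> carrier G" for x
      using order_trans[OF B(2)[of "T x"] mult_left_mono[OF C(2)[OF that], of B]] B(1) that
      by (simp add: mult.assoc)
  qed (auto simp: op_outside[OF assms(1,2) T])
qed

lemma add_bounded:
  assumes "inner_product_space H" "inner_product_space K"
    and S: "S \<in> bounded_ops H K" and T: "T \<in> bounded_ops H K"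
  shows "S + T \<in> bounded_ops H K"
proof -
  note [simp] = op_linear[OF assms(1,2) S] op_linear[OF assms(1,2) T] assms(1,2)
  obtain B where B: "B > 0" "\<And>x. x \<in> carrier H \<Longrightarrow> hnorm K (S x) \<le> B * hnorm H x"
    by (rule op_bound[OF assms(1,2) S], rule that)
  obtain C where C: "C > 0" "\<And>x. x \<in> carrier H \<Longrightarrow> hnorm K (T x) \<le> C * hnorm H x"
    by (rule op_bound[OF assms(1,2) T], rule that)
  show ?thesis
  proof (rule bounded_opsI[where B = "B + C"])
    show "hnorm K ((S + T) x) \<le> (B + C) * hnorm H x" if x: "x \<in> carrier H" for x
      using order_trans[OF hnorm_triangle[of K "S x" "T x"] add_mono[OF B(2)[OF x] C(2)[OF x]]] x
      by (simp add: distrib_right)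
  qed (auto simp: op_outside[OF assms(1,2) T] op_outside[OF assms(1,2) S] scaleC_add_right)
qed

lemma scaleC_bounded:
  assumes "inner_product_space H" "inner_product_space K" and T: "T \<in> bounded_ops H K"
  shows "c *\<^sub>C T \<in> bounded_ops H K"
proof -
  note [simp] = op_linear[OF assms(1,2) T] assms(1,2)
  obtain C where C: "C > 0" "\<And>x. x \<in> carrier H \<Longrightarrow> hnorm K (T x) \<le> C * hnorm H x"
    by (rule op_bound[OF assms(1,2) T], rule that)
  show ?thesis
  proof (rule bounded_opsI[where B = "cmod c * C"])
    show "hnorm K ((c *\<^sub>C T) x) \<le> cmod c * C * hnorm H x" if x: "x \<in> carrier H" for x
      using mult_left_mono[OF C(2)[OF x], of "cmod c"] x
      by (simp add: scaleC_fun_def hnorm_scale mult.assoc)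
  qed (auto simp: op_outside[OF assms(1,2) T] scaleC_fun_def scaleC_add_right scaleC_scaleC mult.commute)
qed

lemma diff_bounded:
  assumes "inner_product_space H" "inner_product_space K"
    and S: "S \<in> bounded_ops H K" and T: "T \<in> bounded_ops H K"
  shows "S - T \<in> bounded_ops H K"
proof -
  have eq: "S - T = S + (-1) *\<^sub>C T"
    by (simp add: fun_eq_iff scaleC_fun_def complex_vector.scale_minus_left)
  show ?thesis unfolding eq by (rule add_bounded[OF assms(1,2) S scaleC_bounded[OF assms(1,2) T]])
qed

section \<open>Riesz representation and adjoints\<close>

text \<open>The first-order condition at a minimum: a quadratic that is nonnegative near its zero at
  t = 0 has no linear term. It supplies the variational step of the Riesz argument.\<close>

lemma linear_coefficient_eq_zero:
  fixes s N :: real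
  assumes N: "0 \<le> N" and quadratic_nonneg: "\<And>t. 0 \<le> 2 * t * s + t\<^sup>2 * N"
  shows "s = 0"
proof (rule ccontr)
  assume s: "s \<noteq> 0"
  \<comment> \<open>The minimizer is t = -s/N; using N + 1 instead keeps the quotient defined for N
    = 0 and still gives a negative value.\<close>
  have "0 \<le> 2 * (- s / (N + 1)) * s + (- s / (N + 1))\<^sup>2 * N" by (rule quadratic_nonneg)
  also have "\<dots> = - (s\<^sup>2 * (N + 2)) / (N + 1)\<^sup>2"
  proof -
    have "N + 1 \<noteq> 0" using N by simp
    then show ?thesis by (simp add: divide_simps) (simp add: algebra_simps power2_eq_square)
  qed
  finally have "s\<^sup>2 * (N + 2) \<le> 0"
    using N by (simp add: divide_le_0_iff)
  then show False using N s by (simp add: mult_le_0_iff)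
qed

text \<open>The form in which \<open>f\<close> is a functional on the range of \<open>b\<close> covers the Riesz representation
  theorem, orthogonal projections and the extension of isometries to a closure at once; the
  representing vector minimizes \<open>\<parallel>b h\<parallel>\<^sup>2 - 2 Re (f h)\<close>.\<close>

lemma Riesz_closure_range:
  assumes M: "hilbert_space M" and S: "complex_vector.subspace S"
    and b: "\<And>h. h \<in> S \<Longrightarrow> b h \<in> carrier M"
      "\<And>h k. h \<in> S \<Longrightarrow> k \<in> S \<Longrightarrow> b (h + k) = b h + b k" "\<And>c h. h \<in> S \<Longrightarrow> b (c *\<^sub>C h) = c *\<^sub>C b h"
    and f: "\<And>h k. h \<in> S \<Longrightarrow> k \<in> S \<Longrightarrow> f (h + k) = f h + f k" "\<And>c h. h \<in> S \<Longrightarrow> f (c *\<^sub>C h) = c * f h"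
    and bound: "\<And>h. h \<in> S \<Longrightarrow> cmod (f h) \<le> C * hnorm M (b h)"
  obtains y X where "y \<in> carrier M" "\<And>n. X n \<in> S" "(\<lambda>n::nat. hnorm M (b (X n) - y)) \<longlonglongrightarrow> 0"
    "\<And>h. h \<in> S \<Longrightarrow> f h = cinner M (b h) y"
proof -
  have [simp]: "inner_product_space M" using M by simp
  have S_add [simp]: "h + k \<in> S" if "h \<in> S" "k \<in> S" for h k
    using S that by (simp add: complex_vector.subspace_add)
  have S_scale [simp]: "c *\<^sub>C h \<in> S" if "h \<in> S" for c h
    using S that by (simp add: complex_vector.subspace_scale)
  define q where "q h = (hnorm M (b h))\<^sup>2 - 2 * Re (f h)" for h
  define d where "d = Inf (q ` S)"
  \<comment> \<open>Completing the square in the norm of \<open>b h\<close> bounds the functional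
    below.\<close>
  have lower: "- C\<^sup>2 \<le> q h" if "h \<in> S" for h
  proof -
    have "Re (f h) \<le> C * hnorm M (b h)"
      using bound[OF that] complex_Re_le_cmod order_trans by blast
    moreover have "0 \<le> (hnorm M (b h) - C)\<^sup>2" by simp
    ultimately show ?thesis unfolding q_def power2_diff by (simp add: mult.commute)
  qed
  then have bdd: "bdd_below (q ` S)" by (intro bdd_belowI[where m = "- C\<^sup>2"]) auto
  have d_le: "d \<le> q h" if "h \<in> S" for h
    unfolding d_def using bdd that by (intro cInf_lower) auto
  have "\<exists>h\<in>S. q h < d + 1 / (real n + 1)" for n
  proof -
    have "Inf (q ` S) < d + 1 / (real n + 1)" by (simp add: d_def)
    moreover have "q ` S \<noteq> {}" using complex_vector.subspace_0[OF S] by blast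
    ultimately obtain v where "v \<in> q ` S" "v < d + 1 / (real n + 1)"
      using cInf_lessD[of "q ` S" "d + 1 / (real n + 1)"] by auto
    then show ?thesis by auto
  qed
  then obtain X where X: "\<And>n. X n \<in> S" "\<And>n. q (X n) < d + 1 / (real n + 1)" by metis
  have dist: "(hnorm M (b (X m) - b (X n)))\<^sup>2 \<le> 2 / (real m + 1) + 2 / (real n + 1)" for m n
  proof -
    \<comment> \<open>The midpoint of two almost minimizers: its value is at least \<open>d\<close>,
      so the parallelogram law makes the images \<open>b (X n)\<close> Cauchy. The vectors
      \<open>X n\<close> themselves need not converge.\<close>
    let ?z = "of_real (1/2) *\<^sub>C (X m + X n)"
    have "q ?z = (hnorm M (b (X m) + b (X n)))\<^sup>2 / 4 - Re (f (X m)) - Re (f (X n))"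
    proof -
      have "b ?z = of_real (1/2) *\<^sub>C (b (X m) + b (X n))"
        "f ?z = of_real (1/2) * (f (X m) + f (X n))"
        using X(1) by (simp_all only: b f S_add)
      moreover have "hnorm M (of_real (1/2) *\<^sub>C (b (X m) + b (X n))) = hnorm M (b (X m) + b (X n)) / 2"
        using X(1) b(1) hnorm_scale[of M "b (X m) + b (X n)" "of_real (1/2)"] by simp
      ultimately show ?thesis unfolding q_def by (simp only: power_divide) (simp add: field_simps)
    qed
    moreover have "d \<le> q ?z" using X(1) by (intro d_le) auto
    ultimately have "4 * d \<le> (hnorm M (b (X m) + b (X n)))\<^sup>2 - 4 * Re (f (X m)) - 4 * Re (f (X n))"
      by simp
    then show ?thesis
      using parallelogram_law[of M "b (X m)" "b (X n)"] X(2)[of m] X(2)[of n] X(1) b(1)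
      by (simp add: q_def)
  qed
  have "\<exists>N. \<forall>m\<ge>N. \<forall>n\<ge>N. hnorm M (b (X m) - b (X n)) < e" if e: "e > 0" for e
  proof -
    obtain N :: nat where N: "4 / e\<^sup>2 < real N" using reals_Archimedean2 by blast
    have "hnorm M (b (X m) - b (X n)) < e" if "m \<ge> N" "n \<ge> N" for m n
    proof -
      have "1 / (real k + 1) < e\<^sup>2 / 4" if "k \<ge> N" for k
      proof -
        have "4 / e\<^sup>2 < real k + 1" using N that by linarith
        then show ?thesis using e by (simp add: field_simps)
      qed
      from this[OF that(1)] this[OF that(2)] dist[of m n]
      have "(hnorm M (b (X m) - b (X n)))\<^sup>2 < e\<^sup>2" by simp
      then show ?thesis using e by (simp add: power2_less_imp_less)
    qed
    then show ?thesis by blast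
  qed
  then obtain y where y: "y \<in> carrier M" "(\<lambda>n. hnorm M (b (X n) - y)) \<longlonglongrightarrow> 0"
    using hilbert_space_complete[OF M, of "\<lambda>n. b (X n)"] b(1) X(1) by blast
  have Re: "Re (f h) = Re (cinner M (b h) y)" if h: "h \<in> S" for h
  proof -
    \<comment> \<open>Perturbing \<open>X n\<close> to \<open>X n + t h\<close> cannot go below the
      infimum \<open>d\<close>, up to the slack 1/(n+1); letting n grow leaves a nonnegative
      quadratic in t.\<close>
    have "0 \<le> 2 * t * (Re (cinner M (b h) y) - Re (f h)) + t\<^sup>2 * (hnorm M (b h))\<^sup>2" for t
    proof (rule LIMSEQ_le[where X = "\<lambda>n. 0"])
      show "(\<lambda>n. 1 / (real n + 1) + 2 * t * (Re (cinner M (b h) (b (X n))) - Re (f h))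
          + t\<^sup>2 * (hnorm M (b h))\<^sup>2) \<longlonglongrightarrow>
          2 * t * (Re (cinner M (b h) y) - Re (f h)) + t\<^sup>2 * (hnorm M (b h))\<^sup>2"
      proof -
        have lim0: "(\<lambda>n. 1 / (real n + 1)) \<longlonglongrightarrow> 0"
          using LIMSEQ_inverse_real_of_nat by (simp add: inverse_eq_divide add.commute)
        have lim1: "(\<lambda>n. Re (cinner M (b h) (b (X n)))) \<longlonglongrightarrow> Re (cinner M (b h) y)"
          using y X(1) h b(1) by (intro tendsto_Re tendsto_cinner) auto
        show ?thesis
          using tendsto_add[OF tendsto_add[OF lim0 tendsto_mult[OF tendsto_const[of "2 * t"]
              tendsto_diff[OF lim1 tendsto_const[of "Re (f h)"]]]] tendsto_const[of "t\<^sup>2 * (hnorm M (b h))\<^sup>2"]]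
          by simp
      qed
      have "q (X n + of_real t *\<^sub>C h) =
          q (X n) + 2 * t * (Re (cinner M (b h) (b (X n))) - Re (f h)) + t\<^sup>2 * (hnorm M (b h))\<^sup>2" for n
        using X(1)[of n] h b Re_cinner_commute[of M "b h" "b (X n)"]
        by (simp add: q_def f hnorm_power2_add hnorm_scale power_mult_distrib cinner_linear algebra_simps)
      moreover have "d \<le> q (X n + of_real t *\<^sub>C h)" for n
        using X(1)[of n] h by (intro d_le) simp
      ultimately have "0 \<le> 1 / (real n + 1) + 2 * t * (Re (cinner M (b h) (b (X n))) - Re (f h))
          + t\<^sup>2 * (hnorm M (b h))\<^sup>2" for n
        using X(2)[of n] by (smt (verit))
      then show "\<exists>N. \<forall>n\<ge>N. 0 \<le> 1 / (real n + 1) + 2 * t * (Re (cinner M (b h) (b (X n))) - Re (f h))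
          + t\<^sup>2 * (hnorm M (b h))\<^sup>2" by blast
    qed simp
    from linear_coefficient_eq_zero[OF _ this] show ?thesis by simp
  qed
  have "f h = cinner M (b h) y" if h: "h \<in> S" for h
  proof -
    have "Im (f h) = Im (cinner M (b h) y)"
      using Re[of "\<i> *\<^sub>C h"] h b y(1) f(2)[OF h, of "\<i>"] by (simp add: cinner_linear)
    with Re[OF h] show ?thesis by (simp add: complex_eq_iff)
  qed
  with X(1) y show thesis using that by blast
qed

text \<open>Here \<open>x\<close> plays the role of the adjoint applied to \<open>y\<close>. Pairing
  T x with y yields the square of the norm of x, and Cauchy-Schwarz cancels one factor.\<close>

lemma hnorm_adjoint_le:
  assumes ips: "inner_product_space H" "inner_product_space K"
    and mem: "x \<in> carrier H" "T x \<in> carrier K" "y \<in> carrier K" and B: "0 \<le> B"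
    and eq: "cinner K (T x) y = cinner H x x" and le: "hnorm K (T x) \<le> B * hnorm H x"
  shows "hnorm H x \<le> B * hnorm K y"
proof (cases "x = 0")
  case False
  then have pos: "hnorm H x > 0" using ips mem by (simp add: less_le)
  have "(hnorm H x)\<^sup>2 = Re (cinner K (T x) y)" using eq hnorm_power2[OF ips(1) mem(1)] by simp
  also have "\<dots> \<le> hnorm K (T x) * hnorm K y" by (rule Re_Cauchy_Schwarz[OF ips(2) mem(2,3)])
  also have "\<dots> \<le> B * hnorm H x * hnorm K y" using le mem ips by (intro mult_right_mono) auto
  finally show ?thesis using pos by (simp add: power2_eq_square mult.commute mult.left_commute)
qed (use ips mem B in simp)

text \<open>Inner products separate points, so the adjoint identity already forces linearity, and
  \<open>hnorm_adjoint_le\<close> forces boundedness. Candidates for adjoints can therefore be given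
  by bare formulas.\<close>

lemma bounded_ops_of_adjoint:
  assumes "inner_product_space H" "inner_product_space K" and T: "T \<in> bounded_ops H K"
    and S: "\<And>y. y \<in> carrier K \<Longrightarrow> S y \<in> carrier H" "\<And>y. y \<notin> carrier K \<Longrightarrow> S y = 0"
    and adj: "\<And>x y. x \<in> carrier H \<Longrightarrow> y \<in> carrier K \<Longrightarrow> cinner K (T x) y = cinner H x (S y)"
  shows "S \<in> bounded_ops K H"
proof -
  note [simp] = op_linear[OF assms(1,2) T] assms(1,2) S(1)
  obtain B where B: "B > 0" "\<And>x. x \<in> carrier H \<Longrightarrow> hnorm K (T x) \<le> B * hnorm H x"
    by (rule op_bound[OF assms(1,2) T], rule that)
  show ?thesis
  proof (rule bounded_opsI[where B = B])
    show "hnorm H (S y) \<le> B * hnorm K y" if y: "y \<in> carrier K" for y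
      by (rule hnorm_adjoint_le[where T = T]) (use y B in \<open>simp_all add: adj\<close>)
    show "S (x + y) = S x + S y" if "x \<in> carrier K" "y \<in> carrier K" for x y
      by (rule eqI_cinner[of H]) (use that in \<open>auto simp: adj[symmetric] cinner_linear\<close>)
    show "S (c *\<^sub>C x) = c *\<^sub>C S x" if "x \<in> carrier K" for c x
      by (rule eqI_cinner[of H]) (use that in \<open>auto simp: adj[symmetric] cinner_linear\<close>)
  qed (use S in auto)
qed

text \<open>For each y the functional sending x to the inner product of T x with y is represented by
  \<open>Riesz_closure_range\<close>, with \<open>b\<close> the identity on the complete space
  H.\<close>

lemma adjoint_exists:
  assumes H: "hilbert_space H" and K: "inner_product_space K" and T: "T \<in> bounded_ops H K"
  shows "\<exists>S\<in>bounded_ops K H. \<forall>x\<in>carrier H. \<forall>y\<in>carrier K. cinner K (T x) y = cinner H x (S y)"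
proof -
  have [simp]: "inner_product_space H" using H by simp
  note [simp] = op_linear[OF _ K T] K
  obtain B where B: "B > 0" "\<And>x. x \<in> carrier H \<Longrightarrow> hnorm K (T x) \<le> B * hnorm H x"
    by (rule op_bound[OF _ K T], simp, rule that)
  have "\<exists>z. z \<in> carrier H \<and> (\<forall>x\<in>carrier H. cinner K (T x) y = cinner H x z)" if y: "y \<in> carrier K" for y
  proof (rule Riesz_closure_range[OF H, of "carrier H" "\<lambda>x. x" "\<lambda>x. cinner K (T x) y" "B * hnorm K y"])
    show "cmod (cinner K (T h) y) \<le> B * hnorm K y * hnorm H h" if h: "h \<in> carrier H" for h
      using order_trans[OF Cauchy_Schwarz[of K "T h" y] mult_right_mono[OF B(2)[OF h], of "hnorm K y"]] h y
      by (simp add: mult_ac)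
  qed (use y in \<open>auto simp: cinner_linear\<close>)
  then obtain S where S: "\<And>y. y \<in> carrier K \<Longrightarrow> S y \<in> carrier H"
    "\<And>x y. y \<in> carrier K \<Longrightarrow> x \<in> carrier H \<Longrightarrow> cinner K (T x) y = cinner H x (S y)"
    by metis
  show ?thesis
  proof (rule bexI[of _ "\<lambda>y. if y \<in> carrier K then S y else 0"])
    show "(\<lambda>y. if y \<in> carrier K then S y else 0) \<in> bounded_ops K H"
      by (rule bounded_ops_of_adjoint[OF _ K T]) (use S in auto)
  qed (use S in auto)
qed

lemma adj_op_eqI:
  assumes "inner_product_space H" "inner_product_space K" and S: "S \<in> bounded_ops K H"
    and adj: "\<And>x y. x \<in> carrier H \<Longrightarrow> y \<in> carrier K \<Longrightarrow> cinner K (T x) y = cinner H x (S y)"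
  shows "adj_op H K T = S"
  unfolding adj_op_def
proof (rule the_equality)
  fix S' assume S': "S' \<in> bounded_ops K H \<and>
    (\<forall>x\<in>carrier H. \<forall>y\<in>carrier K. cinner K (T x) y = cinner H x (S' y))"
  show "S' = S"
  proof (rule bounded_ops_eqI[of _ K H])
    show "S' y = S y" if y: "y \<in> carrier K" for y
    proof (rule eqI_cinner[OF assms(1)])
      show "S' y \<in> carrier H" "S y \<in> carrier H"
        using op_closed[OF assms(2,1) S y] op_closed[OF assms(2,1) _ y] S' by blast+
      show "cinner H z (S' y) = cinner H z (S y)" if "z \<in> carrier H" for z
        using S' adj[OF that y] that y by auto
    qed
  qed (use S S' in blast)+
qed (use S adj in blast)

context
  fixes H :: "'a::complex_vector chilbert" and K :: "'b::complex_vector chilbert" and T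
  assumes H: "hilbert_space H" and K: "hilbert_space K" and T: "T \<in> bounded_ops H K"
begin

lemma adj_op_bounded: "adj_op H K T \<in> bounded_ops K H"
  and cinner_adj_op: "x \<in> carrier H \<Longrightarrow> y \<in> carrier K \<Longrightarrow> cinner H x (adj_op H K T y) = cinner K (T x) y"
proof -
  obtain S where S: "S \<in> bounded_ops K H"
    "\<And>x y. x \<in> carrier H \<Longrightarrow> y \<in> carrier K \<Longrightarrow> cinner K (T x) y = cinner H x (S y)"
    using adjoint_exists[OF H hilbert_space_inner_product_space[OF K] T] by blast
  have "adj_op H K T = S"
    by (rule adj_op_eqI[OF _ _ S]) (use H K in simp_all)
  then show "adj_op H K T \<in> bounded_ops K H"
    "x \<in> carrier H \<Longrightarrow> y \<in> carrier K \<Longrightarrow> cinner H x (adj_op H K T y) = cinner K (T x) y"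
    using S(1) S(2)[symmetric] by simp_all
qed

lemma adj_op_closed [simp]: "y \<in> carrier K \<Longrightarrow> adj_op H K T y \<in> carrier H"
  using op_closed[OF _ _ adj_op_bounded] H K by simp

lemma cinner_adj_op': "x \<in> carrier H \<Longrightarrow> y \<in> carrier K \<Longrightarrow> cinner H (adj_op H K T y) x = cinner K y (T x)"
  using cinner_commute[of H x "adj_op H K T y"] cinner_commute[of K "T x" y] H K op_closed[OF _ _ T, of x]
  by (simp add: cinner_adj_op)

end

section \<open>Inverses, positive operators and isometries\<close>

lemma inv_op_eqI:
  assumes "S \<in> bounded_ops H H" "T \<in> bounded_ops H H" "inner_product_space H"
    and ST: "\<And>x. x \<in> carrier H \<Longrightarrow> S (T x) = x" and TS: "\<And>x. x \<in> carrier H \<Longrightarrow> T (S x) = x"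
  shows "invertible_op H T" and "inv_op H T = S"
proof -
  note bdd = comp_bounded[OF assms(3,3,3)]
  have comp: "S \<circ> T = id_op H" "T \<circ> S = id_op H"
    using bounded_ops_eqI[OF bdd[OF assms(1,2)] id_op_bounded[OF assms(3)]]
      bounded_ops_eqI[OF bdd[OF assms(2,1)] id_op_bounded[OF assms(3)]] ST TS by auto
  then show "invertible_op H T" using assms unfolding invertible_op_def by blast
  show "inv_op H T = S" unfolding inv_op_def
  proof (rule the_equality)
    fix S' assume S': "S' \<in> bounded_ops H H \<and> S' \<circ> T = id_op H \<and> T \<circ> S' = id_op H"
    show "S' = S"
    proof (rule bounded_ops_eqI[of _ H H])
      fix x assume x: "x \<in> carrier H"
      have "S x \<in> carrier H" using op_closed[OF assms(3,3,1) x] .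
      moreover have "(S' \<circ> T) (S x) = id_op H (S x)" using S' by simp
      ultimately show "S' x = S x" using TS x by simp
    qed (use S' assms in auto)
  qed (use comp assms(1) in blast)
qed

context
  fixes H :: "'a::complex_vector chilbert" and T
  assumes ips: "inner_product_space H" and T: "invertible_op H T"
begin

lemma invertible_op_bounded: "T \<in> bounded_ops H H"
  using T by (simp add: invertible_op_def)

lemma inv_op_bounded: "inv_op H T \<in> bounded_ops H H"
  and inv_op_left: "x \<in> carrier H \<Longrightarrow> inv_op H T (T x) = x"
  and inv_op_right: "x \<in> carrier H \<Longrightarrow> T (inv_op H T x) = x"
proof -
  obtain S where S: "S \<in> bounded_ops H H" "S \<circ> T = id_op H" "T \<circ> S = id_op H"
    using T by (auto simp: invertible_op_def)
  have *: "S (T x) = x" "T (S x) = x" if "x \<in> carrier H" for x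
    using S(2,3)[THEN fun_cong, of x] that by auto
  then have "inv_op H T = S" using inv_op_eqI[OF S(1) invertible_op_bounded ips] by auto
  then show "inv_op H T \<in> bounded_ops H H" "x \<in> carrier H \<Longrightarrow> inv_op H T (T x) = x"
    "x \<in> carrier H \<Longrightarrow> T (inv_op H T x) = x"
    using S * by auto
qed

lemma inv_op_invertible: "invertible_op H (inv_op H T)" "inv_op H (inv_op H T) = T"
  using inv_op_eqI[OF invertible_op_bounded inv_op_bounded ips] inv_op_left inv_op_right by auto

end

text \<open>Testing positivity on \<open>x - (1/C) A x\<close>.\<close>

lemma positive_hnorm_le:
  assumes ips: "inner_product_space H" and A: "A \<in> bounded_ops H H" and C: "C > 0"
    and sym: "\<And>x y. x \<in> carrier H \<Longrightarrow> y \<in> carrier H \<Longrightarrow> cinner H (A x) y = cinner H x (A y)"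
    and pos: "\<And>x. x \<in> carrier H \<Longrightarrow> 0 \<le> Re (cinner H (A x) x)"
    and upper: "\<And>x. x \<in> carrier H \<Longrightarrow> Re (cinner H (A x) x) \<le> C * (hnorm H x)\<^sup>2"
    and x: "x \<in> carrier H"
  shows "(hnorm H (A x))\<^sup>2 \<le> C * Re (cinner H (A x) x)"
proof -
  note [simp] = ips op_linear[OF ips ips A]
  let ?c = "of_real (1 / C)"
  have eq: "Re (cinner H (A (A x)) x) = (hnorm H (A x))\<^sup>2" "Re (cinner H (A x) (A x)) = (hnorm H (A x))\<^sup>2"
    using x by (simp_all add: sym hnorm_power2)
  have "0 \<le> Re (cinner H (A (x - ?c *\<^sub>C A x)) (x - ?c *\<^sub>C A x))"
    using x by (intro pos) auto
  also have "\<dots> = Re (cinner H (A x) x) - 2 / C * (hnorm H (A x))\<^sup>2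
      + 1 / C\<^sup>2 * Re (cinner H (A (A x)) (A x))"
    using x C by (simp add: cinner_linear eq power2_eq_square field_simps)
  also have "\<dots> \<le> Re (cinner H (A x) x) - 2 / C * (hnorm H (A x))\<^sup>2 + 1 / C\<^sup>2 * (C * (hnorm H (A x))\<^sup>2)"
    using upper[of "A x"] x by (intro add_left_mono mult_left_mono) auto
  also have "\<dots> = Re (cinner H (A x) x) - (hnorm H (A x))\<^sup>2 / C"
    using C by (simp add: field_simps power2_eq_square)
  finally show ?thesis using C by (simp add: field_simps)
qed

text \<open>An operator bound serves as C in \<open>positive_hnorm_le\<close>. Extremality uses this
  to turn equality in a scalar inequality at one vector into a vector identity.\<close>

lemma positive_eq_zero:
  assumes ips: "inner_product_space H" and A: "A \<in> bounded_ops H H"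
    and sym: "\<And>x y. x \<in> carrier H \<Longrightarrow> y \<in> carrier H \<Longrightarrow> cinner H (A x) y = cinner H x (A y)"
    and pos: "\<And>x. x \<in> carrier H \<Longrightarrow> 0 \<le> Re (cinner H (A x) x)"
    and x: "x \<in> carrier H" and zero: "Re (cinner H (A x) x) = 0"
  shows "A x = 0"
proof -
  obtain C where C: "C > 0" "\<And>x. x \<in> carrier H \<Longrightarrow> hnorm H (A x) \<le> C * hnorm H x"
    by (rule op_bound[OF ips ips A], rule that)
  have "Re (cinner H (A x) x) \<le> C * (hnorm H x)\<^sup>2" if "x \<in> carrier H" for x
    using order_trans[OF Re_Cauchy_Schwarz[of H "A x" x] mult_right_mono[OF C(2)[OF that], of "hnorm H x"]]
      that ips op_closed[OF ips ips A] by (simp add: power2_eq_square mult.assoc)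
  from positive_hnorm_le[OF ips A C(1) sym pos this x] have "(hnorm H (A x))\<^sup>2 \<le> 0"
    using zero by simp
  then show ?thesis using ips op_closed[OF ips ips A x] by simp
qed

context
  fixes H :: "'a::complex_vector chilbert" and K :: "'b::complex_vector chilbert" and V
  assumes H: "inner_product_space H" and K: "inner_product_space K" and V: "isometry H K V"
begin

lemma isometry_bounded: "V \<in> bounded_ops H K"
  using V by (simp add: isometry_def)

lemma isometry_hnorm: "x \<in> carrier H \<Longrightarrow> hnorm K (V x) = hnorm H x"
  using V by (simp add: isometry_def)

lemma isometry_cinner: "x \<in> carrier H \<Longrightarrow> y \<in> carrier H \<Longrightarrow> cinner K (V x) (V y) = cinner H x y"
  using H K op_linear[OF H K isometry_bounded] isometry_hnorm
  by (intro cinner_preserved_if_hnorm_preserved[of K H "carrier H" H V "\<lambda>x. x"]) auto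

end

lemma isometryI:
  assumes "\<And>x. x \<in> carrier H \<Longrightarrow> V x \<in> carrier K" "\<And>x. x \<notin> carrier H \<Longrightarrow> V x = 0"
    and "\<And>x y. x \<in> carrier H \<Longrightarrow> y \<in> carrier H \<Longrightarrow> V (x + y) = V x + V y"
    and "\<And>c x. x \<in> carrier H \<Longrightarrow> V (c *\<^sub>C x) = c *\<^sub>C V x"
    and "\<And>x. x \<in> carrier H \<Longrightarrow> hnorm K (V x) = hnorm H x"
  shows "isometry H K V"
  using bounded_opsI[where B = 1, of H V K] assms unfolding isometry_def by auto

section \<open>Direct sums and closed subspaces\<close>

lemma carrier_hprod [simp]: "carrier (hprod H K) = carrier H \<times> carrier K"
  by (simp add: hprod_def)

lemma cinner_hprod: "cinner (hprod H K) p q = cinner H (fst p) (fst q) + cinner K (snd p) (snd q)"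
  by (simp add: hprod_def)

lemma scaleC_Pair [simp]: "c *\<^sub>C (x, y) = (c *\<^sub>C x, c *\<^sub>C y)"
  by (simp add: scaleC_prod_def)

lemma fst_scaleC [simp]: "fst (c *\<^sub>C p) = c *\<^sub>C fst p"
  and snd_scaleC [simp]: "snd (c *\<^sub>C p) = c *\<^sub>C snd p"
  by (simp_all add: scaleC_prod_def)

lemma scaleC_apply [simp]: "(c *\<^sub>C f) x = c *\<^sub>C f x"
  by (simp add: scaleC_fun_def)

lemma inner_product_space_hprod [simp]:
  assumes H: "inner_product_space H" and K: "inner_product_space K"
  shows "inner_product_space (hprod H K)"
proof -
  have "x = 0" if "x \<in> carrier (hprod H K)" "cinner (hprod H K) x x = 0" for x
  proof -
    have "(hnorm H (fst x))\<^sup>2 + (hnorm K (snd x))\<^sup>2 = 0"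
      using that H K by (auto simp: cinner_hprod cinner_self simp flip: of_real_add of_real_power)
    then show ?thesis
      using that H K by (auto simp: prod_eq_iff sum_power2_eq_zero_iff)
  qed
  moreover have "complex_vector.subspace (carrier (hprod H K))"
    using H K by (auto simp: complex_vector.subspace_def zero_prod_def)
  moreover have "cinner (hprod H K) y x = cnj (cinner (hprod H K) x y)"
    if "x \<in> carrier (hprod H K)" "y \<in> carrier (hprod H K)" for x y
    using that H K cinner_commute[of H "fst x" "fst y"] cinner_commute[of K "snd x" "snd y"]
    by (auto simp: cinner_hprod)
  moreover have "cinner (hprod H K) (x + y) z = cinner (hprod H K) x z + cinner (hprod H K) y z"
    if "x \<in> carrier (hprod H K)" "y \<in> carrier (hprod H K)" "z \<in> carrier (hprod H K)" for x y z
    using that H K by (auto simp: cinner_hprod cinner_linear)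
  moreover have "cinner (hprod H K) (c *\<^sub>C x) y = c * cinner (hprod H K) x y"
    if "x \<in> carrier (hprod H K)" "y \<in> carrier (hprod H K)" for c x y
    using that H K by (auto simp: cinner_hprod cinner_linear algebra_simps)
  moreover have "0 \<le> Re (cinner (hprod H K) x x)" if "x \<in> carrier (hprod H K)" for x
    using that H K by (auto simp: cinner_hprod cinner_ge_zero)
  ultimately show ?thesis
    unfolding inner_product_space_def by blast
qed

lemma hnorm_hprod:
  "inner_product_space H \<Longrightarrow> inner_product_space K \<Longrightarrow> p \<in> carrier (hprod H K) \<Longrightarrow>
     (hnorm (hprod H K) p)\<^sup>2 = (hnorm H (fst p))\<^sup>2 + (hnorm K (snd p))\<^sup>2"
  using hnorm_power2[of "hprod H K" p] by (auto simp: cinner_hprod hnorm_power2)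

lemma hnorm_fst_le:
  assumes "inner_product_space H" "inner_product_space K" and p: "p \<in> carrier (hprod H K)"
  shows "hnorm H (fst p) \<le> hnorm (hprod H K) p"
proof (rule power2_le_imp_le)
  show "(hnorm H (fst p))\<^sup>2 \<le> (hnorm (hprod H K) p)\<^sup>2"
    unfolding hnorm_hprod[OF assms] by simp
  show "0 \<le> hnorm (hprod H K) p"
    by (rule hnorm_nonneg[OF inner_product_space_hprod[OF assms(1,2)] p])
qed

lemma hnorm_snd_le:
  assumes "inner_product_space H" "inner_product_space K" and p: "p \<in> carrier (hprod H K)"
  shows "hnorm K (snd p) \<le> hnorm (hprod H K) p"
proof (rule power2_le_imp_le)
  show "(hnorm K (snd p))\<^sup>2 \<le> (hnorm (hprod H K) p)\<^sup>2"
    unfolding hnorm_hprod[OF assms] by simp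
  show "0 \<le> hnorm (hprod H K) p"
    by (rule hnorm_nonneg[OF inner_product_space_hprod[OF assms(1,2)] p])
qed

lemma hilbert_space_hprod [simp]:
  assumes H: "hilbert_space H" and K: "hilbert_space K"
  shows "hilbert_space (hprod H K)"
  unfolding hilbert_space_def
proof (intro conjI allI impI)
  have ips: "inner_product_space H" "inner_product_space K" using H K by auto
  show "inner_product_space (hprod H K)" using ips by simp
  fix X :: "nat \<Rightarrow> _"
  assume *: "(\<forall>n. X n \<in> carrier (hprod H K)) \<and>
      (\<forall>e>0. \<exists>N. \<forall>m\<ge>N. \<forall>n\<ge>N. hnorm (hprod H K) (X m - X n) < e)"
  have X: "fst (X n) \<in> carrier H" "snd (X n) \<in> carrier K" "X n \<in> carrier (hprod H K)" for n
    using * by (auto simp: mem_Times_iff)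
  have comp: "hnorm H (fst (X m) - fst (X n)) \<le> hnorm (hprod H K) (X m - X n)"
    "hnorm K (snd (X m) - snd (X n)) \<le> hnorm (hprod H K) (X m - X n)" for m n
    using hnorm_fst_le[OF ips carrier_diff[of "hprod H K" "X m" "X n"]]
      hnorm_snd_le[OF ips carrier_diff[of "hprod H K" "X m" "X n"]] X ips by simp_all
  have "\<exists>N. \<forall>m\<ge>N. \<forall>n\<ge>N. hnorm H (fst (X m) - fst (X n)) < e" if "e > 0" for e
    using * that comp(1) by (meson le_less_trans)
  then obtain x where x: "x \<in> carrier H" "(\<lambda>n. hnorm H (fst (X n) - x)) \<longlonglongrightarrow> 0"
    using hilbert_space_complete[OF H, of "\<lambda>n. fst (X n)"] X(1) by blast
  have "\<exists>N. \<forall>m\<ge>N. \<forall>n\<ge>N. hnorm K (snd (X m) - snd (X n)) < e" if "e > 0" for e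
    using * that comp(2) by (meson le_less_trans)
  then obtain y where y: "y \<in> carrier K" "(\<lambda>n. hnorm K (snd (X n) - y)) \<longlonglongrightarrow> 0"
    using hilbert_space_complete[OF K, of "\<lambda>n. snd (X n)"] X(2) by blast
  have "(\<lambda>n. sqrt ((hnorm H (fst (X n) - x))\<^sup>2 + (hnorm K (snd (X n) - y))\<^sup>2)) \<longlonglongrightarrow> sqrt (0\<^sup>2 + 0\<^sup>2)"
    by (intro tendsto_intros x y)
  moreover have "sqrt ((hnorm H (fst (X n) - x))\<^sup>2 + (hnorm K (snd (X n) - y))\<^sup>2) = hnorm (hprod H K) (X n - (x, y))" for n
    using hnorm_hprod[OF ips, of "X n - (x, y)"] X x y ips
    by (intro real_sqrt_unique) (simp_all add: mem_Times_iff)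
  ultimately show "\<exists>z\<in>carrier (hprod H K). (\<lambda>n. hnorm (hprod H K) (X n - z)) \<longlonglongrightarrow> 0"
    using x y by (intro bexI[of _ "(x, y)"]) auto
qed

section \<open>Hilbert direct sums of families\<close>

lemma mem_carrier_hsum:
  "f \<in> carrier (hsum I H) \<longleftrightarrow> (\<forall>i\<in>I. f i \<in> carrier (H i)) \<and> (\<forall>i. i \<notin> I \<longrightarrow> f i = 0) \<and>
     (\<lambda>i. (hnorm (H i) (f i))\<^sup>2) summable_on I"
  by (simp add: hsum_def)

lemma cinner_hsum: "cinner (hsum I H) f g = (\<Sum>\<^sub>\<infinity>i\<in>I. cinner (H i) (f i) (g i))"
  by (simp add: hsum_def)

context
  fixes I :: "'i set" and H :: "'i \<Rightarrow> 'a::complex_vector chilbert"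
  assumes all_ips: "\<forall>i\<in>I. inner_product_space (H i)"
begin

lemmas summand_ips = bspec[OF all_ips]

lemma hsum_component: "f \<in> carrier (hsum I H) \<Longrightarrow> i \<in> I \<Longrightarrow> f i \<in> carrier (H i)"
  by (simp add: mem_carrier_hsum)

lemma hsum_component_outside: "f \<in> carrier (hsum I H) \<Longrightarrow> i \<notin> I \<Longrightarrow> f i = 0"
  by (simp add: mem_carrier_hsum)

lemma hsum_summable_hnorm: "f \<in> carrier (hsum I H) \<Longrightarrow> (\<lambda>i. (hnorm (H i) (f i))\<^sup>2) summable_on I"
  by (simp add: mem_carrier_hsum)

lemma hsum_memI:
  assumes "\<And>i. i \<in> I \<Longrightarrow> f i \<in> carrier (H i)" "\<And>i. i \<notin> I \<Longrightarrow> f i = 0"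
    and "g summable_on I" "\<And>i. i \<in> I \<Longrightarrow> (hnorm (H i) (f i))\<^sup>2 \<le> g i"
  shows "f \<in> carrier (hsum I H)"
  using assms summable_on_comparison_test[OF assms(3), of "\<lambda>i. (hnorm (H i) (f i))\<^sup>2"]
  by (simp add: mem_carrier_hsum)

lemma hsum_summable_cinner:
  assumes f: "f \<in> carrier (hsum I H)" and g: "g \<in> carrier (hsum I H)"
  shows "(\<lambda>i. cinner (H i) (f i) (g i)) summable_on I"
proof (rule abs_summable_summable, rule summable_on_comparison_test)
  show "(\<lambda>i. (hnorm (H i) (f i))\<^sup>2 + (hnorm (H i) (g i))\<^sup>2) summable_on I"
    using f g by (intro summable_on_add hsum_summable_hnorm)
  show "cmod (cinner (H i) (f i) (g i)) \<le> (hnorm (H i) (f i))\<^sup>2 + (hnorm (H i) (g i))\<^sup>2" if i: "i \<in> I" for i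
  proof -
    have fg: "f i \<in> carrier (H i)" "g i \<in> carrier (H i)" using f g i by (auto simp: hsum_component)
    have "cmod (cinner (H i) (f i) (g i)) \<le> hnorm (H i) (f i) * hnorm (H i) (g i)"
      using fg summand_ips[OF i] by (intro Cauchy_Schwarz)
    also have "2 * (hnorm (H i) (f i) * hnorm (H i) (g i)) \<le> (hnorm (H i) (f i))\<^sup>2 + (hnorm (H i) (g i))\<^sup>2"
      using sum_squares_bound[of "hnorm (H i) (f i)" "hnorm (H i) (g i)"] by (simp add: mult.assoc)
    moreover have "0 \<le> hnorm (H i) (f i) * hnorm (H i) (g i)" using fg summand_ips[OF i] by simp
    ultimately show ?thesis by linarith
  qed
qed simp

lemma subspace_carrier_hsum: "complex_vector.subspace (carrier (hsum I H))"
  unfolding complex_vector.subspace_def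
proof (intro conjI ballI allI)
  show "0 \<in> carrier (hsum I H)"
    using summand_ips by (auto simp: mem_carrier_hsum intro!: summable_on_0)
  fix f g c assume f: "f \<in> carrier (hsum I H)"
  show "f + g \<in> carrier (hsum I H)" if g: "g \<in> carrier (hsum I H)"
  proof (rule hsum_memI)
    show "(\<lambda>i. 2 * (hnorm (H i) (f i))\<^sup>2 + 2 * (hnorm (H i) (g i))\<^sup>2) summable_on I"
      using f g by (intro summable_on_add summable_on_cmult_right hsum_summable_hnorm)
    show "(hnorm (H i) ((f + g) i))\<^sup>2 \<le> 2 * (hnorm (H i) (f i))\<^sup>2 + 2 * (hnorm (H i) (g i))\<^sup>2" if "i \<in> I" for i
      using that f g summand_ips hnorm_power2_add_le[of "H i" "f i" "g i"] by (simp add: hsum_component)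
  qed (use f g summand_ips in \<open>auto simp: hsum_component hsum_component_outside\<close>)
  show "c *\<^sub>C f \<in> carrier (hsum I H)"
  proof (rule hsum_memI)
    show "(\<lambda>i. (cmod c)\<^sup>2 * (hnorm (H i) (f i))\<^sup>2) summable_on I"
      using f by (intro summable_on_cmult_right hsum_summable_hnorm)
    show "(hnorm (H i) ((c *\<^sub>C f) i))\<^sup>2 \<le> (cmod c)\<^sup>2 * (hnorm (H i) (f i))\<^sup>2" if "i \<in> I" for i
      using that f summand_ips by (simp add: hsum_component hnorm_scale power_mult_distrib)
  qed (use f summand_ips in \<open>auto simp: hsum_component hsum_component_outside\<close>)
qed

lemma cinner_hsum_self:
  assumes f: "f \<in> carrier (hsum I H)"
  shows "cinner (hsum I H) f f = of_real (\<Sum>\<^sub>\<infinity>i\<in>I. (hnorm (H i) (f i))\<^sup>2)"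
proof -
  have "cinner (hsum I H) f f = (\<Sum>\<^sub>\<infinity>i\<in>I. of_real ((hnorm (H i) (f i))\<^sup>2))"
    unfolding cinner_hsum using f summand_ips by (intro infsum_cong) (simp add: cinner_self hsum_component)
  also have "\<dots> = of_real (\<Sum>\<^sub>\<infinity>i\<in>I. (hnorm (H i) (f i))\<^sup>2)"
    by (intro infsumI has_sum_of_real has_sum_infsum hsum_summable_hnorm f)
  finally show ?thesis .
qed

lemma inner_product_space_hsum: "inner_product_space (hsum I H)"
proof -
  have "f = 0" if f: "f \<in> carrier (hsum I H)" and zero: "cinner (hsum I H) f f = 0" for f
  proof
    fix i
    have "(hnorm (H i) (f i))\<^sup>2 = 0" if "i \<in> I"
      using nonneg_infsum_le_0D[of "\<lambda>i. (hnorm (H i) (f i))\<^sup>2" I i] that zero f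
      by (simp add: cinner_hsum_self hsum_summable_hnorm)
    then show "f i = 0 i" using f summand_ips by (cases "i \<in> I") (auto simp: hsum_component hsum_component_outside)
  qed
  moreover have "cinner (hsum I H) (f + g) h = cinner (hsum I H) f h + cinner (hsum I H) g h"
    if "f \<in> carrier (hsum I H)" "g \<in> carrier (hsum I H)" "h \<in> carrier (hsum I H)" for f g h
    unfolding cinner_hsum infsum_add[OF hsum_summable_cinner[OF that(1,3)] hsum_summable_cinner[OF that(2,3)], symmetric]
    using that summand_ips by (intro infsum_cong) (simp add: cinner_linear hsum_component)
  moreover have "cinner (hsum I H) (c *\<^sub>C f) g = c * cinner (hsum I H) f g"
    if "f \<in> carrier (hsum I H)" "g \<in> carrier (hsum I H)" for c f g
    unfolding cinner_hsum infsum_cmult_right'[symmetric]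
    using that summand_ips by (intro infsum_cong) (simp add: cinner_linear hsum_component)
  moreover have "cinner (hsum I H) g f = cnj (cinner (hsum I H) f g)"
    if "f \<in> carrier (hsum I H)" "g \<in> carrier (hsum I H)" for f g
    unfolding cinner_hsum infsum_cnj[symmetric]
    using that summand_ips by (intro infsum_cong cinner_commute) (simp_all add: hsum_component)
  moreover have "0 \<le> Re (cinner (hsum I H) f f)" if "f \<in> carrier (hsum I H)" for f
    using that by (simp add: cinner_hsum_self infsum_nonneg)
  ultimately show ?thesis
    unfolding inner_product_space_def using subspace_carrier_hsum by blast
qed

lemma hnorm_hsum:
  assumes f: "f \<in> carrier (hsum I H)"
  shows "(hnorm (hsum I H) f)\<^sup>2 = (\<Sum>\<^sub>\<infinity>i\<in>I. (hnorm (H i) (f i))\<^sup>2)"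
  using f cinner_self[OF inner_product_space_hsum f] cinner_hsum_self[OF f] by (simp only: of_real_eq_iff)

lemma hsum_finite_sum_le:
  assumes f: "f \<in> carrier (hsum I H)" and F: "finite F" "F \<subseteq> I"
  shows "(\<Sum>i\<in>F. (hnorm (H i) (f i))\<^sup>2) \<le> (hnorm (hsum I H) f)\<^sup>2"
  unfolding hnorm_hsum[OF f] by (rule finite_sum_le_infsum[OF hsum_summable_hnorm[OF f] F]) simp

lemma hsum_component_le:
  assumes f: "f \<in> carrier (hsum I H)" and i: "i \<in> I"
  shows "hnorm (H i) (f i) \<le> hnorm (hsum I H) f"
  using hsum_finite_sum_le[OF f, of "{i}"] i f inner_product_space_hsum
  by (auto intro: power2_le_imp_le)

lemma hsum_hnorm_le:
  assumes f: "f \<in> carrier (hsum I H)" and B: "0 \<le> B"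
    and le: "\<And>F. finite F \<Longrightarrow> F \<subseteq> I \<Longrightarrow> (\<Sum>i\<in>F. (hnorm (H i) (f i))\<^sup>2) \<le> B\<^sup>2"
  shows "hnorm (hsum I H) f \<le> B"
proof (rule power2_le_imp_le[OF _ B])
  show "(hnorm (hsum I H) f)\<^sup>2 \<le> B\<^sup>2"
    unfolding hnorm_hsum[OF f] by (rule infsum_le_finite_sums[OF hsum_summable_hnorm[OF f] le])
qed

end

lemma hilbert_space_hsum:
  fixes H :: "'i \<Rightarrow> 'a::complex_vector chilbert"
  assumes hs: "\<And>i. i \<in> I \<Longrightarrow> hilbert_space (H i)"
  shows "hilbert_space (hsum I H)"
  unfolding hilbert_space_def
proof (intro conjI allI impI)
  have all_ips: "\<forall>i\<in>I. inner_product_space (H i)" using hs by simp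
  note ips = bspec[OF all_ips]
  let ?H = "hsum I H"
  show ipsH [simp]: "inner_product_space ?H" by (rule inner_product_space_hsum[OF all_ips])
  fix X :: "nat \<Rightarrow> 'i \<Rightarrow> 'a"
  assume *: "(\<forall>n. X n \<in> carrier ?H) \<and> (\<forall>e>0. \<exists>N. \<forall>m\<ge>N. \<forall>n\<ge>N. hnorm ?H (X m - X n) < e)"
  have X [simp]: "X n \<in> carrier ?H" for n using * by blast
  have Xi [simp]: "X n i \<in> carrier (H i)" if "i \<in> I" for n i
    using hsum_component[OF all_ips X that] by simp
  have "\<exists>x\<in>carrier (H i). (\<lambda>n. hnorm (H i) (X n i - x)) \<longlonglongrightarrow> 0" if i: "i \<in> I" for i
  proof (rule hilbert_space_complete[OF hs[OF i], of "\<lambda>n. X n i"])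
    have le: "hnorm (H i) (X m i - X n i) \<le> hnorm ?H (X m - X n)" for m n
      using hsum_component_le[OF all_ips _ i, where f = "X m - X n"] by simp
    show "\<exists>N. \<forall>m\<ge>N. \<forall>n\<ge>N. hnorm (H i) (X m i - X n i) < e" if "e > 0" for e
      using * that le by (meson le_less_trans)
  qed (use i in auto)
  then obtain x0 where x0: "\<And>i. i \<in> I \<Longrightarrow> x0 i \<in> carrier (H i)"
    "\<And>i. i \<in> I \<Longrightarrow> (\<lambda>n. hnorm (H i) (X n i - x0 i)) \<longlonglongrightarrow> 0" by metis
  define x where "x i = (if i \<in> I then x0 i else 0)" for i
  have x: "x i \<in> carrier (H i)" "(\<lambda>n. hnorm (H i) (X n i - x i)) \<longlonglongrightarrow> 0" if "i \<in> I" for i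
    using x0 that by (auto simp: x_def)
  \<comment> \<open>Membership of \<open>x\<close> in the sum is not known yet. Finite partial sums
    of the squared norms of X n - X m pass to the limit in m, which gives both the square
    summability of X n - x and the bound on its norm.\<close>
  have close: "\<exists>N. \<forall>n\<ge>N. X n - x \<in> carrier ?H \<and> hnorm ?H (X n - x) \<le> e" if e: "e > 0" for e
  proof -
    obtain N where N: "\<And>m n. m \<ge> N \<Longrightarrow> n \<ge> N \<Longrightarrow> hnorm ?H (X m - X n) < e"
      using * e by blast
    have "X n - x \<in> carrier ?H \<and> hnorm ?H (X n - x) \<le> e" if n: "n \<ge> N" for n
    proof -
      have fin: "(\<Sum>i\<in>F. (hnorm (H i) ((X n - x) i))\<^sup>2) \<le> e\<^sup>2" if F: "finite F" "F \<subseteq> I" for F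
      proof (rule LIMSEQ_le_const2)
        show "(\<lambda>m. \<Sum>i\<in>F. (hnorm (H i) ((X n - X m) i))\<^sup>2) \<longlonglongrightarrow> (\<Sum>i\<in>F. (hnorm (H i) ((X n - x) i))\<^sup>2)"
        proof (intro tendsto_sum tendsto_power)
          fix i assume "i \<in> F"
          then have i: "i \<in> I" using F by blast
          have "hnorm (H i) ((X n - X m) i - (X n - x) i) = hnorm (H i) (X m i - x i)" for m
            using hnorm_minus_commute[OF ips[OF i], of "x i" "X m i"] x(1)[OF i] i by simp
          then show "(\<lambda>m. hnorm (H i) ((X n - X m) i)) \<longlonglongrightarrow> hnorm (H i) ((X n - x) i)"
            using x[OF i] i ips[OF i] by (intro tendsto_hnorm) auto
        qed
        have "(\<Sum>i\<in>F. (hnorm (H i) ((X n - X m) i))\<^sup>2) \<le> e\<^sup>2" if m: "m \<ge> N" for m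
          using hsum_finite_sum_le[OF all_ips _ F, where f = "X n - X m"] power_mono[OF less_imp_le[OF N[OF n m]], of 2]
          by simp
        then show "\<exists>N. \<forall>m\<ge>N. (\<Sum>i\<in>F. (hnorm (H i) ((X n - X m) i))\<^sup>2) \<le> e\<^sup>2" by blast
      qed
      have "(\<lambda>i. (hnorm (H i) ((X n - x) i))\<^sup>2) summable_on I"
        using fin by (intro nonneg_bdd_above_summable_on bdd_aboveI[where M = "e\<^sup>2"]) auto
      then have "X n - x \<in> carrier ?H"
        using x(1) ips hsum_component_outside[OF all_ips X[of n]] by (auto simp: mem_carrier_hsum x_def)
      then show ?thesis
        using hsum_hnorm_le[OF all_ips _ less_imp_le[OF e] fin] by blast
    qed
    then show ?thesis by blast
  qed
  \<comment> \<open>Membership of \<open>x\<close> comes from writing it as X N - (X N - x).\<close>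
  then obtain N where N: "X N - x \<in> carrier ?H" using zero_less_one by blast
  have "X N - (X N - x) \<in> carrier ?H" by (rule carrier_diff[OF ipsH X N])
  then have xH: "x \<in> carrier ?H" by simp
  have "(\<lambda>n. hnorm ?H (X n - x)) \<longlonglongrightarrow> 0"
  proof (rule LIMSEQ_I)
    fix e :: real assume "e > 0"
    then obtain N where "\<forall>n\<ge>N. hnorm ?H (X n - x) \<le> e / 2" using close[of "e / 2"] by auto
    then show "\<exists>N. \<forall>n\<ge>N. norm (hnorm ?H (X n - x) - 0) < e"
      using \<open>e > 0\<close> xH by (intro exI[of _ N]) (auto intro: le_less_trans)
  qed
  then show "\<exists>x\<in>carrier ?H. (\<lambda>n. hnorm ?H (X n - x)) \<longlonglongrightarrow> 0" using xH by blast
qed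

section \<open>Closed subspaces as Hilbert spaces\<close>

lemma carrier_sub_hilbert [simp]: "carrier (sub_hilbert H M) = M"
  and cinner_sub_hilbert [simp]: "cinner (sub_hilbert H M) = cinner H"
  by (simp_all add: sub_hilbert_def)

lemma hnorm_sub_hilbert [simp]: "hnorm (sub_hilbert H M) = hnorm H"
  by (simp add: fun_eq_iff hnorm_def)

lemma hilbert_space_sub_hilbert:
  assumes H: "hilbert_space H" and M: "closed_subspace H M"
  shows "hilbert_space (sub_hilbert H M)"
  unfolding hilbert_space_def
proof (intro conjI allI impI)
  have ips [simp]: "inner_product_space H" using H by simp
  have sub: "M \<subseteq> carrier H" "complex_vector.subspace M" using M by (auto simp: closed_subspace_def)
  have "cinner H y x = cnj (cinner H x y)" if "x \<in> M" "y \<in> M" for x y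
    using that sub by (intro cinner_commute) auto
  moreover have "x = 0" if "x \<in> M" "cinner H x x = 0" for x
    using that sub cinner_self[of H x] by auto
  moreover have "cinner H (x + y) z = cinner H x z + cinner H y z" if "x \<in> M" "y \<in> M" "z \<in> M" for x y z
    using that sub by (intro cinner_add_left) auto
  moreover have "cinner H (c *\<^sub>C x) y = c * cinner H x y" if "x \<in> M" "y \<in> M" for c x y
    using that sub by (intro cinner_scale_left) auto
  moreover have "0 \<le> Re (cinner H x x)" if "x \<in> M" for x
    using that sub by (intro cinner_ge_zero) auto
  ultimately show "inner_product_space (sub_hilbert H M)"
    unfolding inner_product_space_def carrier_sub_hilbert cinner_sub_hilbert using sub(2) by blast
  fix X :: "nat \<Rightarrow> _"
  assume *: "(\<forall>n. X n \<in> carrier (sub_hilbert H M)) \<and>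
      (\<forall>e>0. \<exists>N. \<forall>m\<ge>N. \<forall>n\<ge>N. hnorm (sub_hilbert H M) (X m - X n) < e)"
  then obtain x where x: "x \<in> carrier H" "(\<lambda>n. hnorm H (X n - x)) \<longlonglongrightarrow> 0"
    using hilbert_space_complete[OF H, of X] sub by auto
  then have "x \<in> M" using M * unfolding closed_subspace_def by auto
  then show "\<exists>x\<in>carrier (sub_hilbert H M). (\<lambda>n. hnorm (sub_hilbert H M) (X n - x)) \<longlonglongrightarrow> 0"
    using x by auto
qed

section \<open>The class \<open>PA\<close>\<close>

text \<open>The operator in the definition of \<open>PA\<close> without its scalar prefactor, which
  is positive for 0 < r < 1.\<close>

definition annulus_defect :: "real \<Rightarrow> 'a::complex_vector chilbert \<Rightarrow> ('a \<Rightarrow> 'a) \<Rightarrow> 'a \<Rightarrow> 'a" where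
  "annulus_defect r H T = of_real (1 / r\<^sup>2 + r\<^sup>2) *\<^sub>C id_op H - (adj_op H H T \<circ> T)
     - (adj_op H H (inv_op H T) \<circ> inv_op H T)"

context
  fixes H :: "'a::complex_vector chilbert" and T and r :: real
  assumes H: "hilbert_space H" and T: "invertible_op H T"
begin

lemma annulus_defect_bounded: "annulus_defect r H T \<in> bounded_ops H H"
proof -
  have ips: "inner_product_space H" using H by simp
  note S = inv_op_bounded[OF ips T] and T' = invertible_op_bounded[OF ips T]
  note adj = adj_op_bounded[OF H H S] adj_op_bounded[OF H H T']
  show ?thesis unfolding annulus_defect_def
    by (intro diff_bounded scaleC_bounded id_op_bounded comp_bounded[OF ips ips ips] ips S T' adj)
qed

lemma cinner_annulus_defect:
  assumes x: "x \<in> carrier H" and y: "y \<in> carrier H"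
  shows "cinner H (annulus_defect r H T x) y =
    of_real (1 / r\<^sup>2 + r\<^sup>2) * cinner H x y - cinner H (T x) (T y) - cinner H (inv_op H T x) (inv_op H T y)"
proof -
  have ips: "inner_product_space H" using H by simp
  note S = inv_op_bounded[OF ips T] and T' = invertible_op_bounded[OF ips T]
  note [simp] = op_linear[OF ips ips S] op_linear[OF ips ips T'] ips
    op_closed[OF ips ips adj_op_bounded[OF H H S]] op_closed[OF ips ips adj_op_bounded[OF H H T']]
  show ?thesis
    using x y by (simp add: annulus_defect_def cinner_linear cinner_adj_op'[OF H H S] cinner_adj_op'[OF H H T'])
qed

lemma annulus_defect_symmetric:
  assumes x: "x \<in> carrier H" and y: "y \<in> carrier H"
  shows "cinner H (annulus_defect r H T x) y = cinner H x (annulus_defect r H T y)"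
proof -
  have ips: "inner_product_space H" using H by simp
  note S = inv_op_bounded[OF ips T] and T' = invertible_op_bounded[OF ips T]
  have "cinner H x (annulus_defect r H T y) = cnj (cinner H (annulus_defect r H T y) x)"
    by (rule cinner_commute[OF ips op_closed[OF ips ips annulus_defect_bounded y] x])
  also have "\<dots> = cinner H (annulus_defect r H T x) y"
    unfolding cinner_annulus_defect[OF x y] cinner_annulus_defect[OF y x]
    using cinner_commute[OF ips x y] cinner_commute[OF ips op_closed[OF ips ips T' x] op_closed[OF ips ips T' y]]
      cinner_commute[OF ips op_closed[OF ips ips S x] op_closed[OF ips ips S y]] by simp
  finally show ?thesis by simp
qed

lemma Re_cinner_annulus_defect:
  assumes x: "x \<in> carrier H"
  shows "Re (cinner H (annulus_defect r H T x) x) =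
    (1 / r\<^sup>2 + r\<^sup>2) * (hnorm H x)\<^sup>2 - (hnorm H (T x))\<^sup>2 - (hnorm H (inv_op H T x))\<^sup>2"
proof -
  have ips: "inner_product_space H" using H by simp
  note S = inv_op_bounded[OF ips T] and T' = invertible_op_bounded[OF ips T]
  show ?thesis unfolding cinner_annulus_defect[OF x x]
    using x ips op_closed[OF ips ips S x] op_closed[OF ips ips T' x]
    by (simp add: cinner_self del: of_real_add of_real_divide of_real_power flip: of_real_mult)
qed

end

lemma inverse_power2_gt:
  fixes r :: real
  assumes "0 < r" "r < 1"
  shows "r\<^sup>2 < 1 / r\<^sup>2"
proof -
  have "r\<^sup>2 < 1" using assms by (simp add: power_less_one_iff)
  moreover from this have "1 < 1 / r\<^sup>2" using assms by simp
  ultimately show ?thesis by linarith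
qed

text \<open>The defect is automatically bounded and self-adjoint and the prefactor is positive, so
  \<open>psd\<close> amounts to a pointwise inequality between norms. This is the form in which
  \<open>PA\<close> is used from here on.\<close>

lemma PA_iff:
  assumes r: "0 < r" "r < 1"
  shows "T \<in> PA r H \<longleftrightarrow> hilbert_space H \<and> invertible_op H T \<and>
    (\<forall>x\<in>carrier H. (hnorm H (T x))\<^sup>2 + (hnorm H (inv_op H T x))\<^sup>2 \<le> (1 / r\<^sup>2 + r\<^sup>2) * (hnorm H x)\<^sup>2)"
proof (cases "hilbert_space H \<and> invertible_op H T")
  case True
  then have H: "hilbert_space H" and T: "invertible_op H T" and ips: "inner_product_space H" by auto
  define k where "k = 1 / (1 / r\<^sup>2 - r\<^sup>2)"
  have k: "k > 0" using inverse_power2_gt[OF r] by (simp add: k_def)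
  let ?D = "annulus_defect r H T"
  have D: "?D \<in> bounded_ops H H" by (rule annulus_defect_bounded[OF H T])
  have kD: "of_real k *\<^sub>C ?D \<in> bounded_ops H H" by (intro scaleC_bounded D ips)
  have "adj_op H H (of_real k *\<^sub>C ?D) = of_real k *\<^sub>C ?D"
    by (rule adj_op_eqI[OF ips ips kD])
      (simp add: cinner_linear ips op_closed[OF ips ips D] annulus_defect_symmetric[OF H T])
  moreover have "Re (cinner H ((of_real k *\<^sub>C ?D) x) x) = k * ((1 / r\<^sup>2 + r\<^sup>2) * (hnorm H x)\<^sup>2 - (hnorm H (T x))\<^sup>2 - (hnorm H (inv_op H T x))\<^sup>2)"
    if "x \<in> carrier H" for x
    using that Re_cinner_annulus_defect[OF H T that, of r]
    by (simp add: cinner_linear ips op_closed[OF ips ips D])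
  ultimately have "psd H (of_real k *\<^sub>C ?D) \<longleftrightarrow>
    (\<forall>x\<in>carrier H. 0 \<le> (1 / r\<^sup>2 + r\<^sup>2) * (hnorm H x)\<^sup>2 - (hnorm H (T x))\<^sup>2 - (hnorm H (inv_op H T x))\<^sup>2)"
    unfolding psd_def using kD k by (auto simp: zero_le_mult_iff)
  moreover have "T \<in> PA r H \<longleftrightarrow> psd H (of_real k *\<^sub>C ?D)"
    using True by (simp add: PA_def annulus_defect_def k_def)
  ultimately show ?thesis using True by (auto simp: algebra_simps)
qed (auto simp: PA_def)

section \<open>Unitary operators\<close>

lemma unitary_op_inverse:
  assumes H: "inner_product_space H" and K: "inner_product_space K" and U: "unitary_op H K U"
  obtains U' where "unitary_op K H U'" "\<And>x. x \<in> carrier H \<Longrightarrow> U' (U x) = x"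
    "\<And>y. y \<in> carrier K \<Longrightarrow> U (U' y) = y"
    "\<And>x y. x \<in> carrier H \<Longrightarrow> y \<in> carrier K \<Longrightarrow> cinner K (U x) y = cinner H x (U' y)"
proof -
  have iso: "isometry H K U" and surj: "U ` carrier H = carrier K" using U by (auto simp: unitary_op_def)
  note [simp] = H K op_linear[OF H K isometry_bounded[OF H K iso]] isometry_hnorm[OF H K iso]
  have inj: "x = y" if "x \<in> carrier H" "y \<in> carrier H" "U x = U y" for x y
    using that isometry_hnorm[OF H K iso, of "x - y"] by simp
  obtain V where V: "\<And>y. y \<in> carrier K \<Longrightarrow> V y \<in> carrier H" "\<And>y. y \<in> carrier K \<Longrightarrow> U (V y) = y"
    using surj by (metis image_iff)
  define U' where "U' = restrict_op (carrier K) V"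
  have U' [simp]: "y \<in> carrier K \<Longrightarrow> U' y \<in> carrier H" and UU' [simp]: "y \<in> carrier K \<Longrightarrow> U (U' y) = y"
    and out: "y \<notin> carrier K \<Longrightarrow> U' y = 0" for y
    using V by (auto simp: U'_def restrict_op_def)
  have U'U [simp]: "U' (U x) = x" if "x \<in> carrier H" for x
    by (rule inj) (use that in auto)
  have "isometry K H U'"
  proof (rule isometryI)
    show "U' (x + y) = U' x + U' y" if "x \<in> carrier K" "y \<in> carrier K" for x y
      by (rule inj) (use that in auto)
    show "U' (c *\<^sub>C x) = c *\<^sub>C U' x" if "x \<in> carrier K" for c x
      by (rule inj) (use that in auto)
    show "hnorm H (U' x) = hnorm K x" if "x \<in> carrier K" for x
      using isometry_hnorm[OF H K iso, of "U' x"] that by simp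
  qed (auto simp: out)
  moreover have "U' ` carrier K = carrier H"
  proof
    show "carrier H \<subseteq> U' ` carrier K" using U'U by (metis image_iff subsetI surj)
  qed auto
  moreover have "cinner K (U x) y = cinner H x (U' y)" if "x \<in> carrier H" "y \<in> carrier K" for x y
    using isometry_cinner[OF H K iso, of x "U' y"] that by simp
  ultimately show thesis using that[of U'] by (auto simp: unitary_op_def)
qed

lemma isometry_of_adjoint_inverse:
  assumes H: "inner_product_space H" and K: "inner_product_space K"
    and U: "U \<in> bounded_ops H K" "U' \<in> bounded_ops K H"
    and "\<And>x. x \<in> carrier H \<Longrightarrow> U' (U x) = x"
    and "\<And>x y. x \<in> carrier H \<Longrightarrow> y \<in> carrier K \<Longrightarrow> cinner K (U x) y = cinner H x (U' y)"
  shows "isometry H K U"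
  using assms op_closed[OF H K U(1)] by (auto simp: isometry_def hnorm_def)

lemma closed_subspace_kernel:
  assumes H: "inner_product_space H" and A: "A \<in> bounded_ops H H"
  shows "closed_subspace H {x \<in> carrier H. A x = 0}"
  unfolding closed_subspace_def
proof (intro conjI allI ballI impI)
  note [simp] = H op_linear[OF H H A]
  show "complex_vector.subspace {x \<in> carrier H. A x = 0}"
    by (auto simp: complex_vector.subspace_def)
  fix X x assume x: "x \<in> carrier H"
    and X: "(\<forall>n. X n \<in> {x \<in> carrier H. A x = 0}) \<and> (\<lambda>n::nat. hnorm H (X n - x)) \<longlonglongrightarrow> 0"
  obtain B where B: "B > 0" "\<And>x. x \<in> carrier H \<Longrightarrow> hnorm H (A x) \<le> B * hnorm H x"
    by (rule op_bound[OF H H A], rule that)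
  have "hnorm H (A x) \<le> B * hnorm H (X n - x)" for n
    using B(2)[of "X n - x"] X x by simp
  moreover have "(\<lambda>n. B * hnorm H (X n - x)) \<longlonglongrightarrow> B * 0"
    using X by (intro tendsto_intros) auto
  ultimately have "hnorm H (A x) \<le> B * 0" by (intro LIMSEQ_le_const) auto
  then have "hnorm H (A x) = 0" using hnorm_nonneg[OF H, of "A x"] x by (intro antisym) auto
  then show "x \<in> {x \<in> carrier H. A x = 0}" using x by simp
qed auto

section \<open>Structure of the class \<open>scrPA\<close>\<close>

text \<open>\<open>P\<close> is the projection onto the first summand and \<open>U\<close> the unitary of the block form, with
  inverse \<open>U'\<close>; \<open>P U P = U P\<close> expresses that \<open>U\<close> is block upper triangular.\<close>

definition triangular_unitary ::
    "'a::complex_vector chilbert \<Rightarrow> ('a \<Rightarrow> 'a) \<Rightarrow> ('a \<Rightarrow> 'a) \<Rightarrow> ('a \<Rightarrow> 'a) \<Rightarrow> bool" where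
  "triangular_unitary K P U U' \<longleftrightarrow> hilbert_space K \<and>
     P \<in> bounded_ops K K \<and> U \<in> bounded_ops K K \<and> U' \<in> bounded_ops K K \<and>
     (\<forall>x\<in>carrier K. P (P x) = P x \<and> U (U' x) = x \<and> U' (U x) = x \<and> P (U (P x)) = U (P x)) \<and>
     (\<forall>x\<in>carrier K. \<forall>y\<in>carrier K. cinner K (P x) y = cinner K x (P y)) \<and>
     (\<forall>x\<in>carrier K. \<forall>y\<in>carrier K. cinner K (U x) y = cinner K x (U' y))"

definition weighted_unitary ::
    "real \<Rightarrow> 'a::complex_vector chilbert \<Rightarrow> ('a \<Rightarrow> 'a) \<Rightarrow> ('a \<Rightarrow> 'a) \<Rightarrow> 'a \<Rightarrow> 'a" where
  "weighted_unitary r K P U =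
     restrict_op (carrier K) (\<lambda>x. U (of_real r *\<^sub>C P x + of_real (1 / r) *\<^sub>C (x - P x)))"

section \<open>The model operator, its inverse, its adjoint and its defect\<close>

locale annulus_model =
  fixes r :: real and K :: "'a::complex_vector chilbert" and P U U'
  assumes r: "0 < r" "r < 1" and model: "triangular_unitary K P U U'"
begin

lemma hilbert: "hilbert_space K"
  and P_bounded: "P \<in> bounded_ops K K"
  and U_bounded: "U \<in> bounded_ops K K"
  and U'_bounded: "U' \<in> bounded_ops K K"
  and P_P [simp]: "x \<in> carrier K \<Longrightarrow> P (P x) = P x"
  and U_U' [simp]: "x \<in> carrier K \<Longrightarrow> U (U' x) = x"
  and U'_U [simp]: "x \<in> carrier K \<Longrightarrow> U' (U x) = x"
  and PUP: "x \<in> carrier K \<Longrightarrow> P (U (P x)) = U (P x)"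
  and P_sym: "x \<in> carrier K \<Longrightarrow> y \<in> carrier K \<Longrightarrow> cinner K (P x) y = cinner K x (P y)"
  and U_adj: "x \<in> carrier K \<Longrightarrow> y \<in> carrier K \<Longrightarrow> cinner K (U x) y = cinner K x (U' y)"
  using model by (auto simp: triangular_unitary_def)

lemma ips [simp]: "inner_product_space K"
  using hilbert by simp

lemmas ops_linear [simp] = op_linear[OF ips ips P_bounded] op_linear[OF ips ips U_bounded]
  op_linear[OF ips ips U'_bounded]

lemmas ops_outside = op_outside[OF ips ips P_bounded] op_outside[OF ips ips U_bounded]
  op_outside[OF ips ips U'_bounded]

lemma r_nonzero [simp]: "r \<noteq> 0" using r by simp

lemma U_isometry: "isometry K K U"
  using U_adj by (intro isometry_of_adjoint_inverse[OF ips ips U_bounded U'_bounded]) auto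

lemma U'_adj: "x \<in> carrier K \<Longrightarrow> y \<in> carrier K \<Longrightarrow> cinner K (U' x) y = cinner K x (U y)"
  using U_adj[of y x] cinner_commute[of K y "U' x"] cinner_commute[of K "U y" x] by simp

lemma U'_isometry: "isometry K K U'"
  using U'_adj by (intro isometry_of_adjoint_inverse[OF ips ips U'_bounded U_bounded]) auto

lemmas hnorm_U [simp] = isometry_hnorm[OF ips ips U_isometry]
lemmas hnorm_U' [simp] = isometry_hnorm[OF ips ips U'_isometry]

lemma hnorm_split:
  assumes "x \<in> carrier K"
  shows "(hnorm K (P x))\<^sup>2 + (hnorm K (x - P x))\<^sup>2 = (hnorm K x)\<^sup>2"
  using assms P_sym[of x x] P_sym[of "P x" x] by (simp add: hnorm_power2 cinner_linear P_sym)

lemma hnorm_combination: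
  assumes "x \<in> carrier K"
  shows "(hnorm K (a *\<^sub>C P x + b *\<^sub>C (x - P x)))\<^sup>2 =
    (cmod a)\<^sup>2 * (hnorm K (P x))\<^sup>2 + (cmod b)\<^sup>2 * (hnorm K (x - P x))\<^sup>2"
proof -
  have "cinner K (P x) (x - P x) = 0" using assms by (simp add: cinner_linear P_sym)
  then show ?thesis
    using assms by (simp add: hnorm_power2_add hnorm_scale power_mult_distrib cinner_scale_left cinner_scale_right)
qed

lemma hnorm_P_le:
  assumes x: "x \<in> carrier K"
  shows "hnorm K (P x) \<le> 1 * hnorm K x"
proof (rule power2_le_imp_le)
  show "(hnorm K (P x))\<^sup>2 \<le> (1 * hnorm K x)\<^sup>2"
    unfolding mult_1 using hnorm_split[OF x] zero_le_power2[of "hnorm K (x - P x)"] by linarith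
qed (use x in simp)

abbreviation J where "J \<equiv> weighted_unitary r K P U"

text \<open>Inverse and adjoint of \<open>J\<close>: both apply \<open>U'\<close> first; the inverse
  \<open>J'\<close> then reciprocates the weights r and 1/r, while \<open>J_adj\<close> below keeps
  them.\<close>

definition J' where
  "J' = restrict_op (carrier K)
     (\<lambda>x. of_real (1 / r) *\<^sub>C P (U' x) + of_real r *\<^sub>C (U' x - P (U' x)))"

definition J_adj where
  "J_adj = restrict_op (carrier K)
     (\<lambda>x. of_real r *\<^sub>C P (U' x) + of_real (1 / r) *\<^sub>C (U' x - P (U' x)))"

lemma J_apply: "x \<in> carrier K \<Longrightarrow> J x = U (of_real r *\<^sub>C P x + of_real (1 / r) *\<^sub>C (x - P x))"
  and J'_apply: "x \<in> carrier K \<Longrightarrow> J' x = of_real (1 / r) *\<^sub>C P (U' x) + of_real r *\<^sub>C (U' x - P (U' x))"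
  and J_adj_apply: "x \<in> carrier K \<Longrightarrow> J_adj x = of_real r *\<^sub>C P (U' x) + of_real (1 / r) *\<^sub>C (U' x - P (U' x))"
  by (simp_all add: weighted_unitary_def restrict_op_def J'_def J_adj_def)

lemma J_eq: "J = U \<circ> (of_real r *\<^sub>C P + of_real (1 / r) *\<^sub>C (id_op K - P))"
  by (rule ext) (auto simp: weighted_unitary_def restrict_op_def ops_outside id_op_def)

lemma J'_eq: "J' = (of_real (1 / r) *\<^sub>C P + of_real r *\<^sub>C (id_op K - P)) \<circ> U'"
  by (rule ext) (auto simp: J'_def restrict_op_def ops_outside id_op_def)

lemma J_bounded: "J \<in> bounded_ops K K"
  unfolding J_eq
  by (intro comp_bounded[OF ips ips ips] add_bounded scaleC_bounded diff_bounded id_op_bounded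
      U_bounded P_bounded ips)

lemma J'_bounded: "J' \<in> bounded_ops K K"
  unfolding J'_eq
  by (intro comp_bounded[OF ips ips ips] add_bounded scaleC_bounded diff_bounded id_op_bounded
      U'_bounded P_bounded ips)

lemmas J_linear [simp] = op_linear[OF ips ips J_bounded] op_linear[OF ips ips J'_bounded]

lemma J_adj_closed [simp]: "x \<in> carrier K \<Longrightarrow> J_adj x \<in> carrier K"
  by (simp add: J_adj_apply)

lemma J_J' [simp]: "x \<in> carrier K \<Longrightarrow> J (J' x) = x"
proof -
  assume x: "x \<in> carrier K"
  have "P (J' x) = of_real (1 / r) *\<^sub>C P (U' x)"
    "J' x - P (J' x) = of_real r *\<^sub>C (U' x - P (U' x))"
    using x by (simp_all add: J'_apply)
  then have "J (J' x) = U (P (U' x) + (U' x - P (U' x)))"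
    using x by (simp only: J_apply J_linear scaleC_scaleC) (simp add: scaleC_one)
  then show ?thesis using x by simp
qed

lemma J'_J [simp]: "x \<in> carrier K \<Longrightarrow> J' (J x) = x"
  by (simp add: J_apply J'_apply)

lemma J_invertible: "invertible_op K J" and inv_J: "inv_op K J = J'"
  using inv_op_eqI[OF J'_bounded J_bounded ips] by auto

lemma cinner_J: "x \<in> carrier K \<Longrightarrow> y \<in> carrier K \<Longrightarrow> cinner K (J x) y = cinner K x (J_adj y)"
  by (simp add: J_apply J_adj_apply cinner_linear U_adj P_sym)

lemma adj_J: "adj_op K K J = J_adj"
proof (rule adj_op_eqI[OF ips ips _ cinner_J])
  show "J_adj \<in> bounded_ops K K"
    by (rule bounded_ops_of_adjoint[OF ips ips J_bounded _ _ cinner_J]) (auto simp: J_adj_def restrict_op_def)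
qed

lemma J_adj_J: "x \<in> carrier K \<Longrightarrow> J_adj (J x) = of_real (r\<^sup>2) *\<^sub>C P x + of_real (1 / r\<^sup>2) *\<^sub>C (x - P x)"
  by (simp add: J_apply J_adj_apply power2_eq_square)

lemma hnorm_J:
  assumes "x \<in> carrier K"
  shows "(hnorm K (J x))\<^sup>2 = r\<^sup>2 * (hnorm K (P x))\<^sup>2 + 1 / r\<^sup>2 * (hnorm K (x - P x))\<^sup>2"
proof -
  have "hnorm K (J x) = hnorm K (of_real r *\<^sub>C P x + of_real (1 / r) *\<^sub>C (x - P x))"
    unfolding J_apply[OF assms] using assms by (intro hnorm_U) simp
  then show ?thesis using assms by (simp add: hnorm_combination power_divide norm_divide)
qed

lemma hnorm_J': "x \<in> carrier K \<Longrightarrow>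
    (hnorm K (J' x))\<^sup>2 = 1 / r\<^sup>2 * (hnorm K (P (U' x)))\<^sup>2 + r\<^sup>2 * (hnorm K (U' x - P (U' x)))\<^sup>2"
  by (simp add: J'_apply hnorm_combination power_divide norm_divide)

text \<open>Pythagoras is applied to x and to \<open>U' x\<close>, which have the same norm. The
  defect of \<open>J\<close> at x thus vanishes exactly when \<open>P x\<close> and
  \<open>P (U' x)\<close> have equal norm, the balance condition behind extremality.\<close>

lemma hnorm_J_J':
  assumes "x \<in> carrier K"
  shows "(hnorm K (J x))\<^sup>2 + (hnorm K (J' x))\<^sup>2 =
    (1 / r\<^sup>2 + r\<^sup>2) * (hnorm K x)\<^sup>2 - (1 / r\<^sup>2 - r\<^sup>2) * ((hnorm K (P x))\<^sup>2 - (hnorm K (P (U' x)))\<^sup>2)"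
  using hnorm_split[OF assms] hnorm_split[of "U' x"] assms
  unfolding hnorm_J[OF assms] hnorm_J'[OF assms] by (simp add: algebra_simps) algebra

text \<open>U maps ran P into itself, so U P U* is the projection onto a subspace of ran P. This is
  what makes the defect of \<open>J\<close> positive.\<close>

lemma hnorm_PU'_le:
  assumes x: "x \<in> carrier K"
  shows "hnorm K (P (U' x)) \<le> hnorm K (P x)"
proof (cases "P (U' x) = 0")
  case False
  then have pos: "hnorm K (P (U' x)) > 0" using x by (simp add: less_le)
  have "(hnorm K (P (U' x)))\<^sup>2 = Re (cinner K (U (P (U' x))) x)"
    using x by (simp add: hnorm_power2 U_adj P_sym)
  also have "\<dots> = Re (cinner K (U (P (U' x))) (P x))"
    using x PUP[of "U' x"] P_sym[of "U (P (U' x))" x] by simp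
  also have "\<dots> \<le> hnorm K (P (U' x)) * hnorm K (P x)"
    using x Re_Cauchy_Schwarz[of K "U (P (U' x))" "P x"] by simp
  finally show ?thesis using pos by (simp add: power2_eq_square)
qed (use x in simp)

lemma J_PA: "J \<in> PA r K"
proof -
  have "0 \<le> (1 / r\<^sup>2 - r\<^sup>2) * ((hnorm K (P x))\<^sup>2 - (hnorm K (P (U' x)))\<^sup>2)" if "x \<in> carrier K" for x
    using inverse_power2_gt[OF r] power_mono[OF hnorm_PU'_le[OF that], of 2] that by (intro mult_nonneg_nonneg) auto
  then show ?thesis
    using hilbert J_invertible hnorm_J_J' by (auto simp: PA_iff[OF r] inv_J)
qed

end

lemma triangular_unitaryI:
  assumes "hilbert_space K" "P \<in> bounded_ops K K" "U \<in> bounded_ops K K" "U' \<in> bounded_ops K K"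
    and "\<And>x. x \<in> carrier K \<Longrightarrow> P (P x) = P x"
    and "\<And>x. x \<in> carrier K \<Longrightarrow> U (U' x) = x" "\<And>x. x \<in> carrier K \<Longrightarrow> U' (U x) = x"
    and "\<And>x. x \<in> carrier K \<Longrightarrow> P (U (P x)) = U (P x)"
    and "\<And>x y. x \<in> carrier K \<Longrightarrow> y \<in> carrier K \<Longrightarrow> cinner K (P x) y = cinner K x (P y)"
    and "\<And>x y. x \<in> carrier K \<Longrightarrow> y \<in> carrier K \<Longrightarrow> cinner K (U x) y = cinner K x (U' y)"
  shows "triangular_unitary K P U U'"
  using assms unfolding triangular_unitary_def by blast

text \<open>The relations between \<open>P\<close>, \<open>U\<close> and \<open>U'\<close> survive
  conjugation by a unitary. This removes \<Phi> from the definition of \<open>scrPA\<close> and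
  later moves the lift to another ambient type.\<close>

lemma triangular_unitary_transport:
  assumes r: "0 < r" "r < 1" and model: "triangular_unitary L P U U'" and K: "hilbert_space K"
    and \<Phi>: "unitary_op K L \<Phi>" and J: "J \<in> bounded_ops K K" "\<Phi> \<circ> J = weighted_unitary r L P U \<circ> \<Phi>"
  shows "\<exists>P U U'. triangular_unitary K P U U' \<and> J = weighted_unitary r K P U"
proof -
  interpret annulus_model r L P U U' by unfold_locales (use r model in auto)
  have ipsK [simp]: "inner_product_space K" using K by simp
  obtain \<Psi> where \<Psi>: "unitary_op L K \<Psi>" "\<And>x. x \<in> carrier K \<Longrightarrow> \<Psi> (\<Phi> x) = x"
    "\<And>y. y \<in> carrier L \<Longrightarrow> \<Phi> (\<Psi> y) = y"
    "\<And>x y. x \<in> carrier K \<Longrightarrow> y \<in> carrier L \<Longrightarrow> cinner L (\<Phi> x) y = cinner K x (\<Psi> y)"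
    by (rule unitary_op_inverse[OF ipsK ips \<Phi>], rule that)
  have \<Phi>_bdd: "\<Phi> \<in> bounded_ops K L" and \<Psi>_bdd: "\<Psi> \<in> bounded_ops L K"
    using \<Phi> \<Psi>(1) by (auto simp: unitary_op_def isometry_def)
  note [simp] = op_linear[OF ipsK ips \<Phi>_bdd] op_linear[OF ips ipsK \<Psi>_bdd] \<Psi>(2,3)
  have adj: "cinner K (\<Psi> y) x = cinner L y (\<Phi> x)" if "x \<in> carrier K" "y \<in> carrier L" for x y
    using \<Psi>(4)[OF that] cinner_commute[of K x "\<Psi> y"] cinner_commute[of L "\<Phi> x" y] that by simp
  let ?C = "\<lambda>A. \<Psi> \<circ> A \<circ> \<Phi>"
  have C: "?C A \<in> bounded_ops K K" if "A \<in> bounded_ops L L" for A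
    by (rule comp_bounded[OF ipsK ips ipsK comp_bounded[OF ips ips ipsK \<Psi>_bdd that] \<Phi>_bdd])
  have "triangular_unitary K (?C P) (?C U) (?C U')"
    by (rule triangular_unitaryI[OF K C[OF P_bounded] C[OF U_bounded] C[OF U'_bounded]])
      (simp_all add: PUP P_sym U_adj adj \<Psi>(4)[symmetric])
  moreover have "J = weighted_unitary r K (?C P) (?C U)"
  proof (rule ext)
    fix x
    show "J x = weighted_unitary r K (?C P) (?C U) x"
    proof (cases "x \<in> carrier K")
      case True
      have Jx: "J x \<in> carrier K" by (rule op_closed[OF ipsK ipsK J(1) True])
      have "J x = \<Psi> (\<Phi> (J x))" using Jx by simp
      also have "\<Phi> (J x) = weighted_unitary r L P U (\<Phi> x)" using J(2) by (metis comp_apply)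
      finally show ?thesis using True by (simp add: J_apply weighted_unitary_def restrict_op_def)
    next
      case False
      then show ?thesis using op_outside[OF ipsK ipsK J(1) False] by (simp add: weighted_unitary_def restrict_op_def)
    qed
  qed
  ultimately show ?thesis by blast
qed

lemma block_op_apply:
  "x \<in> carrier H \<Longrightarrow> y \<in> carrier K \<Longrightarrow> block_op H K A B C D (x, y) = (A x + B y, C x + D y)"
  by (simp add: block_op_def restrict_op_def)

lemma restrict_op_apply: "x \<in> M \<Longrightarrow> restrict_op M T x = T x"
  and restrict_op_outside: "x \<notin> M \<Longrightarrow> restrict_op M T x = 0"
  by (simp_all add: restrict_op_def)

lemma fst_projection_bounded:
  fixes H :: "'a::complex_vector chilbert" and K :: "'b::complex_vector chilbert"
  assumes ips: "inner_product_space H" "inner_product_space K"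
  shows "restrict_op (carrier (hprod H K)) (\<lambda>p. (fst p, 0)) \<in> bounded_ops (hprod H K) (hprod H K)"
    (is "?P \<in> _")
proof (rule bounded_opsI[where B = 1])
  show "hnorm (hprod H K) (?P p) \<le> 1 * hnorm (hprod H K) p" if p: "p \<in> carrier (hprod H K)" for p
  proof (rule power2_le_imp_le)
    show "(hnorm (hprod H K) (?P p))\<^sup>2 \<le> (1 * hnorm (hprod H K) p)\<^sup>2"
      using p ips hnorm_hprod[OF ips, of p] hnorm_hprod[OF ips, of "(fst p, 0)"]
      by (auto simp: restrict_op_apply)
  qed (use hnorm_nonneg[OF inner_product_space_hprod[OF ips] p] in simp)
qed (auto simp: restrict_op_def ips)

text \<open>With P the projection onto the first summand, the zero in the lower left corner of the
  block operator is the relation P U P = U P, and the block factorization of J is the weighting of U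
  by r on ran P and 1/r on ker P.\<close>

lemma scrPA_imp_triangular_unitary:
  assumes r: "0 < r" "r < 1" and J: "J \<in> scrPA r K"
  shows "\<exists>P U U'. triangular_unitary K P U U' \<and> J = weighted_unitary r K P U"
proof -
  obtain Kp Km :: "'a chilbert" and V E W \<Phi> where hs: "hilbert_space K" "hilbert_space Kp" "hilbert_space Km"
    and J_bdd: "J \<in> bounded_ops K K" and ops: "V \<in> bounded_ops Kp Kp" "E \<in> bounded_ops Km Kp" "W \<in> bounded_ops Km Km"
    and unitary: "unitary_op (hprod Kp Km) (hprod Kp Km) (block_op Kp Km V E 0 (adj_op Km Km W))"
    and \<Phi>: "unitary_op K (hprod Kp Km) \<Phi>"
    and J_block: "\<Phi> \<circ> J = block_op Kp Km
                  (of_real r *\<^sub>C V) (of_real (1 / r) *\<^sub>C E)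
                  0                         (of_real (1 / r) *\<^sub>C adj_op Km Km W) \<circ> \<Phi>"
    using J unfolding scrPA_def by blast
  let ?L = "hprod Kp Km" and ?U = "block_op Kp Km V E 0 (adj_op Km Km W)"
  define D where "D = adj_op Km Km W"
  have ips [simp]: "inner_product_space Kp" "inner_product_space Km" using hs by auto
  have L: "hilbert_space ?L" and ipsL: "inner_product_space ?L" using hs by auto
  have D: "D \<in> bounded_ops Km Km" unfolding D_def by (rule adj_op_bounded[OF hs(3,3) ops(3)])
  note [simp] = op_linear[OF ips(1,1) ops(1)] op_linear[OF ips(2,1) ops(2)] op_linear[OF ips(2,2) D]
  obtain U' where U': "unitary_op ?L ?L U'" "\<And>x. x \<in> carrier ?L \<Longrightarrow> U' (?U x) = x"
    "\<And>y. y \<in> carrier ?L \<Longrightarrow> ?U (U' y) = y"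
    "\<And>x y. x \<in> carrier ?L \<Longrightarrow> y \<in> carrier ?L \<Longrightarrow> cinner ?L (?U x) y = cinner ?L x (U' y)"
    by (rule unitary_op_inverse[OF ipsL ipsL unitary], rule that)
  define P where "P = restrict_op (carrier ?L) (\<lambda>p. (fst p, 0 :: 'a))"
  have P_apply: "P (x, y) = (x, 0)" if "x \<in> carrier Kp" "y \<in> carrier Km" for x y
    using that by (simp add: P_def restrict_op_def)
  have P: "P \<in> bounded_ops ?L ?L" unfolding P_def by (rule fst_projection_bounded[OF ips])
  have "triangular_unitary ?L P ?U U'"
  proof (rule triangular_unitaryI[OF L P _ _ _ U'(3,2) _ _ U'(4)])
    show "?U \<in> bounded_ops ?L ?L" "U' \<in> bounded_ops ?L ?L"
      using unitary U'(1) by (auto simp: unitary_op_def isometry_def)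
  qed (auto simp: P_apply block_op_apply cinner_hprod D_def[symmetric])
  moreover have "\<Phi> \<circ> J = weighted_unitary r ?L P ?U \<circ> \<Phi>"
  proof -
    have eq: "block_op Kp Km (of_real r *\<^sub>C V) (of_real (1 / r) *\<^sub>C E)
        0 (of_real (1 / r) *\<^sub>C adj_op Km Km W) p = weighted_unitary r ?L P ?U p" for p
    proof (cases "p \<in> carrier ?L")
      case True
      then obtain x y where p: "p = (x, y)" "x \<in> carrier Kp" "y \<in> carrier Km" by auto
      have "(x, y) - (x, 0) = (0, y)" by simp
      then show ?thesis
        using p by (simp add: block_op_apply weighted_unitary_def restrict_op_apply P_apply D_def[symmetric])
    next
      case False
      then show ?thesis unfolding block_op_def weighted_unitary_def by (simp add: restrict_op_outside)
    qed
    show ?thesis unfolding J_block by (rule ext) (simp only: comp_apply eq)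
  qed
  ultimately show ?thesis by (intro triangular_unitary_transport[OF r _ hs(1) \<Phi> J_bdd])
qed

section \<open>From the pair of a projection and a unitary back to the block form\<close>

context annulus_model
begin

text \<open>The range of P is written as the kernel of 1 - P, so that
  \<open>closed_subspace_kernel\<close> covers both summands.\<close>

definition Kp where "Kp = sub_hilbert K {x \<in> carrier K. x - P x = 0}"
definition Km where "Km = sub_hilbert K {x \<in> carrier K. P x = 0}"

lemma carrier_Kp: "x \<in> carrier Kp \<longleftrightarrow> x \<in> carrier K \<and> P x = x"
  and carrier_Km: "x \<in> carrier Km \<longleftrightarrow> x \<in> carrier K \<and> P x = 0"
  by (auto simp: Kp_def Km_def)

lemma hilbert_Kp: "hilbert_space Kp"
proof -
  have "{x \<in> carrier K. x - P x = 0} = {x \<in> carrier K. (id_op K - P) x = 0}" by auto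
  then show ?thesis unfolding Kp_def
    using closed_subspace_kernel[OF ips diff_bounded[OF ips ips id_op_bounded[OF ips] P_bounded]]
    by (intro hilbert_space_sub_hilbert hilbert) simp
qed

lemma hilbert_Km: "hilbert_space Km"
  unfolding Km_def by (intro hilbert_space_sub_hilbert hilbert closed_subspace_kernel ips P_bounded)

lemma cinner_Kp [simp]: "cinner Kp = cinner K" and cinner_Km [simp]: "cinner Km = cinner K"
  and hnorm_Kp [simp]: "hnorm Kp = hnorm K" and hnorm_Km [simp]: "hnorm Km = hnorm K"
  by (simp_all add: Kp_def Km_def)

text \<open>U leaves ran P invariant, hence its adjoint \<open>U'\<close> leaves the orthogonal
  complement ker P invariant.\<close>

lemma P_U'_Km:
  assumes "x \<in> carrier K" "P x = 0"
  shows "P (U' x) = 0"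
proof (rule eq_zeroI[OF ips])
  fix z assume z: "z \<in> carrier K"
  have "cinner K (P (U' x)) z = cinner K x (P (U (P z)))"
    using assms z by (simp add: P_sym U'_adj PUP)
  also have "\<dots> = cinner K (P x) (U (P z))" using assms z P_sym[of x "U (P z)"] by simp
  finally show "cinner K (P (U' x)) z = 0" using assms z by simp
qed (use assms in simp)

lemma J_scrPA: "J \<in> scrPA r K"
proof -
  have ipsp: "inner_product_space Kp" "inner_product_space Km" using hilbert_Kp hilbert_Km by auto
  define V where "V = restrict_op (carrier Kp) U"
  define E where "E = restrict_op (carrier Km) (\<lambda>y. P (U y))"
  define D where "D = restrict_op (carrier Km) (\<lambda>y. U y - P (U y))"
  \<comment> \<open>Since \<open>U'\<close> preserves ker P, its restriction is an isometry there,
    and the adjoint of that restriction is \<open>D\<close>, the compression of U to ker P.\<close>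
  define W where "W = restrict_op (carrier Km) U'"
  define \<Phi> where "\<Phi> = restrict_op (carrier K) (\<lambda>x. (P x, x - P x))"
  have UKp: "P (U x) = U x" if "x \<in> carrier K" "P x = x" for x
    using PUP[of x] that by simp
  have V: "V \<in> bounded_ops Kp Kp"
    by (rule bounded_opsI[where B = 1]) (auto simp: V_def restrict_op_def carrier_Kp UKp)
  have E: "E \<in> bounded_ops Km Kp"
  proof (rule bounded_opsI[where B = 1])
    show "hnorm Kp (E x) \<le> 1 * hnorm Km x" if "x \<in> carrier Km" for x
      using that hnorm_P_le[of "U x"] by (auto simp: E_def restrict_op_def carrier_Km)
  qed (auto simp: E_def restrict_op_def carrier_Km carrier_Kp)
  have W: "W \<in> bounded_ops Km Km"
    by (rule bounded_opsI[where B = 1]) (auto simp: W_def restrict_op_def carrier_Km P_U'_Km)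
  have WD: "cinner Km (W x) y = cinner Km x (D y)" if "x \<in> carrier Km" "y \<in> carrier Km" for x y
    using that P_sym[of x "U y"]
    by (simp add: W_def D_def restrict_op_apply) (auto simp: carrier_Km U'_adj cinner_linear)
  have D: "D \<in> bounded_ops Km Km"
    by (rule bounded_ops_of_adjoint[OF ipsp(2,2) W _ _ WD]) (auto simp: D_def restrict_op_def carrier_Km)
  have adjW: "adj_op Km Km W = D" by (rule adj_op_eqI[OF ipsp(2,2) D WD])
  \<comment> \<open>When (x, y) is identified with x + y, the block operator is U itself; the corner
    below V vanishes because U x stays in ran P.\<close>
  have block: "block_op Kp Km V E 0 D (x, y) = (P (U (x + y)), U (x + y) - P (U (x + y)))"
    if "x \<in> carrier Kp" "y \<in> carrier Km" for x y
    using that by (simp add: block_op_apply V_def E_def D_def restrict_op_apply) (auto simp: carrier_Kp carrier_Km UKp)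
  have norm_prod: "hnorm (hprod Kp Km) (P x, x - P x) = hnorm K x" if "x \<in> carrier K" for x
  proof (rule power2_eq_imp_eq)
    have mem: "(P x, x - P x) \<in> carrier (hprod Kp Km)" using that by (simp add: carrier_Kp carrier_Km)
    then show "(hnorm (hprod Kp Km) (P x, x - P x))\<^sup>2 = (hnorm K x)\<^sup>2"
      using hnorm_hprod[OF ipsp mem] hnorm_split[OF that] by simp
    show "0 \<le> hnorm (hprod Kp Km) (P x, x - P x)"
      by (rule hnorm_nonneg[OF inner_product_space_hprod[OF ipsp] mem])
  qed (use that in simp)
  have decomp: "\<exists>z\<in>carrier K. p = (P z, z - P z)" if "p \<in> carrier (hprod Kp Km)" for p
    using that by (intro bexI[of _ "fst p + snd p"]) (auto simp: carrier_Kp carrier_Km)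
  have \<Phi>: "unitary_op K (hprod Kp Km) \<Phi>"
    unfolding unitary_op_def
  proof (intro conjI isometryI)
    show "\<Phi> ` carrier K = carrier (hprod Kp Km)"
    proof
      show "carrier (hprod Kp Km) \<subseteq> \<Phi> ` carrier K"
        using decomp by (auto simp: \<Phi>_def restrict_op_def)
    qed (auto simp: \<Phi>_def restrict_op_def carrier_Kp carrier_Km)
  qed (auto simp: \<Phi>_def restrict_op_def norm_prod carrier_Kp carrier_Km zero_prod_def
      complex_vector.scale_right_diff_distrib)
  have blockz: "block_op Kp Km V E 0 D (P z, z - P z) = (P (U z), U z - P (U z))" if "z \<in> carrier K" for z
    using that block[of "P z" "z - P z"] by (simp add: carrier_Kp carrier_Km)
  have "unitary_op (hprod Kp Km) (hprod Kp Km) (block_op Kp Km V E 0 D)"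
    unfolding unitary_op_def
  proof (intro conjI isometryI)
    show "block_op Kp Km V E 0 D ` carrier (hprod Kp Km) = carrier (hprod Kp Km)"
    proof
      show "carrier (hprod Kp Km) \<subseteq> block_op Kp Km V E 0 D ` carrier (hprod Kp Km)"
      proof
        fix p assume "p \<in> carrier (hprod Kp Km)"
        then obtain z where z: "z \<in> carrier K" "p = (P z, z - P z)" using decomp by blast
        then have "p = block_op Kp Km V E 0 D (P (U' z), U' z - P (U' z))" by (simp add: blockz)
        then show "p \<in> block_op Kp Km V E 0 D ` carrier (hprod Kp Km)"
          using z by (auto intro!: image_eqI simp: carrier_Kp carrier_Km)
      qed
    qed (auto simp: block carrier_Kp carrier_Km)
    show "hnorm (hprod Kp Km) (block_op Kp Km V E 0 D p) = hnorm (hprod Kp Km) p" if "p \<in> carrier (hprod Kp Km)" for p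
      using decomp[OF that] by (auto simp: blockz norm_prod)
    show "block_op Kp Km V E 0 D p = 0" if "p \<notin> carrier (hprod Kp Km)" for p
      using that unfolding block_op_def by (rule restrict_op_outside)
  qed (auto simp: block carrier_Kp carrier_Km complex_vector.scale_right_diff_distrib scaleC_add_right)
  moreover have "\<Phi> \<circ> J = block_op Kp Km (of_real r *\<^sub>C V) (of_real (1 / r) *\<^sub>C E)
      0 (of_real (1 / r) *\<^sub>C D) \<circ> \<Phi>"
  proof (rule ext)
    fix x
    show "(\<Phi> \<circ> J) x = (block_op Kp Km (of_real r *\<^sub>C V) (of_real (1 / r) *\<^sub>C E)
      0 (of_real (1 / r) *\<^sub>C D) \<circ> \<Phi>) x"
    proof (cases "x \<in> carrier K")
      case True
      let ?y = "x - P x"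
      have mem: "P x \<in> carrier Kp" "?y \<in> carrier Km" using True by (simp_all add: carrier_Kp carrier_Km)
      have "J x = of_real r *\<^sub>C U (P x) + of_real (1 / r) *\<^sub>C U ?y"
        using True by (simp add: J_apply)
      moreover from this have "P (J x) = of_real r *\<^sub>C U (P x) + of_real (1 / r) *\<^sub>C P (U ?y)"
        using True by (simp add: PUP)
      ultimately have "(P (J x), J x - P (J x)) =
          (of_real r *\<^sub>C U (P x) + of_real (1 / r) *\<^sub>C P (U ?y),
           of_real (1 / r) *\<^sub>C (U ?y - P (U ?y)))"
        by (simp only: complex_vector.scale_right_diff_distrib add_diff_cancel_left)
      then show ?thesis
        using True mem J_linear(1)[OF True]
        by (simp only: comp_apply \<Phi>_def restrict_op_apply block_op_apply scaleC_apply V_def E_def D_def zero_fun_apply add_0_left)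
    next
      case False
      then show ?thesis
        using op_outside[OF ips ips J_bounded False]
        by (simp add: \<Phi>_def restrict_op_def block_op_def carrier_Kp carrier_Km zero_prod_def V_def E_def D_def)
    qed
  qed
  ultimately show ?thesis
    unfolding scrPA_def using hilbert J_bounded hilbert_Kp hilbert_Km V E W \<Phi> adjW by blast
qed

end

lemma scrPA_iff:
  assumes r: "0 < r" "r < 1"
  shows "J \<in> scrPA r K \<longleftrightarrow> (\<exists>P U U'. triangular_unitary K P U U' \<and> J = weighted_unitary r K P U)"
proof
  assume "\<exists>P U U'. triangular_unitary K P U U' \<and> J = weighted_unitary r K P U"
  then obtain P U U' where "triangular_unitary K P U U'" and J: "J = weighted_unitary r K P U" by blast
  then interpret annulus_model r K P U U' by unfold_locales (use r in auto)
  show "J \<in> scrPA r K" using J_scrPA J by simp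
qed (rule scrPA_imp_triangular_unitary[OF r])

lemma scrPA_cases:
  assumes "0 < r" "r < 1" "J \<in> scrPA r K"
  obtains P U U' where "annulus_model r K P U U'" "J = weighted_unitary r K P U"
  using assms scrPA_iff[OF assms(1,2), of J K] by (auto simp: annulus_model_def)

lemma scrPA_subset_PA:
  assumes "0 < r" "r < 1"
  shows "scrPA r K \<subseteq> PA r K"
proof
  fix J assume "J \<in> scrPA r K"
  then obtain P U U' where "annulus_model r K P U U'" "J = weighted_unitary r K P U"
    using scrPA_cases[OF assms] by blast
  then show "J \<in> PA r K" using annulus_model.J_PA by blast
qed

section \<open>Permanence under representations, direct sums and restrictions to reducing
  subspaces\<close>

lemma (in annulus_model) scrPA_star_rep:
  assumes G: "hilbert_space G" and \<pi>: "unital_star_rep K G \<pi>"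
  shows "\<pi> J \<in> scrPA r G"
proof -
  have ipsG [simp]: "inner_product_space G" using G by simp
  have rep: "A \<in> bounded_ops K K \<Longrightarrow> \<pi> A \<in> bounded_ops G G"
    "A \<in> bounded_ops K K \<Longrightarrow> B \<in> bounded_ops K K \<Longrightarrow> \<pi> (A + B) = \<pi> A + \<pi> B"
    "A \<in> bounded_ops K K \<Longrightarrow> \<pi> (c *\<^sub>C A) = c *\<^sub>C \<pi> A"
    "A \<in> bounded_ops K K \<Longrightarrow> B \<in> bounded_ops K K \<Longrightarrow> \<pi> (A \<circ> B) = \<pi> A \<circ> \<pi> B"
    "A \<in> bounded_ops K K \<Longrightarrow> \<pi> (adj_op K K A) = adj_op G G (\<pi> A)"
    "\<pi> (id_op K) = id_op G" for A B c
    using \<pi> unfolding unital_star_rep_def by blast+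
  note ops = P_bounded U_bounded U'_bounded
  note comp = comp_bounded[OF ips ips ips]
  have "adj_op K K P = P" by (rule adj_op_eqI[OF ips ips P_bounded P_sym])
  then have adjP: "adj_op G G (\<pi> P) = \<pi> P" using rep(5)[OF P_bounded] by simp
  have "adj_op K K U = U'" by (rule adj_op_eqI[OF ips ips U'_bounded U_adj])
  then have adjU: "adj_op G G (\<pi> U) = \<pi> U'" using rep(5)[OF U_bounded] by simp
  have "P \<circ> P = P" "U \<circ> U' = id_op K" "U' \<circ> U = id_op K" "P \<circ> (U \<circ> P) = U \<circ> P"
    by (rule bounded_ops_eqI[where H = K and K = K]; (intro comp ops id_op_bounded ips)?; simp add: PUP)+
  then have \<pi>_comp: "\<pi> P \<circ> \<pi> P = \<pi> P" "\<pi> U \<circ> \<pi> U' = id_op G" "\<pi> U' \<circ> \<pi> U = id_op G"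
    "\<pi> P \<circ> (\<pi> U \<circ> \<pi> P) = \<pi> U \<circ> \<pi> P"
    by (simp_all add: rep(4,6)[symmetric] ops comp)
  have "triangular_unitary G (\<pi> P) (\<pi> U) (\<pi> U')"
  proof (rule triangular_unitaryI[OF G rep(1)[OF P_bounded] rep(1)[OF U_bounded] rep(1)[OF U'_bounded]])
    fix x assume x: "x \<in> carrier G"
    show "\<pi> P (\<pi> P x) = \<pi> P x" "\<pi> U (\<pi> U' x) = x" "\<pi> U' (\<pi> U x) = x"
      "\<pi> P (\<pi> U (\<pi> P x)) = \<pi> U (\<pi> P x)"
      using \<pi>_comp[THEN fun_cong, of x] x by simp_all
    fix y assume y: "y \<in> carrier G"
    show "cinner G (\<pi> P x) y = cinner G x (\<pi> P y)"
      using cinner_adj_op[OF G G rep(1)[OF P_bounded] x y] adjP by simp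
    show "cinner G (\<pi> U x) y = cinner G x (\<pi> U' y)"
      using cinner_adj_op[OF G G rep(1)[OF U_bounded] x y] adjU by simp
  qed
  moreover have "\<pi> J = weighted_unitary r G (\<pi> P) (\<pi> U)"
  proof -
    \<comment> \<open>A representation is only given to respect sums and scalar multiples, so the
      difference is rewritten in those terms before \<pi> is applied.\<close>
    have "id_op K - P = id_op K + (-1) *\<^sub>C P"
      by (simp add: fun_eq_iff scaleC_one)
    then have "J = U \<circ> (of_real r *\<^sub>C P + of_real (1 / r) *\<^sub>C (id_op K + (-1) *\<^sub>C P))"
      unfolding J_eq by simp
    then have "\<pi> J = \<pi> U \<circ> (of_real r *\<^sub>C \<pi> P + of_real (1 / r) *\<^sub>C (id_op G + (-1) *\<^sub>C \<pi> P))"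
      by (simp only: rep ops comp add_bounded scaleC_bounded id_op_bounded ips)
    then show ?thesis
      using op_outside[OF ipsG ipsG rep(1)[OF P_bounded]] op_outside[OF ipsG ipsG rep(1)[OF U_bounded]]
        op_zero[OF ipsG ipsG rep(1)[OF U_bounded]]
      by (auto simp: fun_eq_iff weighted_unitary_def restrict_op_def id_op_def scaleC_one)
  qed
  ultimately show ?thesis using scrPA_iff[OF r] by blast
qed

lemma sum_op_apply: "f \<in> carrier (hsum I H) \<Longrightarrow> i \<in> I \<Longrightarrow> sum_op I H T f i = T i (f i)"
  by (simp add: sum_op_def restrict_op_def)

text \<open>A direct sum of operators needs a uniform bound. For the projections, the unitaries and
  their inverses B = 1 works, so passing to \<open>P\<close>, \<open>U\<close>, \<open>U'\<close>
  makes arbitrary index sets harmless.\<close>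

lemma sum_op_bounded:
  fixes H :: "'i \<Rightarrow> 'a::complex_vector chilbert"
  assumes all_ips: "\<forall>i\<in>I. inner_product_space (H i)"
    and T: "\<And>i. i \<in> I \<Longrightarrow> T i \<in> bounded_ops (H i) (H i)" and B: "0 \<le> B"
    and le: "\<And>i x. i \<in> I \<Longrightarrow> x \<in> carrier (H i) \<Longrightarrow> hnorm (H i) (T i x) \<le> B * hnorm (H i) x"
  shows "sum_op I H T \<in> bounded_ops (hsum I H) (hsum I H)"
proof -
  note ips = bspec[OF all_ips]
  have ipsH: "inner_product_space (hsum I H)" by (rule inner_product_space_hsum[OF all_ips])
  note component = hsum_component[OF all_ips]
  have Tf: "T i (f i) \<in> carrier (H i)" "T i (f i + g i) = T i (f i) + T i (g i)" "T i (c *\<^sub>C f i) = c *\<^sub>C T i (f i)"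
    if "i \<in> I" "f \<in> carrier (hsum I H)" "g \<in> carrier (hsum I H)" for i f g c
    using op_linear(1-3)[OF ips[OF that(1)] ips[OF that(1)] T[OF that(1)]] component[OF _ that(1)] that by auto
  have sq: "(hnorm (H i) (T i (f i)))\<^sup>2 \<le> B\<^sup>2 * (hnorm (H i) (f i))\<^sup>2" if "i \<in> I" "f \<in> carrier (hsum I H)" for i f
    using power_mono[OF le[OF that(1) component[OF that(2,1)]], of 2] Tf[OF that that(2)] ips[OF that(1)]
    by (simp add: power_mult_distrib)
  have mem: "sum_op I H T f \<in> carrier (hsum I H)" if f: "f \<in> carrier (hsum I H)" for f
  proof (rule hsum_memI[OF all_ips])
    show "(\<lambda>i. B\<^sup>2 * (hnorm (H i) (f i))\<^sup>2) summable_on I"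
      by (intro summable_on_cmult_right hsum_summable_hnorm[OF all_ips] f)
  qed (use f Tf(1)[OF _ f f] sq[OF _ f] in \<open>auto simp: sum_op_def restrict_op_def\<close>)
  show ?thesis
  proof (rule bounded_opsI[where B = B])
    fix f assume f: "f \<in> carrier (hsum I H)"
    show "hnorm (hsum I H) (sum_op I H T f) \<le> B * hnorm (hsum I H) f"
    proof (rule hsum_hnorm_le[OF all_ips mem[OF f]])
      show "0 \<le> B * hnorm (hsum I H) f" using B f ipsH by simp
      fix F assume F: "finite F" "F \<subseteq> I"
      have "(\<Sum>i\<in>F. (hnorm (H i) (sum_op I H T f i))\<^sup>2) \<le> (\<Sum>i\<in>F. B\<^sup>2 * (hnorm (H i) (f i))\<^sup>2)"
        using F sq[OF _ f] f by (intro sum_mono) (auto simp: sum_op_apply subset_iff)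
      also have "\<dots> \<le> B\<^sup>2 * (hnorm (hsum I H) f)\<^sup>2"
        unfolding sum_distrib_left[symmetric]
        by (intro mult_left_mono hsum_finite_sum_le[OF all_ips f F]) auto
      finally show "(\<Sum>i\<in>F. (hnorm (H i) (sum_op I H T f i))\<^sup>2) \<le> (B * hnorm (hsum I H) f)\<^sup>2"
        by (simp add: power_mult_distrib)
    qed
  next
    fix f g assume f: "f \<in> carrier (hsum I H)" and g: "g \<in> carrier (hsum I H)"
    then show "sum_op I H T (f + g) = sum_op I H T f + sum_op I H T g"
      using carrier_add[OF ipsH f g] Tf(2)[OF _ f g] by (auto simp: fun_eq_iff sum_op_def restrict_op_def)
  next
    fix c f assume f: "f \<in> carrier (hsum I H)"
    then show "sum_op I H T (c *\<^sub>C f) = c *\<^sub>C sum_op I H T f"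
      using carrier_scale[OF ipsH f] Tf(3)[OF _ f f] by (auto simp: fun_eq_iff sum_op_def restrict_op_def)
  qed (use mem in \<open>auto simp: sum_op_def restrict_op_def\<close>)
qed

lemma scrPA_hsum:
  fixes K :: "'i \<Rightarrow> 'a::complex_vector chilbert"
  assumes r: "0 < r" "r < 1" and J: "\<And>i. i \<in> I \<Longrightarrow> J i \<in> scrPA r (K i)"
  shows "sum_op I K J \<in> scrPA r (hsum I K)"
proof -
  have "\<exists>P U U'. i \<in> I \<longrightarrow> annulus_model r (K i) P U U' \<and> J i = weighted_unitary r (K i) P U" for i
    using scrPA_cases[OF r J] by metis
  then obtain P U U' where model: "\<And>i. i \<in> I \<Longrightarrow> annulus_model r (K i) (P i) (U i) (U' i)"
    and J_eq: "\<And>i. i \<in> I \<Longrightarrow> J i = weighted_unitary r (K i) (P i) (U i)" by metis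
  have hs: "hilbert_space (K i)" if "i \<in> I" for i
    by (rule annulus_model.hilbert[OF model[OF that]])
  then have all_ips: "\<forall>i\<in>I. inner_product_space (K i)" by simp
  let ?K = "hsum I K" and ?P = "sum_op I K P" and ?U = "sum_op I K U" and ?U' = "sum_op I K U'"
  have hsK: "hilbert_space ?K" by (rule hilbert_space_hsum[OF hs])
  note component = hsum_component[OF all_ips] and outside = hsum_component_outside[OF all_ips]
  have P: "?P \<in> bounded_ops ?K ?K"
    by (rule sum_op_bounded[where B = 1, OF all_ips annulus_model.P_bounded[OF model] _ annulus_model.hnorm_P_le[OF model]]) auto
  have U: "?U \<in> bounded_ops ?K ?K"
    by (rule sum_op_bounded[where B = 1, OF all_ips annulus_model.U_bounded[OF model]])
      (auto simp: annulus_model.hnorm_U[OF model])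
  have U': "?U' \<in> bounded_ops ?K ?K"
    by (rule sum_op_bounded[where B = 1, OF all_ips annulus_model.U'_bounded[OF model]])
      (auto simp: annulus_model.hnorm_U'[OF model])
  have ipsK: "inner_product_space ?K" using hsK by simp
  note closed [simp] = op_closed[OF ipsK ipsK P] op_closed[OF ipsK ipsK U] op_closed[OF ipsK ipsK U']
  have eqI: "f = g" if "f \<in> carrier ?K" "g \<in> carrier ?K" "\<And>i. i \<in> I \<Longrightarrow> f i = g i" for f g
    using that outside by (metis ext)
  have "triangular_unitary ?K ?P ?U ?U'"
  proof (rule triangular_unitaryI[OF hsK P U U'])
    fix f assume f: "f \<in> carrier ?K"
    note fi = component[OF f]
    show "?P (?P f) = ?P f" "?U (?U' f) = f" "?U' (?U f) = f" "?P (?U (?P f)) = ?U (?P f)"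
      using f by (auto intro!: eqI simp: sum_op_apply annulus_model.P_P[OF model] annulus_model.U_U'[OF model]
          annulus_model.U'_U[OF model] annulus_model.PUP[OF model] fi)
    fix g assume g: "g \<in> carrier ?K"
    show "cinner ?K (?P f) g = cinner ?K f (?P g)"
      unfolding cinner_hsum using f g component[OF g]
      by (intro infsum_cong) (simp add: sum_op_apply annulus_model.P_sym[OF model] fi)
    show "cinner ?K (?U f) g = cinner ?K f (?U' g)"
      unfolding cinner_hsum using f g component[OF g]
      by (intro infsum_cong) (simp add: sum_op_apply annulus_model.U_adj[OF model] fi)
  qed
  moreover have "sum_op I K J = weighted_unitary r ?K ?P ?U"
  proof (rule ext)
    fix f
    show "sum_op I K J f = weighted_unitary r ?K ?P ?U f"
    proof (cases "f \<in> carrier ?K")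
      case True
      then have mem: "of_real r *\<^sub>C ?P f + of_real (1 / r) *\<^sub>C (f - ?P f) \<in> carrier ?K"
        by (intro carrier_add carrier_scale carrier_diff ipsK closed)
      show ?thesis
      proof
        fix i
        show "sum_op I K J f i = weighted_unitary r ?K ?P ?U f i"
        proof (cases "i \<in> I")
          case i: True
          have "sum_op I K J f i = U i (of_real r *\<^sub>C P i (f i) + of_real (1 / r) *\<^sub>C (f i - P i (f i)))"
            using True i component[OF True i] by (simp add: sum_op_apply J_eq weighted_unitary_def restrict_op_apply)
          also have "\<dots> = ?U (of_real r *\<^sub>C ?P f + of_real (1 / r) *\<^sub>C (f - ?P f)) i"
            unfolding sum_op_apply[OF mem i] using True i by (simp add: sum_op_apply)
          finally show ?thesis using True by (simp add: weighted_unitary_def restrict_op_apply)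
        next
          case False
          then show ?thesis
            using True outside[OF closed(2)[OF mem] False]
            by (simp add: sum_op_def weighted_unitary_def restrict_op_apply)
        qed
      qed
    qed (simp add: sum_op_def weighted_unitary_def restrict_op_outside)
  qed
  ultimately show ?thesis using scrPA_iff[OF r] by blast
qed

lemma restrict_op_bounded:
  assumes K: "inner_product_space K" and T: "T \<in> bounded_ops K K"
    and M: "complex_vector.subspace M" "M \<subseteq> carrier K" and inv: "\<And>x. x \<in> M \<Longrightarrow> T x \<in> M"
  shows "restrict_op M T \<in> bounded_ops (sub_hilbert K M) (sub_hilbert K M)"
proof -
  obtain B where B: "B > 0" "\<And>x. x \<in> carrier K \<Longrightarrow> hnorm K (T x) \<le> B * hnorm K x"
    by (rule op_bound[OF K K T], rule that)
  have MK: "x \<in> carrier K" if "x \<in> M" for x using M(2) that by blast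
  show ?thesis
    by (rule bounded_opsI[where B = B])
      (simp_all add: restrict_op_def inv B(2) MK op_linear(2,3)[OF K K T] complex_vector.subspace_add[OF M(1)]
        complex_vector.subspace_scale[OF M(1)])
qed

text \<open>\<open>P\<close>, \<open>U\<close> and \<open>U'\<close> can be recovered from
  \<open>J\<close> and its adjoint: J* J = r^2 P + (1/r^2) (1 - P) determines P, then U = J ((1/r) P
  + r (1 - P)), and \<open>U'\<close> is the same weight applied after the adjoint of J. A subspace
  reducing J is therefore invariant under all three.\<close>

lemma (in annulus_model) scrPA_restrict:
  assumes M: "closed_subspace K M" and red: "reduces K M J"
  shows "restrict_op M J \<in> scrPA r (sub_hilbert K M)"
proof -
  have sub: "complex_vector.subspace M" and MK: "\<And>x. x \<in> M \<Longrightarrow> x \<in> carrier K"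
    using M by (auto simp: closed_subspace_def)
  note [simp] = MK complex_vector.subspace_add[OF sub] complex_vector.subspace_diff[OF sub]
    complex_vector.subspace_scale[OF sub]
  have JM [simp]: "J x \<in> M" "J_adj x \<in> M" if "x \<in> M" for x
    using red that by (auto simp: reduces_def adj_J)
  let ?k = "1 / r\<^sup>2 - r\<^sup>2"
  have k: "?k \<noteq> 0" using inverse_power2_gt[OF r] by simp
  have PM [simp]: "P x \<in> M" if "x \<in> M" for x
  proof -
    have "of_real (1 / r\<^sup>2) *\<^sub>C x - J_adj (J x) = of_real ?k *\<^sub>C P x"
      using that unfolding of_real_diff J_adj_J[OF MK[OF that]]
      by (simp add: complex_vector.scale_right_diff_distrib complex_vector.scale_left_diff_distrib)
    then have "P x = of_real (1 / ?k) *\<^sub>C (of_real (1 / r\<^sup>2) *\<^sub>C x - J_adj (J x))"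
      using k by (simp add: scaleC_scaleC scaleC_one del: of_real_divide of_real_diff flip: of_real_mult)
    then show ?thesis using that by simp
  qed
  have UM [simp]: "U x \<in> M" if "x \<in> M" for x
  proof -
    \<comment> \<open>The argument of \<open>J\<close> is \<open>J' (U x)\<close> written out; it is
      a combination of x and P x and so lies in M.\<close>
    have "J (of_real (1 / r) *\<^sub>C P x + of_real r *\<^sub>C (x - P x)) = U x"
      using that J_J'[of "U x"] by (simp add: J'_apply)
    moreover have "J (of_real (1 / r) *\<^sub>C P x + of_real r *\<^sub>C (x - P x)) \<in> M"
      by (intro JM) (use that in simp)
    ultimately show ?thesis by simp
  qed
  have U'M [simp]: "U' x \<in> M" if "x \<in> M" for x
  proof -
    have "P (J_adj x) = of_real r *\<^sub>C P (U' x)"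
      "J_adj x - P (J_adj x) = of_real (1 / r) *\<^sub>C (U' x - P (U' x))"
      using that by (simp_all add: J_adj_apply)
    then have "of_real (1 / r) *\<^sub>C P (J_adj x) + of_real r *\<^sub>C (J_adj x - P (J_adj x)) = U' x"
      by (simp only: scaleC_scaleC) (simp add: scaleC_one)
    moreover have "of_real (1 / r) *\<^sub>C P (J_adj x) + of_real r *\<^sub>C (J_adj x - P (J_adj x)) \<in> M"
      using that by simp
    ultimately show ?thesis by simp
  qed
  let ?R = "restrict_op M"
  note bdd = restrict_op_bounded[OF ips _ sub subsetI[OF MK]]
  have "triangular_unitary (sub_hilbert K M) (?R P) (?R U) (?R U')"
    by (rule triangular_unitaryI[OF hilbert_space_sub_hilbert[OF hilbert M] bdd[OF P_bounded] bdd[OF U_bounded] bdd[OF U'_bounded]])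
      (simp_all add: restrict_op_def PUP P_sym U_adj)
  moreover have "?R J = weighted_unitary r (sub_hilbert K M) (?R P) (?R U)"
    by (rule ext) (simp add: weighted_unitary_def restrict_op_def)
  ultimately show ?thesis using scrPA_iff[OF r] by blast
qed

section \<open>Liftings and dilations\<close>

lemma hnorm_adj_op_le:
  assumes H: "hilbert_space H" and K: "hilbert_space K" and T: "T \<in> bounded_ops H K" and B: "0 \<le> B"
    and le: "\<And>x. x \<in> carrier H \<Longrightarrow> hnorm K (T x) \<le> B * hnorm H x" and y: "y \<in> carrier K"
  shows "hnorm H (adj_op H K T y) \<le> B * hnorm K y"
proof -
  have ips: "inner_product_space H" "inner_product_space K" using H K by auto
  have z: "adj_op H K T y \<in> carrier H" by (rule adj_op_closed[OF H K T y])
  show ?thesis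
    by (rule hnorm_adjoint_le[where T = T, OF ips z op_closed[OF ips T z] y B _ le[OF z]])
      (simp add: cinner_adj_op[OF H K T z y])
qed

context
  fixes H :: "'a::complex_vector chilbert" and K :: "'b::complex_vector chilbert" and V
  assumes H: "hilbert_space H" and K: "hilbert_space K" and V: "isometry H K V"
begin

lemma ips_HK: "inner_product_space H" "inner_product_space K"
  using H K by auto

lemmas V_bounded = isometry_bounded[OF ips_HK V]

lemma adj_isometry_left: "x \<in> carrier H \<Longrightarrow> adj_op H K V (V x) = x"
  by (rule eqI_cinner[OF ips_HK(1)])
    (simp_all add: cinner_adj_op[OF H K V_bounded] isometry_cinner[OF ips_HK V] op_closed[OF ips_HK V_bounded]
      adj_op_closed[OF H K V_bounded])

lemma hnorm_adj_isometry_le: "y \<in> carrier K \<Longrightarrow> hnorm H (adj_op H K V y) \<le> hnorm K y"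
  using hnorm_adj_op_le[OF H K V_bounded, of 1 y] by (simp add: isometry_hnorm[OF ips_HK V])

text \<open>V V* is the projection onto the range of V, so the squared distance from y to its
  projection is the drop of squared norm under V*. No drop means that y already lies in the
  range.\<close>

lemma adj_isometry_eq:
  assumes y: "y \<in> carrier K" and norm: "hnorm K y \<le> hnorm H (adj_op H K V y)"
  shows "V (adj_op H K V y) = y"
proof -
  let ?z = "adj_op H K V y"
  have z: "?z \<in> carrier H" by (rule adj_op_closed[OF H K V_bounded y])
  have Vz: "V ?z \<in> carrier K" by (rule op_closed[OF ips_HK V_bounded z])
  have "cinner K (V ?z) y = cinner H ?z ?z" using cinner_adj_op[OF H K V_bounded z y] by simp
  then have "(hnorm K (V ?z - y))\<^sup>2 = (hnorm K y)\<^sup>2 - (hnorm H ?z)\<^sup>2"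
    using hnorm_power2_diff[OF ips_HK(2) Vz y] hnorm_power2[OF ips_HK(1) z] isometry_hnorm[OF ips_HK V z] by simp
  also have "\<dots> \<le> 0" using power_mono[OF norm, of 2] y ips_HK by simp
  finally have "hnorm K (V ?z - y) = 0" by simp
  then show ?thesis using hnorm_eq_zero[OF ips_HK(2) carrier_diff[OF ips_HK(2) Vz y]] by simp
qed

end

lemma dilation_apply:
  assumes dil: "dilation H T K Y V" and x: "x \<in> carrier H" and H: "inner_product_space H" and K: "inner_product_space K"
  shows "T x = adj_op H K V (Y (V x))" "inv_op H T x = adj_op H K V (inv_op K Y (V x))"
proof -
  have V: "V \<in> bounded_ops H K" and powi: "powi_op H T n = adj_op H K V \<circ> powi_op K Y n \<circ> V" for n
    using dil by (auto simp: dilation_def isometry_def)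
  have "V x \<in> carrier K" by (rule op_closed[OF H K V x])
  then show "T x = adj_op H K V (Y (V x))" "inv_op H T x = adj_op H K V (inv_op K Y (V x))"
    using powi[of 1, THEN fun_cong, of x] powi[of "-1", THEN fun_cong, of x] x by (simp_all add: powi_op_def)
qed

lemma dilates_to_PA_imp_PA:
  assumes r: "0 < r" "r < 1" and H: "hilbert_space H" and Y: "Y \<in> PA r K" and dil: "dilation H T K Y V"
  shows "T \<in> PA r H"
proof -
  have K: "hilbert_space K" and Y': "invertible_op K Y"
    and Y_le: "\<And>x. x \<in> carrier K \<Longrightarrow>
      (hnorm K (Y x))\<^sup>2 + (hnorm K (inv_op K Y x))\<^sup>2 \<le> (1 / r\<^sup>2 + r\<^sup>2) * (hnorm K x)\<^sup>2"
    using Y by (auto simp: PA_iff[OF r])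
  have T: "invertible_op H T" and V: "isometry H K V" using dil by (auto simp: dilation_def)
  have ips: "inner_product_space H" "inner_product_space K" using H K by auto
  have "(hnorm H (T x))\<^sup>2 + (hnorm H (inv_op H T x))\<^sup>2 \<le> (1 / r\<^sup>2 + r\<^sup>2) * (hnorm H x)\<^sup>2" if x: "x \<in> carrier H" for x
  proof -
    have Vx: "V x \<in> carrier K" by (rule op_closed[OF ips isometry_bounded[OF ips V] x])
    have YV: "Y (V x) \<in> carrier K" "inv_op K Y (V x) \<in> carrier K"
      using op_closed[OF ips(2,2) invertible_op_bounded[OF ips(2) Y'] Vx]
        op_closed[OF ips(2,2) inv_op_bounded[OF ips(2) Y'] Vx] by auto
    have "(hnorm H (T x))\<^sup>2 \<le> (hnorm K (Y (V x)))\<^sup>2" "(hnorm H (inv_op H T x))\<^sup>2 \<le> (hnorm K (inv_op K Y (V x)))\<^sup>2"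
      unfolding dilation_apply[OF dil x ips]
      using YV hnorm_adj_isometry_le[OF H K V] adj_op_closed[OF H K isometry_bounded[OF ips V]] ips
      by (auto intro!: power_mono)
    then show ?thesis using Y_le[OF Vx] isometry_hnorm[OF ips V x] by simp
  qed
  then show ?thesis using H T by (simp add: PA_iff[OF r])
qed

text \<open>With both operators invertible, V T = J V also gives the intertwining of the inverses,
  hence of all integer powers; composing with V* removes V because V* V = 1.\<close>

lemma lifts_imp_dilates:
  assumes H: "hilbert_space H" and K: "hilbert_space K" and T: "invertible_op H T" and J: "invertible_op K J"
    and lift: "lifts_to H T K J"
  shows "dilates_to H T K J"
proof -
  obtain V where V: "isometry H K V" and VT: "V \<circ> T = J \<circ> V" using lift by (auto simp: lifts_to_def)
  have ips: "inner_product_space H" "inner_product_space K" using H K by auto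
  note [simp] = op_linear[OF ips isometry_bounded[OF ips V]] op_linear[OF ips(1,1) invertible_op_bounded[OF ips(1) T]]
    op_linear[OF ips(1,1) inv_op_bounded[OF ips(1) T]] op_linear[OF ips(2,2) invertible_op_bounded[OF ips(2) J]]
  have lift1: "V (T x) = J (V x)" for x using VT by (metis comp_apply)
  have lift2: "V (inv_op H T x) = inv_op K J (V x)" if "x \<in> carrier H" for x
    using lift1[of "inv_op H T x"] inv_op_right[OF ips(1) T that] inv_op_left[OF ips(2) J, of "V (inv_op H T x)"] that
    by simp
  have iter: "(A ^^ n) x \<in> carrier H \<and> V ((A ^^ n) x) = (B ^^ n) (V x)"
    if "\<And>x. x \<in> carrier H \<Longrightarrow> A x \<in> carrier H \<and> V (A x) = B (V x)" "x \<in> carrier H" for A B n x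
    using that by (induction n) auto
  have "powi_op H T n = adj_op H K V \<circ> powi_op K J n \<circ> V" for n
  proof (rule ext)
    fix x
    \<comment> \<open>Off the carrier, \<open>?x\<close> is 0 and V x = V 0, so both sides only have
      to be compared at a vector of the carrier.\<close>
    let ?x = "id_op H x"
    have x: "?x \<in> carrier H" "V x = V ?x" using ips op_outside[OF ips isometry_bounded[OF ips V]] by (auto simp: id_op_def)
    have "(T ^^ m) ?x = adj_op H K V ((J ^^ m) (V ?x))" for m
      using iter[of T J ?x m] lift1 x adj_isometry_left[OF H K V, of "(T ^^ m) ?x"] by simp
    moreover have "(inv_op H T ^^ m) ?x = adj_op H K V ((inv_op K J ^^ m) (V ?x))" for m
      using iter[of "inv_op H T" "inv_op K J" ?x m] lift2 x adj_isometry_left[OF H K V, of "(inv_op H T ^^ m) ?x"] by simp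
    ultimately show "powi_op H T n x = (adj_op H K V \<circ> powi_op K J n \<circ> V) x"
      using x by (simp add: powi_op_def)
  qed
  then have "dilation H T K J V" using T J V by (simp add: dilation_def)
  then show ?thesis by (auto simp: dilates_to_def)
qed

section \<open>Two-sided norm bounds for operators in \<open>PA\<close>\<close>

lemma PA_inv:
  assumes r: "0 < r" "r < 1" and T: "T \<in> PA r H"
  shows "inv_op H T \<in> PA r H"
  using T inv_op_invertible[of H T] by (auto simp: PA_iff[OF r] add.commute)

text \<open>The recurrence has characteristic roots r^2 and 1/r^2, and the gap r^2 a(n) - a(n+1)
  grows at least by the factor 1/r^2 in each step. If it were positive at n = 0, the sequence would
  drop by a fixed amount in every step and become negative.\<close>

lemma recurrence_lower_bound:
  fixes a :: "nat \<Rightarrow> real"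
  assumes r: "0 < r" "r < 1" and nonneg: "\<And>n. 0 \<le> a n"
    and rec: "\<And>n. a (Suc (Suc n)) + a n \<le> (1 / r\<^sup>2 + r\<^sup>2) * a (Suc n)"
  shows "r\<^sup>2 * a 0 \<le> a 1"
proof (rule ccontr)
  assume contra: "\<not> ?thesis"
  define d where "d = r\<^sup>2 * a 0 - a 1"
  have d: "d > 0" using contra by (simp add: d_def)
  have r2: "0 < r\<^sup>2" "r\<^sup>2 < 1" using r by (auto simp: power_less_one_iff)
  have gap: "d \<le> r\<^sup>2 * a n - a (Suc n)" for n
  proof (induction n)
    case (Suc n)
    have "d \<le> d / r\<^sup>2" using r2 d by (simp add: pos_le_divide_eq mult_left_le)
    also have "\<dots> \<le> (r\<^sup>2 * a n - a (Suc n)) / r\<^sup>2" using Suc r2 by (intro divide_right_mono) auto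
    also have "\<dots> = a n - 1 / r\<^sup>2 * a (Suc n)" using r2 by (simp add: field_simps)
    also have "\<dots> \<le> r\<^sup>2 * a (Suc n) - a (Suc (Suc n))" using rec[of n] by (simp add: algebra_simps)
    finally show ?case .
  qed (simp add: d_def)
  have "a n \<le> a 0 - real n * d" for n
  proof (induction n)
    case (Suc n)
    have "r\<^sup>2 * a n \<le> 1 * a n" using r2 nonneg[of n] by (intro mult_right_mono) auto
    then show ?case using gap[of n] Suc by (simp add: algebra_simps)
  qed simp
  moreover obtain n :: nat where "a 0 / d < real n" using reals_Archimedean2 by blast
  moreover from this have "a 0 < real n * d" using d by (simp add: pos_divide_less_eq)
  ultimately show False using nonneg[of n] by (smt (verit))
qed

text \<open>The squared norms along the forward orbit of x satisfy the recurrence: the inequality of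
  \<open>PA\<close> at the (n+1)st iterate involves the nth iterate through the inverse.\<close>

lemma PA_lower_bound:
  assumes r: "0 < r" "r < 1" and T: "T \<in> PA r H" and x: "x \<in> carrier H"
  shows "r * hnorm H x \<le> hnorm H (T x)"
proof -
  have H: "hilbert_space H" and T': "invertible_op H T"
    and le: "\<And>x. x \<in> carrier H \<Longrightarrow>
      (hnorm H (T x))\<^sup>2 + (hnorm H (inv_op H T x))\<^sup>2 \<le> (1 / r\<^sup>2 + r\<^sup>2) * (hnorm H x)\<^sup>2"
    using T by (auto simp: PA_iff[OF r])
  have ips: "inner_product_space H" using H by simp
  have iter: "(T ^^ n) x \<in> carrier H" for n
    using x op_closed[OF ips ips invertible_op_bounded[OF ips T']] by (induction n) auto
  have "r\<^sup>2 * (hnorm H ((T ^^ 0) x))\<^sup>2 \<le> (hnorm H ((T ^^ 1) x))\<^sup>2"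
  proof (rule recurrence_lower_bound[OF r])
    show "(hnorm H ((T ^^ Suc (Suc n)) x))\<^sup>2 + (hnorm H ((T ^^ n) x))\<^sup>2
        \<le> (1 / r\<^sup>2 + r\<^sup>2) * (hnorm H ((T ^^ Suc n) x))\<^sup>2" for n
      using le[OF iter[of "Suc n"]] inv_op_left[OF ips T' iter[of n]] by simp
  qed simp
  then have "(r * hnorm H x)\<^sup>2 \<le> (hnorm H (T x))\<^sup>2" by (simp add: power_mult_distrib)
  then show ?thesis
    by (rule power2_le_imp_le) (use iter[of 1] ips in simp)
qed

text \<open>The class is symmetric under inversion, so this is the lower bound for the inverse,
  taken at T x.\<close>

lemma PA_upper_bound:
  assumes r: "0 < r" "r < 1" and T: "T \<in> PA r H" and x: "x \<in> carrier H"
  shows "hnorm H (T x) \<le> 1 / r * hnorm H x"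
proof -
  have ips: "inner_product_space H" and T': "invertible_op H T" using T by (auto simp: PA_iff[OF r])
  have "r * hnorm H (T x) \<le> hnorm H (inv_op H T (T x))"
    using PA_lower_bound[OF r PA_inv[OF r T]] op_closed[OF ips ips invertible_op_bounded[OF ips T'] x] by blast
  then show ?thesis using inv_op_left[OF ips T' x] r by (simp add: field_simps)
qed

section \<open>Extremality\<close>

text \<open>Iterating the step gives a(0) <= r^n a(n) <= r^n C for every n.\<close>

lemma geometric_decay_zero:
  fixes a :: "nat \<Rightarrow> real"
  assumes r: "0 < r" "r < 1" and nonneg: "0 \<le> a 0"
    and step: "\<And>n. a n \<le> r * a (Suc n)" and bound: "\<And>n. a n \<le> C"
  shows "a 0 = 0"
proof -
  have "a 0 \<le> r ^ n * a n" for n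
  proof (induction n)
    case (Suc n)
    have "r ^ n * a n \<le> r ^ n * (r * a (Suc n))" using step[of n] r by (intro mult_left_mono) auto
    then show ?case using Suc by (simp add: mult_ac)
  qed simp
  also have "r ^ n * a n \<le> r ^ n * C" for n using bound[of n] r by (intro mult_left_mono) auto
  finally have "a 0 \<le> r ^ n * C" for n .
  moreover have "(\<lambda>n. r ^ n * C) \<longlonglongrightarrow> 0 * C" using r by (intro tendsto_intros LIMSEQ_realpow_zero) auto
  ultimately have "a 0 \<le> 0 * C" by (intro LIMSEQ_le_const) auto
  then show ?thesis using nonneg by simp
qed

text \<open>Invariance of the range under Y is Y V = V J. Invariance under Y* is obtained as Y* V J
  = V J* J, a form in which the right side is diagonal: the factor is r^2 on ran P and 1/r^2 on ker
  P, so the two parts can be treated separately.\<close>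

lemma (in annulus_model) dilation_extremal:
  assumes Y: "Y \<in> PA r G" and dil: "dilation K J G Y V"
  shows "trivial_dilation K G Y V"
proof -
  have G: "hilbert_space G" and Y': "invertible_op G Y" and V: "isometry K G V"
    using Y dil by (auto simp: PA_iff[OF r] dilation_def)
  have ipsG [simp]: "inner_product_space G" using G by simp
  let ?Z = "inv_op G Y"
  note Y_bdd = invertible_op_bounded[OF ipsG Y'] and Z_bdd = inv_op_bounded[OF ipsG Y']
  note V_bdd = isometry_bounded[OF ips ipsG V]
  note [simp] = op_linear[OF ipsG ipsG Y_bdd] op_linear[OF ipsG ipsG Z_bdd] op_linear[OF ips ipsG V_bdd]
    inv_op_left[OF ipsG Y'] inv_op_right[OF ipsG Y'] isometry_hnorm[OF ips ipsG V]
  define Ya where "Ya = adj_op G G Y"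
  define Za where "Za = adj_op G G ?Z"
  have Ya_bdd: "Ya \<in> bounded_ops G G" and Za_bdd: "Za \<in> bounded_ops G G"
    unfolding Ya_def Za_def by (intro adj_op_bounded G Y_bdd Z_bdd)+
  note [simp] = op_linear[OF ipsG ipsG Ya_bdd] op_linear[OF ipsG ipsG Za_bdd]
  have cinner_Ya: "cinner G z (Ya y) = cinner G (Y z) y" and cinner_Za: "cinner G z (Za y) = cinner G (?Z z) y"
    if "z \<in> carrier G" "y \<in> carrier G" for z y
    unfolding Ya_def Za_def by (intro cinner_adj_op G Y_bdd Z_bdd that)+
  have YaZa [simp]: "Ya (Za y) = y" if "y \<in> carrier G" for y
    by (rule eqI_cinner[OF ipsG]) (use that in \<open>simp_all add: cinner_Ya cinner_Za\<close>)
  have ZaYa [simp]: "Za (Ya y) = y" if "y \<in> carrier G" for y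
    by (rule eqI_cinner[OF ipsG]) (use that in \<open>simp_all add: cinner_Ya cinner_Za\<close>)
  have Ya_le: "hnorm G (Ya y) \<le> 1 / r * hnorm G y" if "y \<in> carrier G" for y
    unfolding Ya_def using that r by (intro hnorm_adj_op_le G Y_bdd PA_upper_bound[OF r Y]) auto
  have Za_le: "hnorm G (Za y) \<le> 1 / r * hnorm G y" if "y \<in> carrier G" for y
    unfolding Za_def using that r by (intro hnorm_adj_op_le G Z_bdd PA_upper_bound[OF r PA_inv[OF r Y]]) auto
  note dilJ = dilation_apply[OF dil _ ips ipsG, unfolded inv_J]
  let ?c = "1 / r\<^sup>2 + r\<^sup>2"
  \<comment> \<open>At a balanced vector the norms of J x and J' x exhaust the allowance of the
    inequality, while compression can only decrease norms. Every inequality in the chain collapses: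
    \<open>adj_isometry_eq\<close> yields the first two identities, and the vanishing defect form of
    Y yields the third through \<open>positive_eq_zero\<close>.\<close>
  have tight: "Y (V x) = V (J x)" "?Z (V x) = V (J' x)" "Ya (V (J x)) + Za (V (J' x)) = of_real ?c *\<^sub>C V x"
    if x: "x \<in> carrier K" and balanced: "hnorm K (P x) = hnorm K (P (U' x))" for x
  proof -
    have eq: "(hnorm K (J x))\<^sup>2 + (hnorm K (J' x))\<^sup>2 = ?c * (hnorm K x)\<^sup>2"
      using hnorm_J_J'[OF x] balanced by simp
    have le: "(hnorm K (J x))\<^sup>2 \<le> (hnorm G (Y (V x)))\<^sup>2" "(hnorm K (J' x))\<^sup>2 \<le> (hnorm G (?Z (V x)))\<^sup>2"
      unfolding dilJ[OF x]
      using hnorm_adj_isometry_le[OF hilbert G V] adj_op_closed[OF hilbert G V_bdd] x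
      by (auto intro!: power_mono)
    have defect: "Re (cinner G (annulus_defect r G Y (V x)) (V x)) =
        ?c * (hnorm K x)\<^sup>2 - (hnorm G (Y (V x)))\<^sup>2 - (hnorm G (?Z (V x)))\<^sup>2"
      using Re_cinner_annulus_defect[OF G Y', of "V x" r] x by simp
    have pos: "0 \<le> Re (cinner G (annulus_defect r G Y y) y)" if "y \<in> carrier G" for y
      using Re_cinner_annulus_defect[OF G Y' that, of r] Y that by (auto simp: PA_iff[OF r] algebra_simps)
    have "0 \<le> ?c * (hnorm K x)\<^sup>2 - (hnorm G (Y (V x)))\<^sup>2 - (hnorm G (?Z (V x)))\<^sup>2"
      using pos[of "V x"] x unfolding defect by simp
    then have eqs: "(hnorm K (J x))\<^sup>2 = (hnorm G (Y (V x)))\<^sup>2" "(hnorm K (J' x))\<^sup>2 = (hnorm G (?Z (V x)))\<^sup>2"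
      "Re (cinner G (annulus_defect r G Y (V x)) (V x)) = 0"
      unfolding defect using eq le by linarith+
    have norms: "hnorm G (Y (V x)) = hnorm K (J x)" "hnorm G (?Z (V x)) = hnorm K (J' x)"
      using eqs(1,2) x by (simp_all add: power2_eq_iff_nonneg)
    show YV: "Y (V x) = V (J x)" and ZV: "?Z (V x) = V (J' x)"
      using adj_isometry_eq[OF hilbert G V, of "Y (V x)"] adj_isometry_eq[OF hilbert G V, of "?Z (V x)"]
        norms dilJ[OF x] x by simp_all
    have zero: "annulus_defect r G Y (V x) = 0"
      using positive_eq_zero[OF ipsG annulus_defect_bounded[OF G Y'] annulus_defect_symmetric[OF G Y'] pos _ eqs(3)] x
      by simp
    have "Ya (Y (V x)) + Za (?Z (V x)) = of_real ?c *\<^sub>C V x"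
    proof -
      have "annulus_defect r G Y (V x) = of_real ?c *\<^sub>C V x - Ya (Y (V x)) - Za (?Z (V x))"
        using x by (simp add: annulus_defect_def Ya_def Za_def)
      then show ?thesis using zero by (simp add: algebra_simps)
    qed
    then show "Ya (V (J x)) + Za (V (J' x)) = of_real ?c *\<^sub>C V x" by (simp only: YV ZV)
  qed
  \<comment> \<open>A vector of ran P need not be balanced, but its image under J is:
    \<open>U' (J x)\<close> is r x and lies in ran P again. For this half \<open>tight\<close> is
    therefore used at J x.\<close>
  have J_plus: "J x = of_real r *\<^sub>C U x" "P (J x) = J x" "hnorm K (J x) = r * hnorm K x"
    "hnorm K (P (J x)) = hnorm K (P (U' (J x)))"
    if "x \<in> carrier K" "P x = x" for x
  proof -
    show *: "J x = of_real r *\<^sub>C U x" using that by (simp add: J_apply)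
    show "P (J x) = J x" "hnorm K (J x) = r * hnorm K x" "hnorm K (P (J x)) = hnorm K (P (U' (J x)))"
      using PUP[OF that(1)] that r by (simp_all add: * hnorm_scale)
  qed
  \<comment> \<open>\<open>U'\<close> preserves ker P, so J' acts there as r times an isometry and
    its orbits stay in ker P.\<close>
  have J'_minus: "J' x = of_real r *\<^sub>C U' x" "P (J' x) = 0" "hnorm K (J' x) = r * hnorm K x"
    if "x \<in> carrier K" "P x = 0" for x
  proof -
    show *: "J' x = of_real r *\<^sub>C U' x" using that by (simp add: J'_apply P_U'_Km)
    show "P (J' x) = 0" "hnorm K (J' x) = r * hnorm K x"
      using that r by (simp_all add: * hnorm_scale P_U'_Km)
  qed
  have minus: "Y (V x) = V (J x)" "Ya (V (J x)) + Za (V (J' x)) = of_real ?c *\<^sub>C V x"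
    if "x \<in> carrier K" "P x = 0" for x
    using tight[OF that(1)] P_U'_Km[OF that] that by simp_all
  \<comment> \<open>The identity for the inverse of Y at the balanced vector J x reads back as the
    identity for Y at x.\<close>
  have plus: "Y (V x) = V (J x)" if "x \<in> carrier K" "P x = x" for x
  proof -
    have "?Z (V (J x)) = V (J' (J x))" using J_plus(4)[OF that] that by (intro tight) auto
    then have "Y (?Z (V (J x))) = Y (V x)" using that by simp
    then show ?thesis using that by simp
  qed
  have YV: "Y (V x) = V (J x)" if x: "x \<in> carrier K" for x
  proof -
    have "Y (V (P x) + V (x - P x)) = V (J (P x)) + V (J (x - P x))"
      using x plus[of "P x"] minus(1)[of "x - P x"] by simp
    then show ?thesis using x by simp
  qed
  obtain B where B: "B > 0" "\<And>x. x \<in> carrier K \<Longrightarrow> hnorm K (J x) \<le> B * hnorm K x"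
    by (rule op_bound[OF ips ips J_bounded], rule that)
  \<comment> \<open>The constant c is the value of J* J on the half at hand. The deviation of Y* V J
    from c V is bounded along a bounded orbit, so a step contracting by r towards n = 0 makes it
    vanish at the start.\<close>
  have decay: "Ya (V (J (y 0))) = of_real c *\<^sub>C V (y 0)"
    if y: "\<And>n. y n \<in> carrier K \<and> hnorm K (y n) \<le> hnorm K (y 0)"
      and step: "\<And>n. hnorm G (Ya (V (J (y n))) - of_real c *\<^sub>C V (y n))
        \<le> r * hnorm G (Ya (V (J (y (Suc n)))) - of_real c *\<^sub>C V (y (Suc n)))" for y c
  proof -
    let ?q = "\<lambda>n. Ya (V (J (y n))) - of_real c *\<^sub>C V (y n)"
    have q: "?q n \<in> carrier G" for n using y[of n] by simp
    have "hnorm G (?q 0) = 0"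
    proof (rule geometric_decay_zero[where a = "\<lambda>n. hnorm G (?q n)"
          and C = "1 / r * (B * hnorm K (y 0)) + \<bar>c\<bar> * hnorm K (y 0)", OF r hnorm_nonneg[OF ipsG q] step])
      fix n
      have yn: "y n \<in> carrier K" "hnorm K (y n) \<le> hnorm K (y 0)" using y[of n] by auto
      have "hnorm G (?q n) \<le> hnorm G (Ya (V (J (y n)))) + hnorm G (of_real c *\<^sub>C V (y n))"
        using yn by (intro hnorm_triangle_diff) auto
      also have "hnorm G (Ya (V (J (y n)))) \<le> 1 / r * (B * hnorm K (y 0))"
        using order_trans[OF Ya_le[of "V (J (y n))"] mult_left_mono[of _ "B * hnorm K (y 0)" "1 / r"]]
          order_trans[OF B(2)[OF yn(1)] mult_left_mono[OF yn(2)]] B(1) yn r by simp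
      also have "hnorm G (of_real c *\<^sub>C V (y n)) \<le> \<bar>c\<bar> * hnorm K (y 0)"
        using yn mult_left_mono[OF yn(2), of "\<bar>c\<bar>"] by (simp add: hnorm_scale)
      finally show "hnorm G (?q n) \<le> 1 / r * (B * hnorm K (y 0)) + \<bar>c\<bar> * hnorm K (y 0)" by simp
    qed
    then have "?q 0 = 0" using hnorm_eq_zero[OF ipsG q] by blast
    then show ?thesis by simp
  qed
  have r_le: "r * hnorm K y \<le> hnorm K y" if "y \<in> carrier K" for y
    using mult_right_mono[of r 1 "hnorm K y"] r that by simp
  \<comment> \<open>On ker P the orbit runs under J', where every vector is balanced.\<close>
  have Ya_minus: "Ya (V (J x)) = of_real (1 / r\<^sup>2) *\<^sub>C V x" if x: "x \<in> carrier K" "P x = 0" for x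
  proof -
    define y where "y n = (J' ^^ n) x" for n
    have y: "y n \<in> carrier K \<and> P (y n) = 0 \<and> hnorm K (y n) \<le> hnorm K x" for n
      by (induction n) (use x J'_minus(2,3) order_trans[OF r_le] in \<open>auto simp: y_def\<close>)
    have ySuc: "y (Suc n) = J' (y n)" for n by (simp add: y_def)
    define q where "q n = Ya (V (J (y n))) - of_real (1 / r\<^sup>2) *\<^sub>C V (y n)" for n
    have q: "q n \<in> carrier G" for n using y[of n] by (simp add: q_def)
    have "hnorm G (q n) \<le> r * hnorm G (q (Suc n))" for n
    proof -
      have yn: "y n \<in> carrier K" "P (y n) = 0" using y[of n] by auto
      have "Ya (V (J (y n))) + Za (V (J' (y n))) = of_real ?c *\<^sub>C V (y n)" by (rule minus(2)[OF yn])
      then have "q n = of_real (r\<^sup>2) *\<^sub>C V (y n) - Za (V (J' (y n)))"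
        unfolding q_def of_real_add complex_vector.scale_left_distrib by (simp add: algebra_simps)
      \<comment> \<open>Applying Y* cancels its inverse and, as V (y n) = V (J (y (n+1))), turns the
        deviation at n into r^2 times the deviation at n + 1. The norm bound 1/r of the inverse of
        Y* leaves the factor r.\<close>
      then have "Ya (q n) = of_real (r\<^sup>2) *\<^sub>C Ya (V (y n)) - V (J' (y n))"
        using yn by simp
      also have "\<dots> = of_real (r\<^sup>2) *\<^sub>C q (Suc n)"
        using yn by (simp add: q_def ySuc complex_vector.scale_right_diff_distrib scaleC_scaleC scaleC_one)
      finally have Yaq: "Ya (q n) = of_real (r\<^sup>2) *\<^sub>C q (Suc n)" .
      have "hnorm G (q n) = hnorm G (Za (Ya (q n)))" using q by simp
      also have "\<dots> \<le> 1 / r * hnorm G (Ya (q n))" using q by (intro Za_le) simp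
      also have "\<dots> = r * hnorm G (q (Suc n))"
        unfolding Yaq using q r by (simp add: hnorm_scale power2_eq_square norm_mult)
      finally show ?thesis .
    qed
    then show ?thesis using decay[of y "1 / r\<^sup>2"] y unfolding q_def by (simp add: y_def)
  qed
  \<comment> \<open>On ran P the orbit runs under J, and the recursion goes from index n + 1 down to
    n.\<close>
  have Ya_plus: "Ya (V (J x)) = of_real (r\<^sup>2) *\<^sub>C V x" if x: "x \<in> carrier K" "P x = x" for x
  proof -
    define y where "y n = (J ^^ n) x" for n
    have y: "y n \<in> carrier K \<and> P (y n) = y n \<and> hnorm K (y n) \<le> hnorm K x" for n
      by (induction n) (use x J_plus(2,3) order_trans[OF r_le] in \<open>auto simp: y_def\<close>)
    have ySuc: "y (Suc n) = J (y n)" for n by (simp add: y_def)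
    define q where "q n = Ya (V (J (y n))) - of_real (r\<^sup>2) *\<^sub>C V (y n)" for n
    have q: "q n \<in> carrier G" for n using y[of n] by (simp add: q_def)
    have "hnorm G (q n) \<le> r * hnorm G (q (Suc n))" for n
    proof -
      have yn: "y n \<in> carrier K" "P (y n) = y n" using y[of n] by auto
      \<comment> \<open>The index is shifted because only y (n+1) = J (y n) is known to be balanced.
        Applying Y* to the deviation at n + 1 gives 1/r^2 times the one at n, and the bound 1/r for
        Y* again leaves the factor r.\<close>
      have "Ya (V (J (y (Suc n)))) + Za (V (J' (y (Suc n)))) = of_real ?c *\<^sub>C V (y (Suc n))"
        using y[of "Suc n"] J_plus(4)[OF yn] by (intro tight) (auto simp: ySuc)
      then have "q (Suc n) = of_real (1 / r\<^sup>2) *\<^sub>C V (y (Suc n)) - Za (V (y n))"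
        unfolding q_def of_real_add complex_vector.scale_left_distrib using yn by (simp add: ySuc algebra_simps)
      then have "Ya (q (Suc n)) = of_real (1 / r\<^sup>2) *\<^sub>C Ya (V (y (Suc n))) - V (y n)"
        using yn y[of "Suc n"] by simp
      also have "\<dots> = of_real (1 / r\<^sup>2) *\<^sub>C q n"
        using yn by (simp add: q_def ySuc complex_vector.scale_right_diff_distrib scaleC_scaleC scaleC_one)
      finally have Yaq: "Ya (q (Suc n)) = of_real (1 / r\<^sup>2) *\<^sub>C q n" .
      have "1 / r\<^sup>2 * hnorm G (q n) = hnorm G (Ya (q (Suc n)))"
        unfolding Yaq using q r by (simp add: hnorm_scale norm_divide norm_power)
      also have "\<dots> \<le> 1 / r * hnorm G (q (Suc n))" using q by (intro Ya_le)
      finally show ?thesis using r by (simp add: field_simps power2_eq_square)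
    qed
    then show ?thesis using decay[of y "r\<^sup>2"] y unfolding q_def by (simp add: y_def)
  qed
  have "Ya (V x) \<in> V ` carrier K" if x: "x \<in> carrier K" for x
  proof -
    \<comment> \<open>Since x = J z, splitting z along P reduces Y* V x to the two diagonal
      cases.\<close>
    let ?z = "J' x"
    have z: "?z \<in> carrier K" using x by simp
    have p: "P ?z \<in> carrier K" "P (P ?z) = P ?z" and w: "?z - P ?z \<in> carrier K" "P (?z - P ?z) = 0"
      using z by simp_all
    have "Ya (V (J (P ?z))) + Ya (V (J (?z - P ?z))) =
        V (of_real (r\<^sup>2) *\<^sub>C P ?z + of_real (1 / r\<^sup>2) *\<^sub>C (?z - P ?z))"
      unfolding Ya_plus[OF p] Ya_minus[OF w] using p w by simp
    moreover have "Ya (V (J (P ?z))) + Ya (V (J (?z - P ?z))) = Ya (V x)"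
      using x z by simp
    ultimately have "Ya (V x) = V (of_real (r\<^sup>2) *\<^sub>C P ?z + of_real (1 / r\<^sup>2) *\<^sub>C (?z - P ?z))"
      by (simp only:)
    then show ?thesis by (rule image_eqI) (use z in simp)
  qed
  then show ?thesis
    unfolding trivial_dilation_def reduces_def using YV by (auto simp: Ya_def)
qed

section \<open>Factorization of positive operators\<close>

abbreviation l2 :: "'a::complex_vector chilbert \<Rightarrow> (nat \<Rightarrow> 'a) chilbert" where
  "l2 H \<equiv> hsum UNIV (\<lambda>_. H)"

lemma hilbert_space_l2: "hilbert_space H \<Longrightarrow> hilbert_space (l2 H)"
  by (rule hilbert_space_hsum)

definition positive_op :: "'a::complex_vector chilbert \<Rightarrow> ('a \<Rightarrow> 'a) \<Rightarrow> bool" where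
  "positive_op H A \<longleftrightarrow> A \<in> bounded_ops H H \<and>
     (\<forall>x\<in>carrier H. \<forall>y\<in>carrier H. cinner H (A x) y = cinner H x (A y)) \<and>
     (\<forall>x\<in>carrier H. 0 \<le> Re (cinner H (A x) x))"

text \<open>A positive contraction is factored without its square root: with \<open>A\<^sub>0 = A\<close> and
  \<open>A\<^sub>n\<^sub>+\<^sub>1 = A\<^sub>n - A\<^sub>n\<^sup>2\<close> one has \<open>A = A\<^sub>0\<^sup>2 + \<dots> + A\<^sub>n\<^sup>2 + A\<^sub>n\<^sub>+\<^sub>1\<close>, so \<open>\<parallel>A\<^sub>n x\<parallel>\<^sup>2\<close> is summable and
  the remainder tends to \<open>0\<close>. Hence \<open>x \<mapsto> (A\<^sub>n x)\<^sub>n\<close> is a factor.\<close>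

lemma positive_contraction_factor:
  assumes ips: "inner_product_space H" and A: "positive_op H A"
    and contraction: "\<And>x. x \<in> carrier H \<Longrightarrow> Re (cinner H (A x) x) \<le> (hnorm H x)\<^sup>2"
  shows "\<exists>\<alpha>\<in>bounded_ops H (l2 H). \<forall>x\<in>carrier H. (hnorm (l2 H) (\<alpha> x))\<^sup>2 = Re (cinner H (A x) x)"
proof -
  define B where "B n = ((\<lambda>S. S - (S \<circ> S)) ^^ n) A" for n
  have B0: "B 0 = A" and BSuc: "B (Suc n) = B n - (B n \<circ> B n)" for n by (simp_all add: B_def)
  \<comment> \<open>Each step preserves being a positive contraction:
    \<open>positive_hnorm_le\<close> with C = 1 bounds the squared norm of B n x by the form of B n,
    so the form of B n minus its square stays between 0 and that of B n.\<close>
  have inv: "positive_op H (B n) \<and> (\<forall>x\<in>carrier H. Re (cinner H (B n x) x) \<le> (hnorm H x)\<^sup>2)" for n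
  proof (induction n)
    case 0
    then show ?case using A contraction by (simp add: B0)
  next
    case (Suc n)
    then have bdd: "B n \<in> bounded_ops H H"
      and sym: "\<And>x y. x \<in> carrier H \<Longrightarrow> y \<in> carrier H \<Longrightarrow> cinner H (B n x) y = cinner H x (B n y)"
      and pos: "\<And>x. x \<in> carrier H \<Longrightarrow> 0 \<le> Re (cinner H (B n x) x)"
      and le: "\<And>x. x \<in> carrier H \<Longrightarrow> Re (cinner H (B n x) x) \<le> 1 * (hnorm H x)\<^sup>2"
      by (auto simp: positive_op_def)
    note [simp] = ips op_linear[OF ips ips bdd]
    have "Re (cinner H (B (Suc n) x) x) = Re (cinner H (B n x) x) - (hnorm H (B n x))\<^sup>2" if "x \<in> carrier H" for x
      using that by (simp add: BSuc cinner_linear sym hnorm_power2)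
    moreover have "(hnorm H (B n x))\<^sup>2 \<le> 1 * Re (cinner H (B n x) x)" if "x \<in> carrier H" for x
      by (rule positive_hnorm_le[OF ips bdd zero_less_one sym pos le that])
    moreover have "B (Suc n) \<in> bounded_ops H H"
      unfolding BSuc by (intro diff_bounded comp_bounded[OF ips ips ips] bdd ips)
    moreover have "cinner H (B (Suc n) x) y = cinner H x (B (Suc n) y)" if "x \<in> carrier H" "y \<in> carrier H" for x y
      using that by (simp add: BSuc cinner_linear sym)
    ultimately show ?case using le by (auto simp: positive_op_def) (smt (verit) zero_le_power2)
  qed
  have bdd: "B n \<in> bounded_ops H H" for n using inv[of n] by (simp add: positive_op_def)
  note [simp] = ips op_linear[OF ips ips bdd]
  have sums: "(\<lambda>n. (hnorm H (B n x))\<^sup>2) sums Re (cinner H (A x) x)" if x: "x \<in> carrier H" for x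
  proof -
    have partial: "(\<Sum>k<n. (hnorm H (B k x))\<^sup>2) = Re (cinner H (A x) x) - Re (cinner H (B n x) x)" for n
    proof (induction n)
      case (Suc n)
      have "Re (cinner H (B (Suc n) x) x) = Re (cinner H (B n x) x) - (hnorm H (B n x))\<^sup>2"
        using x inv[of n] by (simp add: BSuc cinner_linear positive_op_def hnorm_power2)
      then show ?case using Suc by simp
    qed (simp add: B0)
    have "summable (\<lambda>n. (hnorm H (B n x))\<^sup>2)"
    proof (rule summableI_nonneg_bounded)
      show "(\<Sum>k<n. (hnorm H (B k x))\<^sup>2) \<le> Re (cinner H (A x) x)" for n
      proof -
        have "0 \<le> Re (cinner H (B n x) x)" using inv[of n] x unfolding positive_op_def by blast
        then show ?thesis unfolding partial by simp
      qed
    qed simp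
    then have "(\<lambda>n. sqrt ((hnorm H (B n x))\<^sup>2)) \<longlonglongrightarrow> sqrt 0"
      by (intro tendsto_real_sqrt summable_LIMSEQ_zero)
    then have lim: "(\<lambda>n. hnorm H (B n x)) \<longlonglongrightarrow> 0" using x by simp
    have "(\<lambda>n. Re (cinner H (B n x) x)) \<longlonglongrightarrow> 0"
    proof (rule tendsto_sandwich[OF _ _ tendsto_const])
      show "(\<lambda>n. hnorm H (B n x) * hnorm H x) \<longlonglongrightarrow> 0" by (rule tendsto_mult_left_zero[OF lim])
      show "\<forall>\<^sub>F n in sequentially. 0 \<le> Re (cinner H (B n x) x)"
        using inv x unfolding positive_op_def by (intro always_eventually allI) blast
      show "\<forall>\<^sub>F n in sequentially. Re (cinner H (B n x) x) \<le> hnorm H (B n x) * hnorm H x"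
        using x by (intro always_eventually allI Re_Cauchy_Schwarz) auto
    qed
    then have "(\<lambda>n. Re (cinner H (A x) x) - Re (cinner H (B n x) x)) \<longlonglongrightarrow> Re (cinner H (A x) x) - 0"
      by (intro tendsto_intros)
    then show ?thesis by (simp add: sums_def partial)
  qed
  have has_sum: "((\<lambda>n. (hnorm H (B n x))\<^sup>2) has_sum Re (cinner H (A x) x)) UNIV" if "x \<in> carrier H" for x
    by (rule sums_nonneg_imp_has_sum[OF sums[OF that]]) simp
  define \<alpha> where "\<alpha> = restrict_op (carrier H) (\<lambda>x n. B n x)"
  have ips_all: "\<forall>i\<in>(UNIV::nat set). inner_product_space H" by simp
  have mem: "\<alpha> x \<in> carrier (l2 H)" if "x \<in> carrier H" for x
    using has_sum[OF that] that by (auto simp: mem_carrier_hsum \<alpha>_def restrict_op_apply summable_on_def)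
  have norm: "(hnorm (l2 H) (\<alpha> x))\<^sup>2 = Re (cinner H (A x) x)" if "x \<in> carrier H" for x
    using has_sum[OF that] that
    by (simp add: hnorm_hsum[OF ips_all mem[OF that]]) (simp add: \<alpha>_def restrict_op_apply infsumI)
  have "\<alpha> \<in> bounded_ops H (l2 H)"
  proof (rule bounded_opsI[where B = 1])
    show "hnorm (l2 H) (\<alpha> x) \<le> 1 * hnorm H x" if "x \<in> carrier H" for x
      by (rule power2_le_imp_le) (use norm[OF that] contraction[OF that] that in auto)
  qed (use mem in \<open>auto simp: \<alpha>_def restrict_op_def fun_eq_iff\<close>)
  then show ?thesis using norm by blast
qed

text \<open>Dividing by an operator bound C reduces to contractions; the factor is then scaled back
  by the square root of C.\<close>

lemma positive_factor:
  assumes H: "hilbert_space H" and A: "positive_op H A"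
  shows "\<exists>\<alpha>\<in>bounded_ops H (l2 H). \<forall>x\<in>carrier H. (hnorm (l2 H) (\<alpha> x))\<^sup>2 = Re (cinner H (A x) x)"
proof -
  have ips: "inner_product_space H" and ips2: "inner_product_space (l2 H)" using H hilbert_space_l2[OF H] by auto
  have bdd: "A \<in> bounded_ops H H" using A by (simp add: positive_op_def)
  note [simp] = ips op_linear[OF ips ips bdd]
  obtain C where C: "C > 0" "\<And>x. x \<in> carrier H \<Longrightarrow> hnorm H (A x) \<le> C * hnorm H x"
    by (rule op_bound[OF ips ips bdd], rule that)
  let ?A = "of_real (1 / C) *\<^sub>C A"
  have form: "Re (cinner H (?A x) x) = Re (cinner H (A x) x) / C" if "x \<in> carrier H" for x
    using that by (simp add: cinner_linear)
  have "positive_op H ?A"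
    using A C scaleC_bounded[OF ips ips bdd, of "of_real (1 / C)"]
    unfolding positive_op_def by (auto simp: cinner_linear)
  moreover have "Re (cinner H (?A x) x) \<le> (hnorm H x)\<^sup>2" if x: "x \<in> carrier H" for x
  proof -
    have "Re (cinner H (A x) x) \<le> hnorm H (A x) * hnorm H x" using x by (intro Re_Cauchy_Schwarz) auto
    also have "\<dots> \<le> C * hnorm H x * hnorm H x" using C(2)[OF x] x by (intro mult_right_mono) auto
    finally show ?thesis using C(1) unfolding form[OF x] by (simp add: field_simps power2_eq_square)
  qed
  ultimately obtain \<alpha> where \<alpha>: "\<alpha> \<in> bounded_ops H (l2 H)"
    "\<And>x. x \<in> carrier H \<Longrightarrow> (hnorm (l2 H) (\<alpha> x))\<^sup>2 = Re (cinner H (?A x) x)"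
    using positive_contraction_factor[OF ips] by blast
  let ?\<alpha> = "of_real (sqrt C) *\<^sub>C \<alpha>"
  have "(hnorm (l2 H) (?\<alpha> x))\<^sup>2 = Re (cinner H (A x) x)" if x: "x \<in> carrier H" for x
    using \<alpha>(2)[OF x] C(1) form[OF x] hnorm_scale[OF ips2 op_closed[OF ips ips2 \<alpha>(1) x]]
    by (simp add: power_mult_distrib)
  then show ?thesis using scaleC_bounded[OF ips ips2 \<alpha>(1)] by blast
qed

section \<open>Extension of isometric correspondences to unitaries\<close>

text \<open>A two-sided inverse that is also a formal adjoint forces linearity and norm
  preservation. Unitaries can thus be introduced by explicit formulas, with only inverse and adjoint
  to be checked.\<close>

lemma unitary_of_adjoint_inverse:
  assumes H: "inner_product_space H" and K: "inner_product_space K"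
    and U: "\<And>x. x \<in> carrier H \<Longrightarrow> U x \<in> carrier K" "\<And>x. x \<notin> carrier H \<Longrightarrow> U x = 0"
    and U': "\<And>y. y \<in> carrier K \<Longrightarrow> U' y \<in> carrier H"
    and U'U: "\<And>x. x \<in> carrier H \<Longrightarrow> U' (U x) = x" and UU': "\<And>y. y \<in> carrier K \<Longrightarrow> U (U' y) = y"
    and adj: "\<And>x y. x \<in> carrier H \<Longrightarrow> y \<in> carrier K \<Longrightarrow> cinner K (U x) y = cinner H x (U' y)"
  shows "unitary_op H K U"
proof -
  note [simp] = H K U U'
  have eqI: "x = y" if "x \<in> carrier K" "y \<in> carrier K" "\<And>z. z \<in> carrier K \<Longrightarrow> cinner K x z = cinner K y z" for x y
    using eqI_cinner[OF K that(1,2)] that cinner_commute[OF K] by metis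
  have "isometry H K U"
  proof (rule isometryI)
    show "U (x + y) = U x + U y" if "x \<in> carrier H" "y \<in> carrier H" for x y
      by (rule eqI) (use that in \<open>simp_all add: cinner_linear adj\<close>)
    show "U (c *\<^sub>C x) = c *\<^sub>C U x" if "x \<in> carrier H" for c x
      by (rule eqI) (use that in \<open>simp_all add: cinner_linear adj\<close>)
    show "hnorm K (U x) = hnorm H x" if "x \<in> carrier H" for x
      using adj[OF that U(1)[OF that]] that by (simp add: hnorm_def U'U)
  qed simp_all
  moreover have "U ` carrier H = carrier K" using UU' U U' by (metis image_iff subsetI subset_antisym image_subsetI)
  ultimately show ?thesis by (simp add: unitary_op_def)
qed

section \<open>The partial isometry of an isometric correspondence\<close>

definition in_closure_range ::
    "'a::complex_vector chilbert \<Rightarrow> 'b::complex_vector chilbert \<Rightarrow> ('a \<Rightarrow> 'b) \<Rightarrow> 'b \<Rightarrow> bool" where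
  "in_closure_range H M b y \<longleftrightarrow> y \<in> carrier M \<and>
     (\<exists>X. (\<forall>n. X n \<in> carrier H) \<and> (\<lambda>n::nat. hnorm M (b (X n) - y)) \<longlonglongrightarrow> 0)"

lemma cinner_in_closure_range_eq:
  assumes H: "inner_product_space H" and M: "inner_product_space M" and b: "b \<in> bounded_ops H M"
    and y: "in_closure_range H M b y" and w: "w \<in> carrier M" and w': "w' \<in> carrier M"
    and eq: "\<And>h. h \<in> carrier H \<Longrightarrow> cinner M (b h) w = cinner M (b h) w'"
  shows "cinner M w y = cinner M w' y"
proof -
  obtain X where y': "y \<in> carrier M" and X: "\<And>n. X n \<in> carrier H" "(\<lambda>n::nat. hnorm M (b (X n) - y)) \<longlonglongrightarrow> 0"
    using y by (auto simp: in_closure_range_def)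
  have bX: "b (X n) \<in> carrier M" for n by (rule op_closed[OF H M b X(1)])
  have "cinner M w (b (X n)) = cinner M w' (b (X n))" for n
    using cinner_commute[OF M bX w] cinner_commute[OF M bX w'] eq[OF X(1)] by simp
  then show ?thesis
    using LIMSEQ_unique[OF tendsto_cinner[OF M bX y' w X(2)]] tendsto_cinner[OF M bX y' w' X(2)] by simp
qed

text \<open>y - z lies in the closure of the range of b and is orthogonal to that range, hence to
  itself.\<close>

lemma in_closure_range_eqI:
  assumes H: "inner_product_space H" and M: "inner_product_space M" and b: "b \<in> bounded_ops H M"
    and y: "in_closure_range H M b y" and z: "in_closure_range H M b z"
    and eq: "\<And>h. h \<in> carrier H \<Longrightarrow> cinner M (b h) y = cinner M (b h) z"
  shows "y = z"
proof -
  have yz: "y \<in> carrier M" "z \<in> carrier M" using y z by (auto simp: in_closure_range_def)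
  have "cinner M y y = cinner M z y" "cinner M y z = cinner M z z"
    using cinner_in_closure_range_eq[OF H M b y yz eq] cinner_in_closure_range_eq[OF H M b z yz eq] by auto
  then have "cinner M (y - z) (y - z) = 0" using yz M by (simp add: cinner_linear)
  then have "hnorm M (y - z) = 0" by (simp add: hnorm_def)
  then show ?thesis using yz M by simp
qed

text \<open>The correspondence between a h and b h is given by two operators on a common source, so
  that the isometry between the two ranges never needs a choice of preimages.\<close>

locale isometric_pair =
  fixes H :: "'h::complex_vector chilbert" and M :: "'m::complex_vector chilbert"
    and N :: "'n::complex_vector chilbert" and a b
  assumes H: "inner_product_space H" and M: "hilbert_space M" and N: "hilbert_space N"
    and a: "a \<in> bounded_ops H M" and b: "b \<in> bounded_ops H N"
    and norm_eq: "\<And>h. h \<in> carrier H \<Longrightarrow> hnorm M (a h) = hnorm N (b h)"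
begin

lemma ips [simp]: "inner_product_space H" "inner_product_space M" "inner_product_space N"
  using H M N by auto

lemmas ab_linear [simp] = op_linear[OF ips(1,2) a] op_linear[OF ips(1,3) b]

lemma cinner_eq: "h \<in> carrier H \<Longrightarrow> k \<in> carrier H \<Longrightarrow> cinner M (a h) (a k) = cinner N (b h) (b k)"
  using norm_eq by (intro cinner_preserved_if_hnorm_preserved[of M N "carrier H" H a b]) auto

lemma transfer_exists:
  assumes m: "m \<in> carrier M"
  shows "\<exists>y. in_closure_range H N b y \<and> (\<forall>h\<in>carrier H. cinner M (a h) m = cinner N (b h) y)"
proof (rule Riesz_closure_range[OF N, of "carrier H" b "\<lambda>h. cinner M (a h) m" "hnorm M m"])
  show "cmod (cinner M (a h) m) \<le> hnorm M m * hnorm N (b h)" if h: "h \<in> carrier H" for h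
    using Cauchy_Schwarz[OF ips(2), of "a h" m] norm_eq[OF h] h m by (simp add: mult.commute)
qed (use m in \<open>auto simp: cinner_linear in_closure_range_def\<close>)

text \<open>The partial isometry from M to N that sends a h to b h and kills the orthogonal
  complement of the range of a. Its value at m is the representing vector of the functional h -> (a
  h, m) on the range of b; requiring it to lie in the closure of that range makes it unique.\<close>

definition transfer where
  "transfer = restrict_op (carrier M)
     (\<lambda>m. SOME y. in_closure_range H N b y \<and> (\<forall>h\<in>carrier H. cinner M (a h) m = cinner N (b h) y))"

lemma transfer:
  assumes m: "m \<in> carrier M"
  shows "in_closure_range H N b (transfer m)"
    and "h \<in> carrier H \<Longrightarrow> cinner N (b h) (transfer m) = cinner M (a h) m"
    and transfer_closed [simp]: "transfer m \<in> carrier N"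
  using someI_ex[OF transfer_exists[OF m]] m by (auto simp: transfer_def restrict_op_apply in_closure_range_def)

lemma transfer_a [simp]: "h \<in> carrier H \<Longrightarrow> transfer (a h) = b h"
proof (rule in_closure_range_eqI[OF ips(1,3) b])
  assume h: "h \<in> carrier H"
  show "in_closure_range H N b (transfer (a h))" using h by (intro transfer(1)) simp
  show "in_closure_range H N b (b h)"
    unfolding in_closure_range_def using h by (auto intro!: exI[of _ "\<lambda>_. h"])
  show "cinner N (b k) (transfer (a h)) = cinner N (b k) (b h)" if "k \<in> carrier H" for k
    using that h by (simp add: transfer(2) cinner_eq)
qed

end

sublocale isometric_pair \<subseteq> swap: isometric_pair H N M b a
  by unfold_locales (use H M N a b norm_eq in auto)

context isometric_pair
begin

text \<open>Exchanging a and b gives the adjoint. An approximating sequence b (X n) of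
  \<open>transfer m\<close> corresponds to a (X n), which is Cauchy by isometry, and inner products
  can be compared along both sequences.\<close>

lemma transfer_adjoint:
  assumes m: "m \<in> carrier M" and y: "y \<in> carrier N"
  shows "cinner N (transfer m) y = cinner M m (swap.transfer y)"
proof -
  obtain X where X: "\<And>n. X n \<in> carrier H" and lim: "(\<lambda>n::nat. hnorm N (b (X n) - transfer m)) \<longlonglongrightarrow> 0"
    using transfer(1)[OF m] by (auto simp: in_closure_range_def)
  have "\<exists>p. p \<in> carrier M \<and> (\<lambda>n. hnorm M (a (X n) - p)) \<longlonglongrightarrow> 0"
  proof (rule hilbert_space_complete[OF M, of "\<lambda>n. a (X n)"])
    fix e :: real assume "e > 0"
    then obtain k where k: "\<And>n. n \<ge> k \<Longrightarrow> hnorm N (b (X n) - transfer m) < e / 2"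
      using LIMSEQ_D[OF lim, of "e / 2"] X m by fastforce
    have "hnorm M (a (X i) - a (X j)) < e" if "i \<ge> k" "j \<ge> k" for i j
    proof -
      have "hnorm M (a (X i) - a (X j)) = hnorm N (b (X i) - b (X j))" using norm_eq[of "X i - X j"] X by simp
      also have "\<dots> \<le> hnorm N (b (X i) - transfer m) + hnorm N (transfer m - b (X j))"
        using X m by (intro hnorm_triangle_sub) auto
      also have "\<dots> < e"
        using k[OF that(1)] k[OF that(2)] X m hnorm_minus_commute[OF ips(3), of "transfer m" "b (X j)"] by simp
      finally show ?thesis .
    qed
    then show "\<exists>k. \<forall>i\<ge>k. \<forall>j\<ge>k. hnorm M (a (X i) - a (X j)) < e" by blast
  qed (use X in auto)
  then obtain p where p: "p \<in> carrier M" "(\<lambda>n. hnorm M (a (X n) - p)) \<longlonglongrightarrow> 0" by blast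
  \<comment> \<open>The limit p is the orthogonal projection of m onto the closure of the range of
    a, so m and p are indistinguishable from within that closure.\<close>
  have p_eq: "cinner M (a h) p = cinner M (a h) m" if h: "h \<in> carrier H" for h
  proof -
    have "(\<lambda>n. cinner M (a h) (a (X n))) \<longlonglongrightarrow> cinner M (a h) p"
      using X p h by (intro tendsto_cinner) auto
    moreover have "(\<lambda>n. cinner N (b h) (b (X n))) \<longlonglongrightarrow> cinner N (b h) (transfer m)"
      using X lim h m by (intro tendsto_cinner) auto
    ultimately show ?thesis
      using LIMSEQ_unique transfer(2)[OF m h] cinner_eq[OF h X] by simp
  qed
  have "(\<lambda>n. cinner N y (b (X n))) \<longlonglongrightarrow> cinner N y (transfer m)"
    using X lim y m by (intro tendsto_cinner) auto
  moreover have "(\<lambda>n. cinner M (swap.transfer y) (a (X n))) \<longlonglongrightarrow> cinner M (swap.transfer y) p"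
    using X p y by (intro tendsto_cinner) auto
  moreover have "cinner N y (b (X n)) = cinner M (swap.transfer y) (a (X n))" for n
    using swap.transfer(2)[OF y X[of n]] cinner_commute[OF ips(3), of "b (X n)" y]
      cinner_commute[OF ips(2), of "a (X n)" "swap.transfer y"] X y by simp
  ultimately have "cinner N y (transfer m) = cinner M (swap.transfer y) p"
    using LIMSEQ_unique by simp
  moreover have "cinner M p (swap.transfer y) = cinner M m (swap.transfer y)"
    by (rule cinner_in_closure_range_eq[OF ips(1,2) a swap.transfer(1)[OF y] p(1) m p_eq])
  ultimately show ?thesis
    using cinner_commute[OF ips(3), of y "transfer m"] cinner_commute[OF ips(2), of "swap.transfer y" p] p(1) m y
    by simp
qed

end

context isometric_pair
begin

lemma transfer_add: "x \<in> carrier M \<Longrightarrow> y \<in> carrier M \<Longrightarrow> transfer (x + y) = transfer x + transfer y"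
  and transfer_diff: "x \<in> carrier M \<Longrightarrow> y \<in> carrier M \<Longrightarrow> transfer (x - y) = transfer x - transfer y"
  by (rule eqI_cinner[OF ips(3)];
      simp add: cinner_linear swap.transfer_adjoint[symmetric])+

lemma transfer_zero: "transfer 0 = 0"
  using transfer_diff[of 0 0] by simp

text \<open>The identity X X* X = X of partial isometries, which makes X X* and X* X projections and
  the Halmos matrix unitary.\<close>

lemma transfer_transfer_transfer:
  assumes m: "m \<in> carrier M"
  shows "transfer (swap.transfer (transfer m)) = transfer m"
proof (rule in_closure_range_eqI[OF ips(1,3) b])
  show "cinner N (b h) (transfer (swap.transfer (transfer m))) = cinner N (b h) (transfer m)" if "h \<in> carrier H" for h
    using that m by (simp add: transfer(2) swap.transfer(2))
qed (use m in \<open>auto simp: transfer\<close>)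

end

text \<open>The Halmos dilation of the partial isometry \<open>transfer\<close>, whose defect operators are the projections
  onto the complements of the closures of the two ranges.\<close>

lemma (in isometric_pair) unitary_extension:
  shows "\<exists>U. unitary_op (hprod M N) (hprod N M) U \<and> (\<forall>h\<in>carrier H. U (a h, 0) = (b h, 0))"
proof -
  let ?X = transfer and ?Y = swap.transfer
  note lin [simp] = transfer_add transfer_diff transfer_zero swap.transfer_add swap.transfer_diff swap.transfer_zero
    transfer_transfer_transfer swap.transfer_transfer_transfer
  \<comment> \<open>The matrix with rows (X, 1 - X X* ) and (1 - X* X, X* ), with \<open>U'\<close>
    its adjoint. On (a h, 0) the lower entry vanishes because X* X fixes a h.\<close>
  define U where "U = restrict_op (carrier (hprod M N))
    (\<lambda>(m, n). (?X m + (n - ?X (?Y n)), (m - ?Y (?X m)) + ?Y n))"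
  define U' where "U' = (\<lambda>(n, m). (?Y n + (m - ?Y (?X m)), (n - ?X (?Y n)) + ?X m))"
  have U: "U (m, n) = (?X m + (n - ?X (?Y n)), (m - ?Y (?X m)) + ?Y n)" if "m \<in> carrier M" "n \<in> carrier N" for m n
    using that by (simp add: U_def restrict_op_apply)
  have "unitary_op (hprod M N) (hprod N M) U"
  proof (rule unitary_of_adjoint_inverse[where U' = U'])
    fix x y assume x: "x \<in> carrier (hprod M N)" and y: "y \<in> carrier (hprod N M)"
    obtain m n where x': "x = (m, n)" and mn [simp]: "m \<in> carrier M" "n \<in> carrier N" using x by auto
    obtain n' m' where y': "y = (n', m')" and mn' [simp]: "m' \<in> carrier M" "n' \<in> carrier N" using y by auto
    show "cinner (hprod N M) (U x) y = cinner (hprod M N) x (U' y)"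
      unfolding x' y'
      by (simp add: U U'_def cinner_hprod cinner_linear transfer_adjoint swap.transfer_adjoint)
  next
    show "U x = 0" if "x \<notin> carrier (hprod M N)" for x
      using that unfolding U_def by (rule restrict_op_outside)
  qed (auto simp: U U'_def)
  moreover have "U (a h, 0) = (b h, 0)" if "h \<in> carrier H" for h
    using that by (simp add: U)
  ultimately show ?thesis by blast
qed

lemma l2_shift:
  fixes L :: "'a::complex_vector chilbert"
  assumes L: "inner_product_space L" and l: "l \<in> carrier L" and f: "f \<in> carrier (l2 L)"
  shows "case_nat l f \<in> carrier (l2 L)"
proof -
  have "(\<lambda>n. (hnorm L (f n))\<^sup>2) summable_on UNIV" using f by (simp add: mem_carrier_hsum)
  then have "(\<lambda>n. (hnorm L (case_nat l f n))\<^sup>2) summable_on range Suc"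
    by (subst summable_on_reindex) (auto simp: o_def)
  then have "(\<lambda>n. (hnorm L (case_nat l f n))\<^sup>2) summable_on insert 0 (range Suc)"
    by (simp only: summable_on_insert_iff)
  then have "(\<lambda>n. (hnorm L (case_nat l f n))\<^sup>2) summable_on UNIV"
    by (simp only: UNIV_nat_eq[symmetric])
  then show ?thesis using l f by (auto simp: mem_carrier_hsum split: nat.split)
qed

lemma l2_tail:
  fixes L :: "'a::complex_vector chilbert"
  assumes L: "inner_product_space L" and f: "f \<in> carrier (l2 L)"
  shows "(\<lambda>n. f (Suc n)) \<in> carrier (l2 L)"
proof -
  have "(\<lambda>n. (hnorm L (f n))\<^sup>2) summable_on range Suc"
    using f by (auto simp: mem_carrier_hsum intro: summable_on_subset_banach)
  then have "(\<lambda>n. (hnorm L (f (Suc n)))\<^sup>2) summable_on UNIV"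
    by (subst (asm) summable_on_reindex) (auto simp: o_def)
  then show ?thesis using f by (auto simp: mem_carrier_hsum)
qed

lemma cinner_l2_split:
  fixes L :: "'a::complex_vector chilbert"
  assumes L: "inner_product_space L" and f: "f \<in> carrier (l2 L)" and g: "g \<in> carrier (l2 L)"
  shows "cinner (l2 L) f g = cinner L (f 0) (g 0) + cinner (l2 L) (\<lambda>n. f (Suc n)) (\<lambda>n. g (Suc n))"
proof -
  have "(\<lambda>n. cinner L (f n) (g n)) summable_on UNIV"
    using L f g by (intro hsum_summable_cinner) auto
  then have s: "(\<lambda>n. cinner L (f n) (g n)) summable_on range Suc"
    by (rule summable_on_subset_banach) simp
  have "infsum (\<lambda>n. cinner L (f n) (g n)) (insert 0 (range Suc)) =
      cinner L (f 0) (g 0) + infsum (\<lambda>n. cinner L (f n) (g n)) (range Suc)"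
    by (rule infsum_insert[OF s]) simp
  also have "infsum (\<lambda>n. cinner L (f n) (g n)) (range Suc) = infsum (\<lambda>n. cinner L (f (Suc n)) (g (Suc n))) UNIV"
    by (subst infsum_reindex) (auto simp: o_def)
  finally show ?thesis by (simp only: cinner_hsum UNIV_nat_eq[symmetric])
qed

text \<open>Adjoining infinitely many copies of \<open>L\<close> absorbs the extra summand \<open>L\<close> on the right.\<close>

lemma isometric_pair_absorbing_extension:
  fixes H :: "'h::complex_vector chilbert" and M :: "'m::complex_vector chilbert" and L :: "'l::complex_vector chilbert"
  assumes H: "inner_product_space H" and M: "hilbert_space M" and L: "hilbert_space L"
    and a: "a \<in> bounded_ops H M" and b: "b \<in> bounded_ops H M" and d: "d \<in> bounded_ops H L"
    and norm_eq: "\<And>h. h \<in> carrier H \<Longrightarrow> (hnorm M (a h))\<^sup>2 = (hnorm M (b h))\<^sup>2 + (hnorm L (d h))\<^sup>2"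
  shows "\<exists>U. unitary_op (hprod M (hprod M (l2 L))) (hprod (hprod M (hprod M (l2 L))) L) U \<and>
    (\<forall>h\<in>carrier H. U (a h, 0, 0) = ((b h, 0, 0), d h))"
proof -
  have ipsML [simp]: "inner_product_space M" "inner_product_space L" "inner_product_space (l2 L)"
    using M L hilbert_space_l2[OF L] by auto
  note [simp] = op_linear[OF H ipsML(1) a] op_linear[OF H ipsML(1) b] op_linear[OF H ipsML(2) d]
  let ?N = "hprod M L"
  \<comment> \<open>The norm hypothesis says exactly that a h and the pair (b h, d h) have equal
    norms.\<close>
  define bd where "bd = (\<lambda>h. (b h, d h))"
  have norm_bd: "hnorm ?N (bd h) = hnorm M (a h)" if h: "h \<in> carrier H" for h
  proof (rule power2_eq_imp_eq)
    have mem: "bd h \<in> carrier ?N" using h by (simp add: bd_def)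
    show "(hnorm ?N (bd h))\<^sup>2 = (hnorm M (a h))\<^sup>2"
      using hnorm_hprod[OF ipsML(1,2) mem] norm_eq[OF h] by (simp add: bd_def)
    show "0 \<le> hnorm ?N (bd h)" by (rule hnorm_nonneg[OF inner_product_space_hprod[OF ipsML(1,2)] mem])
  qed (use h in simp)
  obtain C where C: "C > 0" "\<And>h. h \<in> carrier H \<Longrightarrow> hnorm M (a h) \<le> C * hnorm H h"
    by (rule op_bound[OF H ipsML(1) a], rule that)
  have "bd \<in> bounded_ops H ?N"
    by (rule bounded_opsI[where B = C])
      (auto simp: norm_bd C(2), auto simp: bd_def op_outside[OF H ipsML(1) b] op_outside[OF H ipsML(2) d] zero_prod_def)
  then interpret isometric_pair H M ?N a bd
    by unfold_locales (use H M L a norm_bd in auto)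
  obtain U where U: "unitary_op (hprod M ?N) (hprod ?N M) U" "\<And>h. h \<in> carrier H \<Longrightarrow> U (a h, 0) = (bd h, 0)"
    using unitary_extension by blast
  obtain U' where U': "unitary_op (hprod ?N M) (hprod M ?N) U'"
    "\<And>x. x \<in> carrier (hprod M ?N) \<Longrightarrow> U' (U x) = x" "\<And>y. y \<in> carrier (hprod ?N M) \<Longrightarrow> U (U' y) = y"
    "\<And>x y. x \<in> carrier (hprod M ?N) \<Longrightarrow> y \<in> carrier (hprod ?N M) \<Longrightarrow> cinner (hprod ?N M) (U x) y = cinner (hprod M ?N) x (U' y)"
    by (rule unitary_op_inverse[OF _ _ U(1)], simp, simp, rule that)
  have Uc: "U x \<in> carrier (hprod ?N M)" if "x \<in> carrier (hprod M ?N)" for x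
    using U(1) that by (auto simp: unitary_op_def)
  have U'c: "U' y \<in> carrier (hprod M ?N)" if "y \<in> carrier (hprod ?N M)" for y
    using U'(1) that by (auto simp: unitary_op_def)
  let ?T = "hprod M (hprod M (l2 L))"
  \<comment> \<open>The Halmos unitary goes from M + (M + L) to (M + L) + M. Its input from L is the
    head of the sequence f, whose tail moves up by one place; its output in L becomes the separate
    last summand. \<open>W'\<close> puts the returned L-component back at the head.\<close>
  define W where "W = restrict_op (carrier ?T)
    (\<lambda>(m, m', f). case U (m, (m', f 0)) of ((g, l), k) \<Rightarrow> ((g, k, \<lambda>n. f (Suc n)), l))"
  define W' where "W' = (\<lambda>((g, k, f), l). case U' ((g, l), k) of (m, (m', l')) \<Rightarrow> (m, m', case_nat l' f))"
  have f0: "f 0 \<in> carrier L" if "f \<in> carrier (l2 L)" for f :: "nat \<Rightarrow> 'l"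
    using that by (simp add: mem_carrier_hsum)
  have "unitary_op ?T (hprod ?T L) W"
  proof (rule unitary_of_adjoint_inverse[where U' = W'])
    fix x assume x: "x \<in> carrier ?T"
    then obtain m m' f where x': "x = (m, m', f)" and c: "m \<in> carrier M" "m' \<in> carrier M" "f \<in> carrier (l2 L)"
      by auto
    then have mem: "(m, (m', f 0)) \<in> carrier (hprod M ?N)" using f0 by simp
    obtain g l k where Uv: "U (m, (m', f 0)) = ((g, l), k)" by (metis surj_pair)
    have c': "g \<in> carrier M" "l \<in> carrier L" "k \<in> carrier M" using Uc[OF mem] by (simp_all add: Uv)
    have Wx: "W x = ((g, k, \<lambda>n. f (Suc n)), l)" using x by (simp add: W_def restrict_op_apply x' Uv)
    show "W x \<in> carrier (hprod ?T L)" using c' c l2_tail[OF ipsML(2) c(3)] by (simp add: Wx)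
    have "case_nat (f 0) (\<lambda>n. f (Suc n)) = f" by (rule ext) (simp split: nat.split)
    then show "W' (W x) = x" unfolding Wx using U'(2)[OF mem] by (simp add: W'_def Uv x')
    fix y assume y: "y \<in> carrier (hprod ?T L)"
    then obtain g2 k2 f2 l' where y': "y = ((g2, k2, f2), l')"
      and d: "g2 \<in> carrier M" "k2 \<in> carrier M" "f2 \<in> carrier (hsum UNIV (\<lambda>_. L))" "l' \<in> carrier L" by auto
    then have memy: "((g2, l'), k2) \<in> carrier (hprod ?N M)" by simp
    obtain n n' s where U'v: "U' ((g2, l'), k2) = (n, (n', s))" by (metis surj_pair)
    have d': "n \<in> carrier M" "n' \<in> carrier M" "s \<in> carrier L" using U'c[OF memy] by (simp_all add: U'v)
    show "cinner (hprod ?T L) (W x) y = cinner ?T x (W' y)"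
      unfolding Wx using U'(4)[OF mem memy] cinner_l2_split[OF ipsML(2) c(3) l2_shift[OF ipsML(2) d'(3) d(3)]]
      by (simp add: W'_def x' y' Uv U'v cinner_hprod ac_simps)
  next
    fix y assume y: "y \<in> carrier (hprod ?T L)"
    then obtain g k f l where y': "y = ((g, k, f), l)"
      and d: "g \<in> carrier M" "k \<in> carrier M" "f \<in> carrier (l2 L)" "l \<in> carrier L" by auto
    then have memy: "((g, l), k) \<in> carrier (hprod ?N M)" by simp
    obtain n n' s where U'v: "U' ((g, l), k) = (n, (n', s))" by (metis surj_pair)
    have d': "n \<in> carrier M" "n' \<in> carrier M" "s \<in> carrier L" using U'c[OF memy] by (simp_all add: U'v)
    have W'y: "W' y = (n, n', case_nat s f)" by (simp add: W'_def y' U'v)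
    show mem: "W' y \<in> carrier ?T" using d d' l2_shift[OF ipsML(2) d'(3) d(3)] by (simp add: W'y)
    show "W (W' y) = y"
      using mem U'(3)[OF memy] unfolding W'y by (simp add: W_def restrict_op_apply U'v y')
  next
    show "W x = 0" if "x \<notin> carrier ?T" for x
      using that unfolding W_def by (rule restrict_op_outside)
  qed (use M L hilbert_space_l2[OF L] in simp_all)
  moreover have "W (a h, 0, 0) = ((b h, 0, 0), d h)" if h: "h \<in> carrier H" for h
  proof -
    have mem: "(a h, 0, 0) \<in> carrier ?T" using h by simp
    show ?thesis
      unfolding W_def restrict_op_apply[OF mem] using U(2)[OF h] by (simp add: bd_def zero_prod_def zero_fun_def)
  qed
  ultimately show ?thesis by blast
qed

section \<open>The lifting\<close>

text \<open>The factors of A, B and D. Positivity of A and B is the upper and lower norm bound for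
  T, and the choice of k makes A + B = 1, so that h -> (\<alpha> h, \<beta> h) is isometric.\<close>

lemma annulus_factors:
  assumes r: "0 < r" "r < 1" and T: "T \<in> PA r H"
  obtains \<alpha> \<beta> \<delta> where "\<alpha> \<in> bounded_ops H (l2 H)" "\<beta> \<in> bounded_ops H (l2 H)" "\<delta> \<in> bounded_ops H (l2 H)"
    "\<And>h. h \<in> carrier H \<Longrightarrow> (hnorm (l2 H) (\<alpha> h))\<^sup>2 + (hnorm (l2 H) (\<beta> h))\<^sup>2 = (hnorm H h)\<^sup>2"
    "\<And>h. h \<in> carrier H \<Longrightarrow> 1 / r\<^sup>2 * (hnorm (l2 H) (\<beta> h))\<^sup>2 = (hnorm (l2 H) (\<beta> (T h)))\<^sup>2 + (hnorm (l2 H) (\<delta> h))\<^sup>2"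
    "\<And>h. h \<in> carrier H \<Longrightarrow> (hnorm (l2 H) (\<alpha> (T h)))\<^sup>2 = r\<^sup>2 * (hnorm (l2 H) (\<alpha> h))\<^sup>2 + (hnorm (l2 H) (\<delta> h))\<^sup>2"
proof -
  have H: "hilbert_space H" and T': "invertible_op H T"
    and T_le: "\<And>x. x \<in> carrier H \<Longrightarrow>
      (hnorm H (T x))\<^sup>2 + (hnorm H (inv_op H T x))\<^sup>2 \<le> (1 / r\<^sup>2 + r\<^sup>2) * (hnorm H x)\<^sup>2"
    using T by (auto simp: PA_iff[OF r])
  have ips [simp]: "inner_product_space H" using H by simp
  note T_bdd = invertible_op_bounded[OF ips T'] and D_bdd = annulus_defect_bounded[OF H T', of r]
  note Ta_bdd = adj_op_bounded[OF H H T_bdd]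
  note [simp] = op_linear[OF ips ips T_bdd] op_linear[OF ips ips D_bdd] op_linear[OF ips ips Ta_bdd]
    cinner_adj_op[OF H H T_bdd] cinner_adj_op'[OF H H T_bdd]
  define k where "k = 1 / (1 / r\<^sup>2 - r\<^sup>2)"
  have k: "k > 0" "k * (1 / r\<^sup>2 - r\<^sup>2) = 1" using inverse_power2_gt[OF r] by (simp_all add: k_def)
  have lower: "r\<^sup>2 * (hnorm H h)\<^sup>2 \<le> (hnorm H (T h))\<^sup>2" if "h \<in> carrier H" for h
    using power_mono[OF PA_lower_bound[OF r T that], of 2] r that by (simp add: power_mult_distrib)
  have upper: "(hnorm H (T h))\<^sup>2 \<le> 1 / r\<^sup>2 * (hnorm H h)\<^sup>2" if "h \<in> carrier H" for h
    using power_mono[OF PA_upper_bound[OF r T that], of 2] r that by (simp add: power_divide)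
  let ?k = "of_real k" and ?TT = "adj_op H H T \<circ> T"
  let ?A = "?k *\<^sub>C (of_real (1 / r\<^sup>2) *\<^sub>C id_op H - ?TT)"
  let ?B = "?k *\<^sub>C (?TT - of_real (r\<^sup>2) *\<^sub>C id_op H)"
  \<comment> \<open>Equal to B/r^2 - T* B T and to T* A T - r^2 A; in the present form its
    positivity is the inequality of \<open>PA\<close> at T h, since the inverse takes T h back to
    h.\<close>
  let ?D = "?k *\<^sub>C (adj_op H H T \<circ> (annulus_defect r H T \<circ> T))"
  have formA: "Re (cinner H (?A h) h) = k * (1 / r\<^sup>2 * (hnorm H h)\<^sup>2 - (hnorm H (T h))\<^sup>2)" if "h \<in> carrier H" for h
    using that by (simp add: cinner_linear cinner_self flip: of_real_power)
  have formB: "Re (cinner H (?B h) h) = k * ((hnorm H (T h))\<^sup>2 - r\<^sup>2 * (hnorm H h)\<^sup>2)" if "h \<in> carrier H" for h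
    using that by (simp add: cinner_linear cinner_self flip: of_real_power)
  have formD: "Re (cinner H (?D h) h) =
      k * ((1 / r\<^sup>2 + r\<^sup>2) * (hnorm H (T h))\<^sup>2 - (hnorm H (T (T h)))\<^sup>2 - (hnorm H h)\<^sup>2)" if "h \<in> carrier H" for h
    using that Re_cinner_annulus_defect[OF H T', of "T h" r] inv_op_left[OF ips T' that]
    by (simp add: cinner_linear)
  have "positive_op H ?A" unfolding positive_op_def
  proof (intro conjI ballI)
    show "?A \<in> bounded_ops H H"
      by (intro scaleC_bounded diff_bounded id_op_bounded comp_bounded[OF ips ips ips] T_bdd Ta_bdd ips)
    show "0 \<le> Re (cinner H (?A x) x)" if "x \<in> carrier H" for x
      unfolding formA[OF that] using upper[OF that] k by simp
  qed (simp add: cinner_linear)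
  then obtain \<alpha> where \<alpha>: "\<alpha> \<in> bounded_ops H (l2 H)"
    "\<And>h. h \<in> carrier H \<Longrightarrow> (hnorm (l2 H) (\<alpha> h))\<^sup>2 = Re (cinner H (?A h) h)"
    using positive_factor[OF H] by blast
  have "positive_op H ?B" unfolding positive_op_def
  proof (intro conjI ballI)
    show "?B \<in> bounded_ops H H"
      by (intro scaleC_bounded diff_bounded id_op_bounded comp_bounded[OF ips ips ips] T_bdd Ta_bdd ips)
    show "0 \<le> Re (cinner H (?B x) x)" if "x \<in> carrier H" for x
      unfolding formB[OF that] using lower[OF that] k by simp
  qed (simp add: cinner_linear)
  then obtain \<beta> where \<beta>: "\<beta> \<in> bounded_ops H (l2 H)"
    "\<And>h. h \<in> carrier H \<Longrightarrow> (hnorm (l2 H) (\<beta> h))\<^sup>2 = Re (cinner H (?B h) h)"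
    using positive_factor[OF H] by blast
  have "positive_op H ?D" unfolding positive_op_def
  proof (intro conjI ballI)
    show "?D \<in> bounded_ops H H"
      by (intro scaleC_bounded comp_bounded[OF ips ips ips] T_bdd Ta_bdd D_bdd ips)
    show "0 \<le> Re (cinner H (?D x) x)" if "x \<in> carrier H" for x
      unfolding formD[OF that] using T_le[of "T x"] inv_op_left[OF ips T' that] that k by simp
    show "cinner H (?D x) y = cinner H x (?D y)" if "x \<in> carrier H" "y \<in> carrier H" for x y
      using that annulus_defect_symmetric[OF H T', of "T x" "T y" r] by (simp add: cinner_linear)
  qed
  then obtain \<delta> where \<delta>: "\<delta> \<in> bounded_ops H (l2 H)"
    "\<And>h. h \<in> carrier H \<Longrightarrow> (hnorm (l2 H) (\<delta> h))\<^sup>2 = Re (cinner H (?D h) h)"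
    using positive_factor[OF H] by blast
  show thesis
  proof (rule that[OF \<alpha>(1) \<beta>(1) \<delta>(1)])
    fix h assume h: "h \<in> carrier H"
    then have Th: "T h \<in> carrier H" by simp
    note forms = \<alpha>(2)[OF h] \<alpha>(2)[OF Th] \<beta>(2)[OF h] \<beta>(2)[OF Th] \<delta>(2)[OF h]
      formA[OF h] formA[OF Th] formB[OF h] formB[OF Th] formD[OF h]
    have "k * (1 / r\<^sup>2 * (hnorm H h)\<^sup>2 - (hnorm H (T h))\<^sup>2) + k * ((hnorm H (T h))\<^sup>2 - r\<^sup>2 * (hnorm H h)\<^sup>2) =
        (k * (1 / r\<^sup>2 - r\<^sup>2)) * (hnorm H h)\<^sup>2" by (simp only: algebra_simps)
    then show "(hnorm (l2 H) (\<alpha> h))\<^sup>2 + (hnorm (l2 H) (\<beta> h))\<^sup>2 = (hnorm H h)\<^sup>2"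
      unfolding forms k(2) by simp
    show "1 / r\<^sup>2 * (hnorm (l2 H) (\<beta> h))\<^sup>2 = (hnorm (l2 H) (\<beta> (T h)))\<^sup>2 + (hnorm (l2 H) (\<delta> h))\<^sup>2"
      "(hnorm (l2 H) (\<alpha> (T h)))\<^sup>2 = r\<^sup>2 * (hnorm (l2 H) (\<alpha> h))\<^sup>2 + (hnorm (l2 H) (\<delta> h))\<^sup>2"
      unfolding forms using r by (simp_all add: field_simps)
  qed
qed

text \<open>Ambient type of M + M + l2 M for M = l2 H, the space on which the absorbing extension
  lives when L = M; the lift uses one copy for each of ran P and ker P.\<close>

type_synonym 'a lifting_half = "(nat \<Rightarrow> 'a) \<times> (nat \<Rightarrow> 'a) \<times> (nat \<Rightarrow> nat \<Rightarrow> 'a)"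

lemma carrier_hprodI: "x \<in> carrier H \<Longrightarrow> y \<in> carrier K \<Longrightarrow> (x, y) \<in> carrier (hprod H K)"
  by simp

lemma carrier_hprodE:
  assumes "p \<in> carrier (hprod H K)"
  obtains x y where "p = (x, y)" "x \<in> carrier H" "y \<in> carrier K"
  using assms by auto

text \<open>U is a composition of unitaries: \<open>X\<close> splits a d-component off the second
  half, and the inverse of \<open>Z\<close> merges it into the first half. Flow in this one
  direction only is what makes U triangular.\<close>

lemma PA_lifts:
  fixes H :: "'a::complex_vector chilbert"
  assumes r: "0 < r" "r < 1" and T: "T \<in> PA r H"
  obtains K :: "('a lifting_half \<times> 'a lifting_half) chilbert" and P U U'
  where "triangular_unitary K P U U'" "lifts_to H T K (weighted_unitary r K P U)"
proof -
  have H: "hilbert_space H" and T': "invertible_op H T" using T by (auto simp: PA_iff[OF r])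
  let ?M = "l2 H"
  let ?N = "hprod ?M (hprod ?M (l2 ?M))"
  have M: "hilbert_space ?M" by (rule hilbert_space_l2[OF H])
  have N: "hilbert_space ?N" using M hilbert_space_l2[OF M] by simp
  have ips [simp]: "inner_product_space H" "inner_product_space ?M" "inner_product_space (l2 ?M)"
    using H M hilbert_space_l2[OF M] by auto
  have ipsN: "inner_product_space ?N" "inner_product_space (hprod ?N ?M)" by simp_all
  note T_bdd = invertible_op_bounded[OF ips(1) T']
  obtain \<alpha> \<beta> \<delta> where bdd: "\<alpha> \<in> bounded_ops H ?M" "\<beta> \<in> bounded_ops H ?M" "\<delta> \<in> bounded_ops H ?M"
    and norms: "\<And>h. h \<in> carrier H \<Longrightarrow> (hnorm ?M (\<alpha> h))\<^sup>2 + (hnorm ?M (\<beta> h))\<^sup>2 = (hnorm H h)\<^sup>2"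
      "\<And>h. h \<in> carrier H \<Longrightarrow> 1 / r\<^sup>2 * (hnorm ?M (\<beta> h))\<^sup>2 = (hnorm ?M (\<beta> (T h)))\<^sup>2 + (hnorm ?M (\<delta> h))\<^sup>2"
      "\<And>h. h \<in> carrier H \<Longrightarrow> (hnorm ?M (\<alpha> (T h)))\<^sup>2 = r\<^sup>2 * (hnorm ?M (\<alpha> h))\<^sup>2 + (hnorm ?M (\<delta> h))\<^sup>2"
    by (rule annulus_factors[OF r T], rule that)
  note [simp] = op_linear[OF ips(1,2) bdd(1)] op_linear[OF ips(1,2) bdd(2)] op_linear[OF ips(1,2) bdd(3)]
    op_linear[OF ips(1,1) T_bdd]
  have "\<exists>X. unitary_op ?N (hprod ?N ?M) X \<and>
      (\<forall>h\<in>carrier H. X ((of_real (1 / r) *\<^sub>C \<beta>) h, 0, 0) = (((\<beta> \<circ> T) h, 0, 0), \<delta> h))"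
    by (rule isometric_pair_absorbing_extension[OF ips(1) M M scaleC_bounded[OF ips(1,2) bdd(2)]
          comp_bounded[OF ips(1,1,2) bdd(2) T_bdd] bdd(3)])
      (simp add: hnorm_scale norms(2)[symmetric] power_divide norm_divide)
  then obtain X where X: "unitary_op ?N (hprod ?N ?M) X"
    "\<And>h. h \<in> carrier H \<Longrightarrow> X (of_real (1 / r) *\<^sub>C \<beta> h, 0, 0) = ((\<beta> (T h), 0, 0), \<delta> h)" by auto
  \<comment> \<open>This unitary runs against the action of U: it splits \<alpha> T h into r
    \<alpha> h and \<delta> h, so that both extensions emit the same \<delta> h and its inverse can
    absorb what \<open>X\<close> emits.\<close>
  have "\<exists>Z. unitary_op ?N (hprod ?N ?M) Z \<and>
      (\<forall>h\<in>carrier H. Z ((\<alpha> \<circ> T) h, 0, 0) = (((of_real r *\<^sub>C \<alpha>) h, 0, 0), \<delta> h))"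
    by (rule isometric_pair_absorbing_extension[OF ips(1) M M comp_bounded[OF ips(1,1,2) bdd(1) T_bdd]
          scaleC_bounded[OF ips(1,2) bdd(1)] bdd(3)])
      (simp add: hnorm_scale norms(3) power_mult_distrib)
  then obtain Z where Z: "unitary_op ?N (hprod ?N ?M) Z"
    "\<And>h. h \<in> carrier H \<Longrightarrow> Z (\<alpha> (T h), 0, 0) = ((of_real r *\<^sub>C \<alpha> h, 0, 0), \<delta> h)" by auto
  obtain X' where X': "unitary_op (hprod ?N ?M) ?N X'" "\<And>x. x \<in> carrier ?N \<Longrightarrow> X' (X x) = x"
    "\<And>y. y \<in> carrier (hprod ?N ?M) \<Longrightarrow> X (X' y) = y"
    "\<And>x y. x \<in> carrier ?N \<Longrightarrow> y \<in> carrier (hprod ?N ?M) \<Longrightarrow> cinner (hprod ?N ?M) (X x) y = cinner ?N x (X' y)"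
    by (rule unitary_op_inverse[OF ipsN X(1)], rule that)
  obtain Z' where Z': "unitary_op (hprod ?N ?M) ?N Z'" "\<And>x. x \<in> carrier ?N \<Longrightarrow> Z' (Z x) = x"
    "\<And>y. y \<in> carrier (hprod ?N ?M) \<Longrightarrow> Z (Z' y) = y"
    "\<And>x y. x \<in> carrier ?N \<Longrightarrow> y \<in> carrier (hprod ?N ?M) \<Longrightarrow> cinner (hprod ?N ?M) (Z x) y = cinner ?N x (Z' y)"
    by (rule unitary_op_inverse[OF ipsN Z(1)], rule that)
  let ?K = "hprod ?N ?N"
  have K: "hilbert_space ?K" and ipsK [simp]: "inner_product_space ?K" using N by simp_all
  have Xc: "X m \<in> carrier (hprod ?N ?M)" "Z m \<in> carrier (hprod ?N ?M)" if "m \<in> carrier ?N" for m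
    using X(1) Z(1) that unfolding unitary_op_def by blast+
  have X'c: "X' m \<in> carrier ?N" "Z' m \<in> carrier ?N" if "m \<in> carrier (hprod ?N ?M)" for m
    using X'(1) Z'(1) that unfolding unitary_op_def by blast+
  define P where "P = restrict_op (carrier ?K) (\<lambda>p. (fst p, 0 :: 'a lifting_half))"
  \<comment> \<open>The component \<open>snd (X m)\<close> is handed over to \<open>Z'\<close>; what
    remains of X m stays in the second half.\<close>
  define U where "U = restrict_op (carrier ?K) (\<lambda>(p, m). (Z' (p, snd (X m)), fst (X m)))"
  define U' where "U' = restrict_op (carrier ?K) (\<lambda>(p, m). (fst (Z p), X' (m, snd (Z p))))"
  have P: "P (p, m) = (p, 0)" and U: "U (p, m) = (Z' (p, snd (X m)), fst (X m))"
    and U': "U' (p, m) = (fst (Z p), X' (m, snd (Z p)))" if "p \<in> carrier ?N" "m \<in> carrier ?N" for p m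
    unfolding P_def U_def U'_def restrict_op_apply[OF carrier_hprodI[OF that]] by simp_all
  have c1: "fst (X m) \<in> carrier ?N" "snd (X m) \<in> carrier ?M" "fst (Z m) \<in> carrier ?N" "snd (Z m) \<in> carrier ?M"
    if "m \<in> carrier ?N" for m
    using Xc[OF that] by (simp_all only: carrier_hprod mem_Times_iff)
  have c2: "X' (m, l) \<in> carrier ?N" "Z' (m, l) \<in> carrier ?N" if "m \<in> carrier ?N" "l \<in> carrier ?M" for m l
    by (intro X'c carrier_hprodI that)+
  have inv: "X (X' (m, l)) = (m, l)" "Z (Z' (m, l)) = (m, l)" if "m \<in> carrier ?N" "l \<in> carrier ?M" for m l
    by (intro X'(3) Z'(3) carrier_hprodI that)+
  have U_closed: "U x \<in> carrier ?K" and U'_closed: "U' x \<in> carrier ?K" if x: "x \<in> carrier ?K" for x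
  proof -
    obtain p m where x': "x = (p, m)" and pm: "p \<in> carrier ?N" "m \<in> carrier ?N"
      by (rule carrier_hprodE[OF x])
    show "U x \<in> carrier ?K" "U' x \<in> carrier ?K"
      unfolding x' U[OF pm] U'[OF pm] by (intro carrier_hprodI c1 c2 pm)+
  qed
  have UU': "U (U' x) = x" and U'U: "U' (U x) = x" if x: "x \<in> carrier ?K" for x
  proof -
    obtain p m where x': "x = (p, m)" and pm: "p \<in> carrier ?N" "m \<in> carrier ?N"
      by (rule carrier_hprodE[OF x])
    have "U (U' x) = (Z' (fst (Z p), snd (X (X' (m, snd (Z p))))), fst (X (X' (m, snd (Z p)))))"
      unfolding x' U'[OF pm] by (rule U[OF c1(3)[OF pm(1)] c2(1)[OF pm(2) c1(4)[OF pm(1)]]])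
    then show "U (U' x) = x" using inv(1)[OF pm(2) c1(4)[OF pm(1)]] Z'(2)[OF pm(1)] by (simp add: x')
    have "U' (U x) = (fst (Z (Z' (p, snd (X m)))), X' (fst (X m), snd (Z (Z' (p, snd (X m))))))"
      unfolding x' U[OF pm] by (rule U'[OF c2(2)[OF pm(1) c1(2)[OF pm(2)]] c1(1)[OF pm(2)]])
    then show "U' (U x) = x" using inv(2)[OF pm(1) c1(2)[OF pm(2)]] X'(2)[OF pm(2)] by (simp add: x')
  qed
  have U_adj: "cinner ?K (U x) y = cinner ?K x (U' y)" if x: "x \<in> carrier ?K" and y: "y \<in> carrier ?K" for x y
  proof -
    obtain p m where x': "x = (p, m)" and pm: "p \<in> carrier ?N" "m \<in> carrier ?N"
      by (rule carrier_hprodE[OF x])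
    obtain q n where y': "y = (q, n)" and qn: "q \<in> carrier ?N" "n \<in> carrier ?N"
      by (rule carrier_hprodE[OF y])
    have mem: "(p, snd (X m)) \<in> carrier (hprod ?N ?M)" "(n, snd (Z q)) \<in> carrier (hprod ?N ?M)"
      by (intro carrier_hprodI c1 pm qn)+
    have "cinner ?N q (Z' (p, snd (X m))) = cinner (hprod ?N ?M) (Z q) (p, snd (X m))"
      by (rule Z'(4)[OF qn(1) mem(1), symmetric])
    then have "cinner ?N (Z' (p, snd (X m))) q = cinner (hprod ?N ?M) (p, snd (X m)) (Z q)"
      using cinner_commute[OF ipsN(1) qn(1) X'c(2)[OF mem(1)]] cinner_commute[OF ipsN(2) Xc(2)[OF qn(1)] mem(1)]
      by (simp only:)
    moreover have "cinner ?N m (X' (n, snd (Z q))) = cinner (hprod ?N ?M) (X m) (n, snd (Z q))"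
      by (rule X'(4)[OF pm(2) mem(2), symmetric])
    ultimately show ?thesis
      unfolding x' y' U[OF pm] U'[OF qn] cinner_hprod[of ?N ?N] cinner_hprod[of ?N ?M] by simp
  qed
  have "unitary_op ?K ?K U"
    by (rule unitary_of_adjoint_inverse[OF ipsK ipsK U_closed _ U'_closed U'U UU' U_adj])
      (simp_all only: U_def restrict_op_outside not_False_eq_True)
  then have U_bdd: "U \<in> bounded_ops ?K ?K" by (simp only: unitary_op_def isometry_def)
  have U'_bdd: "U' \<in> bounded_ops ?K ?K"
    by (rule bounded_ops_of_adjoint[OF ipsK ipsK U_bdd U'_closed _ U_adj])
      (simp_all only: U'_def restrict_op_outside not_False_eq_True)
  have P_bdd: "P \<in> bounded_ops ?K ?K"
    unfolding P_def by (rule fst_projection_bounded[OF ipsN(1,1)])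
  \<comment> \<open>For m = 0 nothing is handed over and the second half stays 0, so U maps the
    first half into itself.\<close>
  have X0: "X 0 = 0"
    using X(1) op_zero[OF ipsN, of X] by (simp add: unitary_op_def isometry_def)
  have N0: "0 \<in> carrier ?N" by (rule carrier_zero[OF ipsN(1)])
  have model: "triangular_unitary ?K P U U'"
  proof (rule triangular_unitaryI[OF K P_bdd U_bdd U'_bdd])
    fix x assume x: "x \<in> carrier ?K"
    obtain p m where x': "x = (p, m)" and pm: "p \<in> carrier ?N" "m \<in> carrier ?N"
      by (rule carrier_hprodE[OF x])
    show "P (P x) = P x" unfolding x' P[OF pm] P[OF pm(1) N0] by simp
    have "U (P x) = (Z' (p, 0), 0)" unfolding x' P[OF pm] U[OF pm(1) N0] X0 by simp
    moreover have "P (Z' (p, 0), 0) = (Z' (p, 0), 0)"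
      by (rule P[OF c2(2)[OF pm(1)] N0]) simp
    ultimately show "P (U (P x)) = U (P x)" by (simp only:)
    fix y assume y: "y \<in> carrier ?K"
    obtain q n where y': "y = (q, n)" and qn: "q \<in> carrier ?N" "n \<in> carrier ?N"
      by (rule carrier_hprodE[OF y])
    show "cinner ?K (P x) y = cinner ?K x (P y)"
      unfolding x' y' P[OF pm] P[OF qn] cinner_hprod[of ?N ?N]
      using cinner_zero_left[OF ipsN(1) qn(2)] cinner_zero_right[OF ipsN(1) pm(2)] by simp
  qed (rule UU' U'U U_adj; assumption)+
  define V where "V = restrict_op (carrier H)
    (\<lambda>h. ((\<alpha> h, 0 :: nat \<Rightarrow> 'a, 0 :: nat \<Rightarrow> nat \<Rightarrow> 'a), (\<beta> h, 0 :: nat \<Rightarrow> 'a, 0 :: nat \<Rightarrow> nat \<Rightarrow> 'a)))"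
  have V: "V h = ((\<alpha> h, 0, 0), (\<beta> h, 0, 0))" if "h \<in> carrier H" for h
    using that by (simp add: V_def restrict_op_apply)
  have emb: "(x, 0, 0) \<in> carrier ?N" "(hnorm ?N (x, 0, 0))\<^sup>2 = (hnorm ?M x)\<^sup>2" if "x \<in> carrier ?M" for x
  proof -
    show mem: "(x, 0, 0) \<in> carrier ?N" using that by simp
    have "(0, 0) \<in> carrier (hprod ?M (l2 ?M))" by simp
    then show "(hnorm ?N (x, 0, 0))\<^sup>2 = (hnorm ?M x)\<^sup>2"
      using hnorm_hprod[OF _ _ mem] hnorm_hprod[of ?M "l2 ?M" "(0, 0)"] by simp
  qed
  have V_closed: "V h \<in> carrier ?K" if "h \<in> carrier H" for h
    unfolding V[OF that] by (intro carrier_hprodI emb(1)) (use that in simp_all)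
  have iso: "isometry H ?K V"
  proof (rule isometryI[OF V_closed])
    show "V h = 0" if "h \<notin> carrier H" for h
      using that unfolding V_def by (rule restrict_op_outside)
    show "hnorm ?K (V h) = hnorm H h" if h: "h \<in> carrier H" for h
    proof (rule power2_eq_imp_eq)
      have "(hnorm ?K (V h))\<^sup>2 = (hnorm ?N (\<alpha> h, 0, 0))\<^sup>2 + (hnorm ?N (\<beta> h, 0, 0))\<^sup>2"
        using hnorm_hprod[OF ipsN(1,1) V_closed[OF h]] by (simp only: V[OF h] fst_conv snd_conv)
      then show "(hnorm ?K (V h))\<^sup>2 = (hnorm H h)\<^sup>2" using norms(1)[OF h] emb(2) h by simp
      show "0 \<le> hnorm ?K (V h)" by (rule hnorm_nonneg[OF ipsK V_closed[OF h]])
    qed (use h in simp)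
  qed (simp_all add: V)
  have "V (T h) = weighted_unitary r ?K P U (V h)" for h
  proof (cases "h \<in> carrier H")
    case True
    have a: "(\<alpha> h, 0, 0) \<in> carrier ?N" "(of_real r *\<^sub>C \<alpha> h, 0, 0) \<in> carrier ?N" "(\<alpha> (T h), 0, 0) \<in> carrier ?N"
      and b: "(\<beta> h, 0, 0) \<in> carrier ?N" "(of_real (1 / r) *\<^sub>C \<beta> h, 0, 0) \<in> carrier ?N"
      using True by (auto intro!: emb(1))
    have eq: "of_real r *\<^sub>C P (V h) + of_real (1 / r) *\<^sub>C (V h - P (V h)) =
        ((of_real r *\<^sub>C \<alpha> h, 0, 0), (of_real (1 / r) *\<^sub>C \<beta> h, 0, 0))"
      unfolding V[OF True] P[OF a(1) b(1)]
      by (simp add: zero_prod_def complex_vector.scale_zero_right)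
    \<comment> \<open>X sends \<beta> h / r to \<beta> T h and emits \<delta> h; the inverse of Z
      recombines r \<alpha> h and \<delta> h to \<alpha> T h.\<close>
    have "U ((of_real r *\<^sub>C \<alpha> h, 0, 0), (of_real (1 / r) *\<^sub>C \<beta> h, 0, 0)) =
        (Z' ((of_real r *\<^sub>C \<alpha> h, 0, 0), \<delta> h), (\<beta> (T h), 0, 0))"
      unfolding U[OF a(2) b(2)] X(2)[OF True] by simp
    also have "Z' ((of_real r *\<^sub>C \<alpha> h, 0, 0), \<delta> h) = (\<alpha> (T h), 0, 0)"
      using Z'(2)[OF a(3)] Z(2)[OF True] by simp
    also have "((\<alpha> (T h), 0, 0), (\<beta> (T h), 0, 0)) = V (T h)" by (rule V[symmetric]) (use True in simp)
    finally show ?thesis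
      unfolding weighted_unitary_def restrict_op_apply[OF V_closed[OF True]] eq by (rule sym)
  next
    case False
    have "T h = 0" by (rule op_outside[OF ips(1,1) T_bdd False])
    moreover have "V 0 = 0" "V h = 0"
      using False by (auto simp: V zero_prod_def) (simp add: V_def restrict_op_outside zero_prod_def)
    moreover have "weighted_unitary r ?K P U 0 = 0"
      using op_zero[OF ipsK ipsK P_bdd] op_zero[OF ipsK ipsK U_bdd] carrier_zero[OF ipsK]
      by (simp add: weighted_unitary_def restrict_op_apply)
    ultimately show ?thesis by simp
  qed
  then have "V \<circ> T = weighted_unitary r ?K P U \<circ> V" by (simp add: fun_eq_iff)
  then have "lifts_to H T ?K (weighted_unitary r ?K P U)" using iso by (auto simp: lifts_to_def)
  with model show thesis by (rule that)
qed

section \<open>Change of the ambient type\<close>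

text \<open>Injectivity and linearity suffice for changing the ambient type, as a Hilbert space
  carries its own inner product and the type itself has no topology.\<close>

definition linear_embedding :: "('a::complex_vector \<Rightarrow> 'b::complex_vector) \<Rightarrow> bool" where
  "linear_embedding \<phi> \<longleftrightarrow> inj \<phi> \<and> (\<forall>x y. \<phi> (x + y) = \<phi> x + \<phi> y) \<and> (\<forall>c x. \<phi> (c *\<^sub>C x) = c *\<^sub>C \<phi> x)"

lemma linear_embedding_id: "linear_embedding (\<lambda>x. x)"
  by (simp add: linear_embedding_def)

text \<open>Two sequences are interleaved: the first component occupies the even positions and the
  second the odd ones.\<close>

lemma linear_embedding_Pair:
  fixes \<phi> :: "'a::complex_vector \<Rightarrow> nat \<Rightarrow> 'c::complex_vector" and \<psi> :: "'b::complex_vector \<Rightarrow> nat \<Rightarrow> 'c"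
  assumes "linear_embedding \<phi>" "linear_embedding \<psi>"
  shows "linear_embedding (\<lambda>p n. if even n then \<phi> (fst p) (n div 2) else \<psi> (snd p) (n div 2))" (is "linear_embedding ?\<theta>")
proof -
  have "p = q" if eq: "?\<theta> p = ?\<theta> q" for p q
  proof -
    have "\<phi> (fst p) n = \<phi> (fst q) n" "\<psi> (snd p) n = \<psi> (snd q) n" for n
      using fun_cong[OF eq, of "2 * n"] fun_cong[OF eq, of "Suc (2 * n)"] by simp_all
    then have "\<phi> (fst p) = \<phi> (fst q)" "\<psi> (snd p) = \<psi> (snd q)" by auto
    then show ?thesis using assms by (auto simp: linear_embedding_def inj_def prod_eq_iff)
  qed
  then show ?thesis using assms by (auto simp: linear_embedding_def inj_def fun_eq_iff)
qed

text \<open>A double sequence is flattened along the pairing bijection of the natural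
  numbers.\<close>

lemma linear_embedding_sequence:
  fixes \<phi> :: "'a::complex_vector \<Rightarrow> nat \<Rightarrow> 'c::complex_vector"
  assumes "linear_embedding \<phi>"
  shows "linear_embedding (\<lambda>f n. \<phi> (f (fst (prod_decode n))) (snd (prod_decode n)))" (is "linear_embedding ?\<theta>")
proof -
  have "f = g" if eq: "?\<theta> f = ?\<theta> g" for f g
  proof
    fix i
    have "\<phi> (f i) j = \<phi> (g i) j" for j
      using fun_cong[OF eq, of "prod_encode (i, j)"] by simp
    then have "\<phi> (f i) = \<phi> (g i)" by auto
    then show "f i = g i" using assms by (auto simp: linear_embedding_def inj_def)
  qed
  then show ?thesis using assms by (auto simp: linear_embedding_def inj_def fun_eq_iff)
qed

text \<open>Transport of structure: the inner product on the image is pulled back along the inverse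
  of \<phi>, and Cauchy sequences and limits correspond because \<phi> respects differences.\<close>

lemma hilbert_space_embedding:
  fixes K :: "'a::complex_vector chilbert" and \<phi> :: "'a \<Rightarrow> 'b::complex_vector"
  assumes K: "hilbert_space K" and \<phi>: "linear_embedding \<phi>"
  shows "\<exists>(L :: 'b chilbert) \<Phi>. hilbert_space L \<and> unitary_op L K \<Phi>"
proof -
  have ips [simp]: "inner_product_space K" using K by simp
  have inj: "\<phi> x = \<phi> y \<longleftrightarrow> x = y" and add: "\<phi> (x + y) = \<phi> x + \<phi> y" and scale: "\<phi> (c *\<^sub>C x) = c *\<^sub>C \<phi> x" for x y c
    using \<phi> by (auto simp: linear_embedding_def inj_def)
  have zero: "\<phi> 0 = 0" using scale[of 0 0] by simp
  have diff: "\<phi> (x - y) = \<phi> x - \<phi> y" for x y using add[of "x - y" y] by simp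
  have inv_\<phi> [simp]: "inv \<phi> (\<phi> x) = x" for x using \<phi> by (simp add: linear_embedding_def)
  define L where "L = \<lparr>carrier = \<phi> ` carrier K, cinner = \<lambda>u v. cinner K (inv \<phi> u) (inv \<phi> v)\<rparr>"
  have carrier: "carrier L = \<phi> ` carrier K" and cinner: "cinner L (\<phi> x) (\<phi> y) = cinner K x y"
    and norm: "hnorm L (\<phi> x) = hnorm K x" for x y
    by (simp_all add: L_def hnorm_def)
  have elem: "\<exists>x\<in>carrier K. u = \<phi> x" if "u \<in> carrier L" for u
    using that by (auto simp: carrier)
  have "0 \<in> carrier L" unfolding carrier using zero carrier_zero[OF ips] by (metis image_eqI)
  moreover have "u + v \<in> carrier L" if "u \<in> carrier L" "v \<in> carrier L" for u v
    using elem[OF that(1)] elem[OF that(2)] by (auto simp: carrier simp flip: add)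
  moreover have "c *\<^sub>C u \<in> carrier L" if "u \<in> carrier L" for c u
    using elem[OF that] by (auto simp: carrier simp flip: scale)
  ultimately have "complex_vector.subspace (carrier L)"
    unfolding complex_vector.subspace_def by blast
  moreover have "cinner L (u + v) w = cinner L u w + cinner L v w"
    if "u \<in> carrier L" "v \<in> carrier L" "w \<in> carrier L" for u v w
    using elem[OF that(1)] elem[OF that(2)] elem[OF that(3)] by (auto simp: cinner cinner_linear simp flip: add)
  moreover have "cinner L (c *\<^sub>C u) v = c * cinner L u v" if "u \<in> carrier L" "v \<in> carrier L" for c u v
    using elem[OF that(1)] elem[OF that(2)] by (auto simp: cinner cinner_linear simp flip: scale)
  moreover have "cinner L v u = cnj (cinner L u v)" if uv: "u \<in> carrier L" "v \<in> carrier L" for u v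
  proof -
    obtain x y where xy: "x \<in> carrier K" "y \<in> carrier K" "u = \<phi> x" "v = \<phi> y" using elem uv by blast
    show ?thesis unfolding xy cinner by (rule cinner_commute[OF ips xy(1,2)])
  qed
  moreover have "0 \<le> Re (cinner L u u)" if "u \<in> carrier L" for u
    using elem[OF that] by (auto simp: cinner cinner_ge_zero)
  moreover have "u = 0" if "u \<in> carrier L" "cinner L u u = 0" for u
    using elem[OF that(1)] that(2) by (auto simp: cinner cinner_self zero)
  ultimately have ipsL: "inner_product_space L"
    unfolding inner_product_space_def by blast
  have "\<exists>u\<in>carrier L. (\<lambda>n. hnorm L (X n - u)) \<longlonglongrightarrow> 0"
    if X: "\<And>n. X n \<in> carrier L" and Cauchy: "\<forall>e>0. \<exists>N. \<forall>m\<ge>N. \<forall>n\<ge>N. hnorm L (X m - X n) < e" for X :: "nat \<Rightarrow> 'b"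
  proof -
    obtain Y where Y: "\<And>n. Y n \<in> carrier K" "\<And>n. X n = \<phi> (Y n)"
      using X unfolding carrier image_iff by metis
    have Cauchy': "\<exists>N. \<forall>m\<ge>N. \<forall>n\<ge>N. hnorm K (Y m - Y n) < e" if "e > 0" for e
      using Cauchy that by (simp add: Y(2) norm flip: diff)
    obtain y where "y \<in> carrier K" "(\<lambda>n. hnorm K (Y n - y)) \<longlonglongrightarrow> 0"
      by (rule hilbert_space_complete[OF K Y(1) Cauchy'], assumption, rule that)
    then show ?thesis by (intro bexI[of _ "\<phi> y"]) (auto simp: Y(2) norm carrier simp flip: diff)
  qed
  then have L: "hilbert_space L" unfolding hilbert_space_def using ipsL by blast
  have "unitary_op L K (restrict_op (carrier L) (inv \<phi>))"
    by (rule unitary_of_adjoint_inverse[OF ipsL ips, where U' = \<phi>])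
      (auto simp: carrier restrict_op_apply restrict_op_outside cinner L_def)
  then show ?thesis using L by blast
qed

lemma PA_lifts_scrPA:
  fixes H :: "'a::complex_vector chilbert"
  assumes r: "0 < r" "r < 1" and T: "T \<in> PA r H"
  shows "\<exists>(K :: (nat \<Rightarrow> 'a) chilbert) J. J \<in> scrPA r K \<and> lifts_to H T K J"
proof -
  obtain K :: "('a lifting_half \<times> 'a lifting_half) chilbert" and P U U'
    where model: "triangular_unitary K P U U'" and lift: "lifts_to H T K (weighted_unitary r K P U)"
    by (rule PA_lifts[OF r T], rule that)
  interpret annulus_model r K P U U' by unfold_locales (use r model in auto)
  obtain V where V: "isometry H K V" and VT: "V \<circ> T = J \<circ> V" using lift by (auto simp: lifts_to_def)
  have H: "inner_product_space H" using T by (auto simp: PA_iff[OF r])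
  \<comment> \<open>One half of the lift consists of two sequences and one double sequence over 'a;
    a pair of two such halves is coded once more by interleaving.\<close>
  note component = linear_embedding_Pair[OF linear_embedding_id
      linear_embedding_Pair[OF linear_embedding_id linear_embedding_sequence[OF linear_embedding_id]]]
  obtain L :: "(nat \<Rightarrow> 'a) chilbert" and \<Phi> where L: "hilbert_space L" and \<Phi>: "unitary_op L K \<Phi>"
    using hilbert_space_embedding[OF hilbert linear_embedding_Pair[OF component component]] by blast
  have ipsL: "inner_product_space L" using L by simp
  obtain \<Psi> where \<Psi>: "unitary_op K L \<Psi>" "\<And>x. x \<in> carrier L \<Longrightarrow> \<Psi> (\<Phi> x) = x"
    "\<And>y. y \<in> carrier K \<Longrightarrow> \<Phi> (\<Psi> y) = y"
    by (rule unitary_op_inverse[OF ipsL ips \<Phi>], rule that)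
  have bdd: "\<Phi> \<in> bounded_ops L K" "\<Psi> \<in> bounded_ops K L" and iso\<Psi>: "isometry K L \<Psi>"
    using \<Phi> \<Psi>(1) by (auto simp: unitary_op_def isometry_def)
  note V_bdd = isometry_bounded[OF H ips V]
  define J' where "J' = \<Psi> \<circ> J \<circ> \<Phi>"
  have J'_bdd: "J' \<in> bounded_ops L L"
    unfolding J'_def by (intro comp_bounded[OF ipsL ips ipsL] comp_bounded[OF ips ips ipsL] bdd J_bounded)
  have "\<Phi> \<circ> J' = J \<circ> \<Phi>"
    by (rule bounded_ops_eqI[OF comp_bounded[OF ipsL ipsL ips bdd(1) J'_bdd] comp_bounded[OF ipsL ips ips J_bounded bdd(1)]])
      (simp add: J'_def \<Psi>(3) op_closed[OF ipsL ips bdd(1)])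
  then have "J' \<in> scrPA r L"
    using triangular_unitary_transport[OF r model L \<Phi> J'_bdd] scrPA_iff[OF r] by blast
  moreover have "isometry H L (\<Psi> \<circ> V)"
    using comp_bounded[OF H ips ipsL bdd(2) V_bdd] isometry_hnorm[OF H ips V] isometry_hnorm[OF ips ipsL iso\<Psi>]
      op_closed[OF H ips V_bdd]
    by (simp add: isometry_def)
  moreover have "(\<Psi> \<circ> V) \<circ> T = J' \<circ> (\<Psi> \<circ> V)"
  proof (rule ext)
    fix h
    have "V h \<in> carrier K"
      using op_closed[OF H ips V_bdd] op_outside[OF H ips V_bdd] ips by (cases "h \<in> carrier H") auto
    then show "((\<Psi> \<circ> V) \<circ> T) h = (J' \<circ> (\<Psi> \<circ> V)) h"
      using fun_cong[OF VT, of h] by (simp add: J'_def \<Psi>(3))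
  qed
  ultimately show ?thesis unfolding lifts_to_def by blast
qed

lemma scrPA_lifts_imp_dilates:
  fixes H :: "'a::complex_vector chilbert" and K :: "'b::complex_vector chilbert"
  assumes r: "0 < r" "r < 1" and H: "hilbert_space H" and T: "invertible_op H T"
    and J: "J \<in> scrPA r K" and lift: "lifts_to H T K J"
  shows "dilates_to H T K J"
proof -
  have "J \<in> PA r K" using scrPA_subset_PA[OF r] J by blast
  then show ?thesis using lifts_imp_dilates[OF H _ T _ lift] by (auto simp: PA_iff[OF r])
qed

text \<open>A quantifier over Hilbert spaces ranges over one ambient type. Existence is therefore
  claimed over \<open>nat => 'a\<close>, while the converse implications are stated in addition over
  an arbitrary ambient type \<open>'k\<close>.\<close>

theorem corollary1p4:
  fixes r :: real
  assumes "0 < r" and "r < 1"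
  shows
    "(\<forall>(H :: 'a::complex_vector chilbert) T. hilbert_space H \<and> invertible_op H T \<longrightarrow>
        (T \<in> PA r H \<longleftrightarrow> (\<exists>(K :: (nat \<Rightarrow> 'a) chilbert) Y. Y \<in> PA r K \<and> dilates_to H T K Y)) \<and>
        (T \<in> PA r H \<longleftrightarrow> (\<exists>(K :: (nat \<Rightarrow> 'a) chilbert) J. J \<in> scrPA r K \<and> lifts_to H T K J)) \<and>
        ((\<exists>(K :: 'k::complex_vector chilbert) Y. Y \<in> PA r K \<and> dilates_to H T K Y) \<longrightarrow> T \<in> PA r H) \<and>
        ((\<exists>(K :: 'k chilbert) J. J \<in> scrPA r K \<and> lifts_to H T K J) \<longrightarrow> T \<in> PA r H))
   \<and> (\<forall>(K :: 'b::complex_vector chilbert) J. J \<in> scrPA r K \<longrightarrow>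
        (\<forall>(G :: 'c::complex_vector chilbert) Y V.
           Y \<in> PA r G \<and> dilation K J G Y V \<longrightarrow> trivial_dilation K G Y V))
   \<and> (\<forall>(I :: 'i set) (K :: 'i \<Rightarrow> 'd::complex_vector chilbert) J.
        (\<forall>i\<in>I. J i \<in> scrPA r (K i)) \<longrightarrow> sum_op I K J \<in> scrPA r (hsum I K))
   \<and> (\<forall>(K :: 'e::complex_vector chilbert) (G :: 'f::complex_vector chilbert) J \<pi>.
        J \<in> scrPA r K \<and> hilbert_space G \<and> unital_star_rep K G \<pi> \<longrightarrow> \<pi> J \<in> scrPA r G)
   \<and> (\<forall>(K :: 'g::complex_vector chilbert) J M.
        J \<in> scrPA r K \<and> closed_subspace K M \<and> reduces K M J \<longrightarrow>
        restrict_op M J \<in> scrPA r (sub_hilbert K M))"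
proof (intro conjI allI impI)
  note r = assms
  {
    fix H :: "'a chilbert" and T
    assume HT: "hilbert_space H \<and> invertible_op H T"
    then have H: "hilbert_space H" and T: "invertible_op H T" by auto
    \<comment> \<open>The equivalences close a circle: an element of \<open>PA\<close> lifts to
      \<open>scrPA\<close>, a lifting is a dilation to an element of \<open>PA\<close>, and
      compression leads back to \<open>PA\<close>.\<close>
    show "T \<in> PA r H \<longleftrightarrow> (\<exists>(K :: (nat \<Rightarrow> 'a) chilbert) J. J \<in> scrPA r K \<and> lifts_to H T K J)"
      using PA_lifts_scrPA[OF r] dilates_to_PA_imp_PA[OF r H] scrPA_lifts_imp_dilates[OF r H T] scrPA_subset_PA[OF r]
      unfolding dilates_to_def by blast
    show "T \<in> PA r H \<longleftrightarrow> (\<exists>(K :: (nat \<Rightarrow> 'a) chilbert) Y. Y \<in> PA r K \<and> dilates_to H T K Y)"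
      using PA_lifts_scrPA[OF r] dilates_to_PA_imp_PA[OF r H] scrPA_lifts_imp_dilates[OF r H T] scrPA_subset_PA[OF r]
      unfolding dilates_to_def by blast
    show "T \<in> PA r H" if "\<exists>(K :: 'k chilbert) Y. Y \<in> PA r K \<and> dilates_to H T K Y"
      using that dilates_to_PA_imp_PA[OF r H] unfolding dilates_to_def by blast
    show "T \<in> PA r H" if "\<exists>(K :: 'k chilbert) J. J \<in> scrPA r K \<and> lifts_to H T K J"
      using that dilates_to_PA_imp_PA[OF r H] scrPA_lifts_imp_dilates[OF r H T] scrPA_subset_PA[OF r]
      unfolding dilates_to_def by blast
  }
next
  note r = assms
  fix K :: "'b chilbert" and J and G :: "'c chilbert" and Y V
  assume J: "J \<in> scrPA r K" and Y: "Y \<in> PA r G \<and> dilation K J G Y V"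
  obtain P U U' where "annulus_model r K P U U'" "J = weighted_unitary r K P U" by (rule scrPA_cases[OF r J])
  then show "trivial_dilation K G Y V" using annulus_model.dilation_extremal Y by blast
next
  note r = assms
  fix I :: "'i set" and K :: "'i \<Rightarrow> 'd chilbert" and J
  assume "\<forall>i\<in>I. J i \<in> scrPA r (K i)"
  then show "sum_op I K J \<in> scrPA r (hsum I K)" by (intro scrPA_hsum[OF r]) blast
next
  note r = assms
  fix K :: "'e chilbert" and G :: "'f chilbert" and J \<pi>
  assume *: "J \<in> scrPA r K \<and> hilbert_space G \<and> unital_star_rep K G \<pi>"
  then have J: "J \<in> scrPA r K" by blast
  obtain P U U' where "annulus_model r K P U U'" "J = weighted_unitary r K P U" by (rule scrPA_cases[OF r J])
  then show "\<pi> J \<in> scrPA r G" using annulus_model.scrPA_star_rep * by blast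
next
  note r = assms
  fix K :: "'g chilbert" and J M
  assume *: "J \<in> scrPA r K \<and> closed_subspace K M \<and> reduces K M J"
  then have J: "J \<in> scrPA r K" by blast
  obtain P U U' where "annulus_model r K P U U'" "J = weighted_unitary r K P U" by (rule scrPA_cases[OF r J])
  then show "restrict_op M J \<in> scrPA r (sub_hilbert K M)" using annulus_model.scrPA_restrict * by blast
qed

end
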